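(* Let $\mu,\nu$ be compactly supported probability measures on $\mathbb{R}$ and let $X_1,X_2\in\mathcal B(\mathcal H)$ be bounded self-adjoint random variables, free with respect to the vacuum state $\varphi$, realized on the free product Hilbert space $\mathcal H$ as in the context, with $\varphi$-distributions $\mu$ and $\nu$, respectively. In the decomposition $X_1+X_2=B_1+B_2$, the free branches $B_1$ and $B_2$ are boolean independent with respect to $\varphi$. Therefore $$\mu\boxplus\nu=(\mu\boxplus_s\nu)\uplus(\nu\boxplus_s\mu)$$ is the corresponding decomposition of the free additive convolution.
   Context: Free product: for Hilbert spaces with unit vectors $(\mathcal H_1,\xi_1),(\mathcal H_2,\xi_2)$ put $\mathcal H_i^0=\mathcal H_i\ominus\mathbb{C}\xi_i$ and $\mathcal H=\mathbb{C}\xi\oplus\bigoplus_{n\ge1}\bigoplus_{i_1\ne\cdots\ne i_n}\mathcal H_{i_1}^0\otimes\cdots\otimes\mathcal H_{i_n}^0$ (indices in $\{1,2\}$, $\xi$ a unit vector); $\varphi(\cdot)=\langle\cdot\,\xi,\xi\rangle$. For $j\in\{1,2\}$ let $\bar j$ be the other index, $\mathcal H^{(0)}(j)=\mathbb{C}\xi$, and for $n\ge1$ let $\mathcal H^{(n)}(j)$ be the sum of those $\mathcal H_{i_1}^0\otimes\cdots\otimes\mathcal H_{i_n}^0$ with $i_1\ne\cdots\ne i_n$ and $i_1\ne j$; $\mathcal H(j)=\bigoplus_{n\ge1}\mathcal H^{(n)}(j)$. The representation $\lambda_j:\mathcal B(\mathcal H_j)\to\mathcal B(\mathcal H)$ is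 $\lambda_j(a)(h_1\otimes h)=(ah_1)^0\otimes h+\langle ah_1,\xi_j\rangle h$ for $h_1\in\mathcal H_j$, $h\in\mathbb{C}\xi\oplus\mathcal H(j)$, where $v^0$ is the projection of $v$ onto $\mathcal H_j^0$ and $\xi_j\otimes h\equiv h$, $h_1\otimes\xi\equiv h_1$. Let $x_j\in\mathcal B(\mathcal H_j)$ be self-adjoint, with distributions $\mu$ ($j=1$) and $\nu$ ($j=2$) in the vector states of $\xi_1,\xi_2$, and $X_j=\lambda_j(x_j)$; these are free w.r.t. $\varphi$. Let $P_j(n)$ be the orthogonal projection onto $\mathcal H^{(n-1)}(j)\oplus\mathcal H^{(n)}(\bar j)$ and $X_j(n)=P_j(n)X_jP_j(n)$, $n\ge1$. Free branches: $B_j=\sum_{r\ge0}X_j(2r+1)+\sum_{r\ge0}X_{\bar j}(2r+2)$ (strongly convergent), $j=1,2$. s-free convolution (written here $\boxplus_s$): $\mu\boxplus_s\nu$ is the $\varphi$-distribution of $\sum_{r\ge0}X_1(2r+1)+\sum_{r\ge1}X_2(2r)$; it depends only on $\mu,\nu$, and $\nu\boxplus_s\mu$ is obtained by interchanging the roles of the two variables. Boolean independence of $b_1,b_2$ w.r.t. $\varphi$: $\varphi(c_1c_2\cdots c_n)=\varphi(c_1)\cdots\varphi(c_n)$ whenever $c_k$ belongs to the non-unital algebra generated by $b_{i_k}$ and $i_1\ne i_2\ne\cdots\ne i_n$. The boolean convolution $\mu\uplus\nu$ is the unique probability measure with $K_{\mu\uplus\nu}=K_\mu+K_\nu$ on $\mathbb{C}^+$,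 where $K_\mu(z)=z-1/G_\mu(z)$, $G_\mu(z)=\int\frac{\mu(dx)}{z-x}$; it is the distribution of the sum of boolean independent variables with distributions $\mu,\nu$. $\boxplus$ is Voiculescu's free additive convolution. *)

theory Defs
  imports "HOL-Probability.Probability"
begin

section \<open>Complex Hilbert spaces and bounded operators\<close>

text \<open>The inner product is linear in the first argument and conjugate-linear in the second.
  Definiteness follows from the axiom relating it to the (complete) norm.\<close>

class chilbert_space = banach +
  fixes scaleC :: "complex \<Rightarrow> 'a \<Rightarrow> 'a"  (infixr \<open>*\<^sub>C\<close> 75)
    and cinner :: "'a \<Rightarrow> 'a \<Rightarrow> complex"
  assumes scaleC_add_right: "c *\<^sub>C (x + y) = c *\<^sub>C x + c *\<^sub>C y"
    and scaleC_add_left: "(c + d) *\<^sub>C x = c *\<^sub>C x + d *\<^sub>C x"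
    and scaleC_scaleC: "c *\<^sub>C d *\<^sub>C x = (c * d) *\<^sub>C x"
    and scaleC_of_real: "complex_of_real r *\<^sub>C x = r *\<^sub>R x"
    and cinner_commute: "cinner x y = cnj (cinner y x)"
    and cinner_add_left: "cinner (x + y) z = cinner x z + cinner y z"
    and cinner_scaleC_left: "cinner (c *\<^sub>C x) y = c * cinner x y"
    and cinner_self: "cinner x x = complex_of_real ((norm x)\<^sup>2)"

global_interpretation cvec: vector_space "scaleC :: complex \<Rightarrow> 'a \<Rightarrow> 'a::chilbert_space"
  defines cspan = cvec.span
proof
  show "1 *\<^sub>C x = x" for x :: 'a
    using scaleC_of_real[of 1 x] by simp
qed (simp_all add: scaleC_add_right scaleC_add_left scaleC_scaleC)

definition bounded_clinear :: "('a::chilbert_space \<Rightarrow> 'b::chilbert_space) \<Rightarrow> bool" where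
  "bounded_clinear f \<longleftrightarrow> bounded_linear f \<and> (\<forall>c x. f (c *\<^sub>C x) = c *\<^sub>C f x)"

definition bounded_selfadjoint :: "('a::chilbert_space \<Rightarrow> 'a) \<Rightarrow> bool" where
  "bounded_selfadjoint a \<longleftrightarrow>
     bounded_clinear a \<and> (\<forall>x y. cinner (a x) y = cinner x (a y))"

text \<open>Only used for closed subspaces \<open>M\<close>, for which the projection exists.\<close>

definition orth_proj :: "'a::chilbert_space set \<Rightarrow> 'a \<Rightarrow> 'a" where
  "orth_proj M x = (THE y. y \<in> M \<and> (\<forall>m\<in>M. cinner (x - y) m = 0))"

definition vector_state :: "'a::chilbert_space \<Rightarrow> ('a \<Rightarrow> 'a) \<Rightarrow> complex" where
  "vector_state \<xi> a = cinner (a \<xi>) \<xi>"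

definition compact_prob :: "real measure \<Rightarrow> bool" where
  "compact_prob \<rho> \<longleftrightarrow> real_distribution \<rho> \<and> (\<exists>R. AE x in \<rho>. \<bar>x\<bar> \<le> R)"

text \<open>The distribution of a bounded self-adjoint operator in a vector state: the compactly supported
  probability measure with the same moments.\<close>

definition has_distr ::
    "('a::chilbert_space \<Rightarrow> 'a) \<Rightarrow> 'a \<Rightarrow> real measure \<Rightarrow> bool" where
  "has_distr a \<xi> \<rho> \<longleftrightarrow> bounded_selfadjoint a \<and> compact_prob \<rho> \<and>
     (\<forall>n. vector_state \<xi> (a ^^ n) = complex_of_real (\<integral>x. x ^ n \<partial>\<rho>))"


section \<open>Alternating words, boolean independence and freeness\<close>

datatype idx = One | Two

primrec bar :: "idx \<Rightarrow> idx" where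
  "bar One = Two"
| "bar Two = One"

text \<open>Sequences of objects carrying an index in \<open>{1,2}\<close> are lists over a sum type,
  the summand recording the index.\<close>

primrec idx_of :: "'x + 'y \<Rightarrow> idx" where
  "idx_of (Inl _) = One"
| "idx_of (Inr _) = Two"

definition alternating :: "('x + 'y) list \<Rightarrow> bool" where
  "alternating w \<longleftrightarrow> successively (\<lambda>u v. idx_of u \<noteq> idx_of v) w"

text \<open>The non-unital algebra generated by a set of operators; the unital one generated by \<open>b\<close> is
  \<open>op_alg {id, b}\<close>.\<close>

inductive_set op_alg :: "('a::chilbert_space \<Rightarrow> 'a) set \<Rightarrow> ('a \<Rightarrow> 'a) set"
  for S :: "('a \<Rightarrow> 'a) set" where
  gen: "b \<in> S \<Longrightarrow> b \<in> op_alg S"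
| add: "a \<in> op_alg S \<Longrightarrow> b \<in> op_alg S \<Longrightarrow> (\<lambda>h. a h + b h) \<in> op_alg S"
| scale: "a \<in> op_alg S \<Longrightarrow> (\<lambda>h. c *\<^sub>C a h) \<in> op_alg S"
| mult: "a \<in> op_alg S \<Longrightarrow> b \<in> op_alg S \<Longrightarrow> a \<circ> b \<in> op_alg S"

primrec op_of :: "('a \<Rightarrow> 'a) + ('a \<Rightarrow> 'a) \<Rightarrow> 'a \<Rightarrow> 'a" where
  "op_of (Inl a) = a"
| "op_of (Inr a) = a"

definition op_product :: "(('a \<Rightarrow> 'a) + ('a \<Rightarrow> 'a)) list \<Rightarrow> 'a \<Rightarrow> 'a" where
  "op_product cs = foldr (\<lambda>c b. op_of c \<circ> b) cs id"

definition boolean_indep ::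
    "'a::chilbert_space \<Rightarrow> ('a \<Rightarrow> 'a) \<Rightarrow> ('a \<Rightarrow> 'a) \<Rightarrow> bool" where
  "boolean_indep \<xi> b1 b2 \<longleftrightarrow>
     (\<forall>cs. cs \<noteq> [] \<longrightarrow> alternating cs \<longrightarrow> set cs \<subseteq> op_alg {b1} <+> op_alg {b2} \<longrightarrow>
        vector_state \<xi> (op_product cs) = (\<Prod>c\<leftarrow>cs. vector_state \<xi> (op_of c)))"

definition free_indep ::
    "'a::chilbert_space \<Rightarrow> ('a \<Rightarrow> 'a) \<Rightarrow> ('a \<Rightarrow> 'a) \<Rightarrow> bool" where
  "free_indep \<xi> a b \<longleftrightarrow>
     (\<forall>cs. cs \<noteq> [] \<longrightarrow> alternating cs \<longrightarrow> set cs \<subseteq> op_alg {id, a} <+> op_alg {id, b} \<longrightarrow>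
        (\<forall>c\<in>set cs. vector_state \<xi> (op_of c) = 0) \<longrightarrow> vector_state \<xi> (op_product cs) = 0)"


section \<open>The free product of Hilbert spaces\<close>

text \<open>Throughout, \<open>\<xi>1\<close> and \<open>\<xi>2\<close> are unit vectors in the Hilbert spaces \<open>'a\<close> and \<open>'b\<close>.
  A reduced word is a list \<open>[h\<^sub>1, \<dots>, h\<^sub>n]\<close> of vectors with \<open>h\<^sub>k\<close> in the orthogonal
  complement of the distinguished vector of the space with index \<open>i\<^sub>k\<close>, and with adjacent
  indices distinct.\<close>

definition reduced :: "'a::chilbert_space \<Rightarrow> 'b::chilbert_space \<Rightarrow> ('a + 'b) list set" where
  "reduced \<xi>1 \<xi>2 = {w. alternating w \<and>
     (\<forall>u\<in>set w. case u of Inl a \<Rightarrow> cinner a \<xi>1 = 0 | Inr b \<Rightarrow> cinner b \<xi>2 = 0)}"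

fun letter_inner :: "'a::chilbert_space + 'b::chilbert_space \<Rightarrow> 'a + 'b \<Rightarrow> complex" where
  "letter_inner (Inl a) (Inl a') = cinner a a'"
| "letter_inner (Inr b) (Inr b') = cinner b b'"
| "letter_inner _ _ = 0"

text \<open>The Hilbert space \<open>'h\<close> is the free product: \<open>T [h\<^sub>1, \<dots>, h\<^sub>n]\<close> is the elementary tensor
  \<open>h\<^sub>1 \<otimes> \<dots> \<otimes> h\<^sub>n\<close> and \<open>T [] = \<xi>\<close>.  The inner products of elementary tensors are the
  usual ones, summands with different index sequences being orthogonal (then some factor vanishes),
  and the elementary tensors are total.  These conditions imply that \<open>T\<close> is multilinear on each
  summand, and they determine \<open>('h, \<xi>, T)\<close> up to a unique unitary, as usual for completed
  tensor products.\<close>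

definition free_product_space ::
    "'a::chilbert_space \<Rightarrow> 'b::chilbert_space \<Rightarrow> 'h::chilbert_space \<Rightarrow>
     (('a + 'b) list \<Rightarrow> 'h) \<Rightarrow> bool" where
  "free_product_space \<xi>1 \<xi>2 \<xi> T \<longleftrightarrow>
     norm \<xi>1 = 1 \<and> norm \<xi>2 = 1 \<and> T [] = \<xi> \<and>
     (\<forall>w\<in>reduced \<xi>1 \<xi>2. \<forall>w'\<in>reduced \<xi>1 \<xi>2. cinner (T w) (T w') =
        (if length w = length w' then \<Prod>k<length w. letter_inner (w ! k) (w' ! k) else 0)) \<and>
     closure (cspan (T ` reduced \<xi>1 \<xi>2)) = UNIV"

text \<open>\<open>level \<xi>1 \<xi>2 T j n\<close> is \<open>H\<^sup>(\<^sup>n\<^sup>)(j)\<close>.\<close>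

definition level ::
    "'a::chilbert_space \<Rightarrow> 'b::chilbert_space \<Rightarrow> (('a + 'b) list \<Rightarrow> 'h::chilbert_space) \<Rightarrow>
     idx \<Rightarrow> nat \<Rightarrow> 'h set" where
  "level \<xi>1 \<xi>2 T j n = closure (cspan
     (T ` {w \<in> reduced \<xi>1 \<xi>2. length w = n \<and> (w \<noteq> [] \<longrightarrow> idx_of (hd w) \<noteq> j)}))"

text \<open>With \<open>e = \<xi>\<^sub>j\<close> and \<open>\<iota>\<close> the injection \<open>Inl\<close> or \<open>Inr\<close> of the letters of index \<open>j\<close>, this is
  \<open>h\<^sub>1 \<otimes> T w\<close> for \<open>h\<^sub>1\<close> in the whole of \<open>H\<^sub>j\<close> and \<open>w\<close> not starting with index \<open>j\<close>, under the
  identification of \<open>\<xi>\<^sub>j \<otimes> h\<close> with \<open>h\<close> and of \<open>h\<^sub>1 \<otimes> \<xi>\<close> with \<open>h\<^sub>1\<close>.\<close>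

definition left_tensor ::
    "'k::chilbert_space \<Rightarrow> ('k \<Rightarrow> 'a + 'b) \<Rightarrow> (('a + 'b) list \<Rightarrow> 'h::chilbert_space) \<Rightarrow>
     'k \<Rightarrow> ('a + 'b) list \<Rightarrow> 'h" where
  "left_tensor e \<iota> T h1 w = T (\<iota> (h1 - cinner h1 e *\<^sub>C e) # w) + cinner h1 e *\<^sub>C T w"

text \<open>\<open>A = \<lambda>\<^sub>j(a)\<close>: the defining formula on the total set of vectors \<open>h\<^sub>1 \<otimes> T w\<close>, which
  determines the bounded operator \<open>A\<close> uniquely.  Note that \<open>left_tensor e \<iota> T (a h1) w\<close> is
  \<open>(a h\<^sub>1)\<^sup>0 \<otimes> T w + \<langle>a h\<^sub>1, \<xi>\<^sub>j\<rangle> T w\<close>.\<close>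

definition is_lambda ::
    "'a::chilbert_space \<Rightarrow> 'b::chilbert_space \<Rightarrow> (('a + 'b) list \<Rightarrow> 'h::chilbert_space) \<Rightarrow>
     'k::chilbert_space \<Rightarrow> ('k \<Rightarrow> 'a + 'b) \<Rightarrow> ('k \<Rightarrow> 'k) \<Rightarrow> ('h \<Rightarrow> 'h) \<Rightarrow> bool" where
  "is_lambda \<xi>1 \<xi>2 T e \<iota> a A \<longleftrightarrow> bounded_clinear A \<and>
     (\<forall>h1. \<forall>w\<in>reduced \<xi>1 \<xi>2. (w \<noteq> [] \<longrightarrow> idx_of (hd w) \<noteq> idx_of (\<iota> h1)) \<longrightarrow>
        A (left_tensor e \<iota> T h1 w) = left_tensor e \<iota> T (a h1) w)"

text \<open>Self-adjoint \<open>x1\<close>, \<open>x2\<close> with distributions \<open>\<mu>\<close>, \<open>\<nu>\<close> in the states of \<open>\<xi>1\<close>, \<open>\<xi>2\<close>, and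
  \<open>X j = \<lambda>\<^sub>j(x\<^sub>j)\<close> on the free product Hilbert space.\<close>

definition free_realization ::
    "real measure \<Rightarrow> real measure \<Rightarrow>
     'a::chilbert_space \<Rightarrow> 'b::chilbert_space \<Rightarrow> 'h::chilbert_space \<Rightarrow>
     (('a + 'b) list \<Rightarrow> 'h) \<Rightarrow> ('a \<Rightarrow> 'a) \<Rightarrow> ('b \<Rightarrow> 'b) \<Rightarrow> (idx \<Rightarrow> 'h \<Rightarrow> 'h) \<Rightarrow> bool" where
  "free_realization \<mu> \<nu> \<xi>1 \<xi>2 \<xi> T x1 x2 X \<longleftrightarrow>
     free_product_space \<xi>1 \<xi>2 \<xi> T \<and>
     has_distr x1 \<xi>1 \<mu> \<and> has_distr x2 \<xi>2 \<nu> \<and>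
     is_lambda \<xi>1 \<xi>2 T \<xi>1 Inl x1 (X One) \<and> is_lambda \<xi>1 \<xi>2 T \<xi>2 Inr x2 (X Two)"

text \<open>The operator \<open>X\<^sub>j(n)\<close>, for \<open>n \<ge> 1\<close>.  The set projected onto is the sum of two orthogonal
  closed subspaces.\<close>

definition block ::
    "'a::chilbert_space \<Rightarrow> 'b::chilbert_space \<Rightarrow> (('a + 'b) list \<Rightarrow> 'h::chilbert_space) \<Rightarrow>
     (idx \<Rightarrow> 'h \<Rightarrow> 'h) \<Rightarrow> idx \<Rightarrow> nat \<Rightarrow> 'h \<Rightarrow> 'h" where
  "block \<xi>1 \<xi>2 T X j n =
     (let P = orth_proj {u + v |u v. u \<in> level \<xi>1 \<xi>2 T j (n - 1) \<and> v \<in> level \<xi>1 \<xi>2 T (bar j) n}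
      in P \<circ> X j \<circ> P)"

definition free_branch ::
    "'a::chilbert_space \<Rightarrow> 'b::chilbert_space \<Rightarrow> (('a + 'b) list \<Rightarrow> 'h::chilbert_space) \<Rightarrow>
     (idx \<Rightarrow> 'h \<Rightarrow> 'h) \<Rightarrow> idx \<Rightarrow> 'h \<Rightarrow> 'h" where
  "free_branch \<xi>1 \<xi>2 T X j h =
     (\<Sum>r. block \<xi>1 \<xi>2 T X j (2 * r + 1) h) + (\<Sum>r. block \<xi>1 \<xi>2 T X (bar j) (2 * r + 2) h)"


section \<open>Convolutions\<close>

text \<open>The free and s-free convolutions are distributions of operators that depend only on the
  distributions of the two variables.  The type argument names the Hilbert spaces on which the
  variables are realized, since the definitions cannot quantify over types.\<close>

definition free_conv ::
    "'h::chilbert_space itself \<Rightarrow> real measure \<Rightarrow> real measure \<Rightarrow> real measure" where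
  "free_conv _ \<mu> \<nu> = (THE \<rho>. \<exists>(\<xi>::'h) a b. norm \<xi> = 1 \<and> free_indep \<xi> a b \<and>
     has_distr a \<xi> \<mu> \<and> has_distr b \<xi> \<nu> \<and> has_distr (\<lambda>h. a h + b h) \<xi> \<rho>)"

definition s_free_conv ::
    "('a::chilbert_space \<times> 'b::chilbert_space \<times> 'h::chilbert_space) itself \<Rightarrow>
     real measure \<Rightarrow> real measure \<Rightarrow> real measure" where
  "s_free_conv _ \<mu> \<nu> = (THE \<rho>. \<exists>(\<xi>1::'a) (\<xi>2::'b) (\<xi>::'h) T x1 x2 X.
     free_realization \<mu> \<nu> \<xi>1 \<xi>2 \<xi> T x1 x2 X \<and>
     has_distr (\<lambda>h. (\<Sum>r. block \<xi>1 \<xi>2 T X One (2 * r + 1) h) +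
                    (\<Sum>r. block \<xi>1 \<xi>2 T X Two (2 * (r + 1)) h)) \<xi> \<rho>)"

definition cauchy_transform :: "real measure \<Rightarrow> complex \<Rightarrow> complex" where
  "cauchy_transform \<mu> z = (\<integral>x. 1 / (z - complex_of_real x) \<partial>\<mu>)"

definition K_transform :: "real measure \<Rightarrow> complex \<Rightarrow> complex" where
  "K_transform \<mu> z = z - 1 / cauchy_transform \<mu> z"

definition boolean_conv :: "real measure \<Rightarrow> real measure \<Rightarrow> real measure"  (infixl \<open>\<uplus>\<close> 65) where
  "\<mu> \<uplus> \<nu> = (THE \<rho>. real_distribution \<rho> \<and>
     (\<forall>z. Im z > 0 \<longrightarrow> K_transform \<rho> z = K_transform \<mu> z + K_transform \<nu> z))"

end

theory Submission
  imports Defs "HOL-Complex_Analysis.Complex_Analysis"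
begin

text \<open>
  The free product space is the orthogonal sum of tensor products indexed by alternating index
  lists, and every assertion below comes down to which of these summands an operator sees.

  The operator \<open>X j\<close> changes an elementary tensor only at its first letter: it acts on the pair
  formed by a tensor \<open>w\<close> not starting with index \<open>j\<close> and the tensors \<open>h \<otimes> w\<close> with \<open>h\<close> in the
  space of index \<open>j\<close>.  Hence it commutes with the projection onto any family of summands that
  contains both types or neither (\<open>proj_lambda_commute\<close>); the projections \<open>P\<^sub>j(n)\<close> are of this kind,
  so \<open>X\<^sub>j(n) = X\<^sub>j P\<^sub>j(n)\<close>, and the strong convergence of \<open>\<Sum>X\<^sub>j(n)\<close> is that of the projections.
  Counting parities, the types covered by \<open>P\<^sub>j(1), P\<^sub>j(3), \<dots>\<close> are the empty one and those ending in
  \<open>j\<close>, and the types covered by \<open>P\<^sub>j(2), P\<^sub>j(4), \<dots>\<close> are those ending in the other index.  The branch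
  \<open>B\<^sub>j\<close> is therefore \<open>X\<^sub>1 + X\<^sub>2\<close> on tensors whose last letter has index \<open>j\<close>, is \<open>X\<^sub>j\<close> on \<open>\<xi>\<close>, and
  vanishes on tensors whose last letter has the other index.  This gives \<open>X\<^sub>1 + X\<^sub>2 = B\<^sub>1 + B\<^sub>2\<close>, and
  \<open>B\<^sub>1\<close>, \<open>B\<^sub>2\<close> live on two subspaces that meet only in \<open>\<complex>\<xi>\<close>, which is the standard model of
  boolean independence (\<open>boolean_indepI\<close>).

  For the convolutions one needs distributions to exist and to depend only on \<open>\<mu>\<close> and \<open>\<nu>\<close>.
  Existence (\<open>has_distr_exists\<close>) is Hausdorff's solution of the moment problem, applied to a
  self-adjoint operator rescaled to lie between 0 and 1.  For the dependence, apply words in the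
  centered powers \<open>x^k - m\<^sub>k\<close> to \<open>\<xi>\<close>: the operators act on the resulting vectors by formulas whose
  only coefficients are the moments \<open>m\<^sub>k\<close>, both in the free product and for any free pair
  (\<open>word_model_moments_eq\<close>).

  Finally, the boolean convolution is recognized by its \<open>K\<close>-transform.  If \<open>u\<^sub>i = (z - B\<^sub>i)\<^sup>-\<^sup>1 \<xi>\<close> and
  \<open>G\<^sub>i\<close> is the Cauchy transform of \<open>B\<^sub>i\<close>, then \<open>v = u\<^sub>1/G\<^sub>1 + u\<^sub>2/G\<^sub>2 - \<xi>\<close> satisfies
  \<open>(z - B\<^sub>1 - B\<^sub>2) v = (1/G\<^sub>1 + 1/G\<^sub>2 - z) \<xi>\<close> and \<open>\<langle>v, \<xi>\<rangle> = 1\<close>, because each \<open>B\<^sub>i\<close> sees of the other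
  resolvent vector only its component along \<open>\<xi>\<close>.  So \<open>1/G = 1/G\<^sub>1 + 1/G\<^sub>2 - z\<close>, which is the
  additivity of \<open>K\<close> for large \<open>z\<close> (\<open>K_transform_additive\<close>); analytic continuation and the injectivity
  of the Cauchy transform (\<open>cauchy_transform_inj\<close>) do the rest.
\<close>


section \<open>Hilbert spaces and bounded operators\<close>

lemma cinner_add_right: "cinner x (y + z) = cinner x y + cinner x z"
  by (metis cinner_add_left cinner_commute complex_cnj_add)

lemma cinner_scaleC_right: "cinner x (c *\<^sub>C y) = cnj c * cinner x y"
  by (metis cinner_scaleC_left cinner_commute complex_cnj_mult)

lemma cinner_zero_left [simp]: "cinner 0 x = 0"
  using cinner_add_left[of 0 0 x] by simp

lemma cinner_zero_right [simp]: "cinner x 0 = 0"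
  by (metis cinner_commute cinner_zero_left complex_cnj_zero)

lemma scaleC_minus1: "(- 1) *\<^sub>C x = - (x :: 'a::chilbert_space)"
  using scaleC_of_real[of "-1" x] by simp

lemma cinner_minus_left: "cinner (- x) y = - cinner x y"
  by (metis add.right_inverse add_eq_0_iff cinner_add_left cinner_zero_left)

lemma cinner_minus_right: "cinner x (- y) = - cinner x y"
  by (metis add.right_inverse add_eq_0_iff cinner_add_right cinner_zero_right)

lemma cinner_diff_left: "cinner (x - y) z = cinner x z - cinner y z"
  using cinner_add_left[of x "- y" z] by (simp add: cinner_minus_left)

lemma cinner_diff_right: "cinner x (y - z) = cinner x y - cinner x z"
  using cinner_add_right[of x y "- z"] by (simp add: cinner_minus_right)

lemma cinner_sum_left: "cinner (\<Sum>i\<in>I. f i) y = (\<Sum>i\<in>I. cinner (f i) y)"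
  by (induction I rule: infinite_finite_induct) (auto simp: cinner_add_left)

lemmas cinner_simps = cinner_add_left cinner_add_right cinner_diff_left cinner_diff_right
  cinner_scaleC_left cinner_scaleC_right cinner_minus_left cinner_minus_right

lemma cinner_self_eq_0 [simp]: "cinner x x = 0 \<longleftrightarrow> x = 0"
  by (simp add: cinner_self)

lemma cinner_unit: "norm x = 1 \<Longrightarrow> cinner x x = 1"
  by (simp add: cinner_self)

lemma cinner_eq_0_commute: "cinner x y = 0 \<longleftrightarrow> cinner y x = 0"
  by (metis cinner_commute complex_cnj_zero)

lemmas scaleC_diff_right = cvec.scale_right_diff_distrib

lemma norm_scaleC: "norm (c *\<^sub>C x) = cmod c * norm (x :: 'a::chilbert_space)"
proof -
  have "complex_of_real ((norm (c *\<^sub>C x))\<^sup>2) = complex_of_real ((cmod c * norm x)\<^sup>2)"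
    using cinner_scaleC_left[of c x "c *\<^sub>C x"]
    by (simp add: cinner_scaleC_right cinner_self complex_norm_square power_mult_distrib
        flip: of_real_power)
  hence "(norm (c *\<^sub>C x))\<^sup>2 = (cmod c * norm x)\<^sup>2"
    using of_real_eq_iff by blast
  thus ?thesis
    by (simp add: power2_eq_iff_nonneg)
qed

lemma pythagoras: "cinner x y = 0 \<Longrightarrow> (norm (x + y))\<^sup>2 = (norm x)\<^sup>2 + (norm y)\<^sup>2"
proof -
  assume "cinner x y = 0"
  moreover from this have "cinner y x = 0"
    by (simp add: cinner_eq_0_commute)
  ultimately have "complex_of_real ((norm (x + y))\<^sup>2) = complex_of_real ((norm x)\<^sup>2 + (norm y)\<^sup>2)"
    unfolding of_real_add cinner_self[symmetric] by (simp add: cinner_simps)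
  thus ?thesis
    using of_real_eq_iff by blast
qed

lemma parallelogram:
  "(norm (x + y))\<^sup>2 + (norm (x - y))\<^sup>2 = 2 * (norm x)\<^sup>2 + 2 * (norm (y :: 'a::chilbert_space))\<^sup>2"
proof -
  have "complex_of_real ((norm (x + y))\<^sup>2 + (norm (x - y))\<^sup>2)
      = complex_of_real (2 * (norm x)\<^sup>2 + 2 * (norm y)\<^sup>2)"
    unfolding of_real_add of_real_mult cinner_self[symmetric] by (simp add: cinner_simps)
  thus ?thesis
    using of_real_eq_iff by blast
qed

lemma cauchy_schwarz: "cmod (cinner x y) \<le> norm x * norm y"
proof (cases "y = 0")
  case False
  define c where "c = cinner x y / cinner y y"
  have "cinner (x - c *\<^sub>C y) (c *\<^sub>C y) = 0"
    using False by (simp add: cinner_simps c_def)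
  hence "(norm x)\<^sup>2 = (norm (x - c *\<^sub>C y))\<^sup>2 + (norm (c *\<^sub>C y))\<^sup>2"
    using pythagoras[of "x - c *\<^sub>C y" "c *\<^sub>C y"] by simp
  hence "(norm (c *\<^sub>C y))\<^sup>2 \<le> (norm x)\<^sup>2"
    by simp
  hence "norm (c *\<^sub>C y) \<le> norm x"
    by (rule power2_le_imp_le) simp
  moreover have "norm (c *\<^sub>C y) = cmod (cinner x y) / norm y"
    using False by (simp add: norm_scaleC c_def cinner_self norm_divide norm_power power2_eq_square norm_mult)
  ultimately have "cmod (cinner x y) / norm y \<le> norm x"
    by simp
  thus ?thesis
    using False by (subst (asm) pos_divide_le_eq) auto
qed simp

lemma bounded_linear_cinner_left: "bounded_linear (\<lambda>x. cinner x y)"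
proof (rule bounded_linear_intro[where K = "norm y"])
  show "cinner (r *\<^sub>R x) y = r *\<^sub>R cinner x y" for r x
    by (metis scaleC_of_real cinner_scaleC_left scaleR_conv_of_real)
qed (auto simp: cinner_simps cauchy_schwarz)

lemma bounded_linear_cinner_right: "bounded_linear (\<lambda>y. cinner x y)"
proof -
  have "(\<lambda>y. cinner x y) = (\<lambda>y. cnj (cinner y x))"
    by (simp add: cinner_commute[symmetric])
  thus ?thesis
    using bounded_linear_compose[OF bounded_linear_cnj bounded_linear_cinner_left] by simp
qed

lemmas tendsto_cinner_left = bounded_linear.tendsto[OF bounded_linear_cinner_left]

lemma bounded_linear_scaleC: "bounded_linear (\<lambda>x :: 'a::chilbert_space. c *\<^sub>C x)"
proof (rule bounded_linear_intro[where K = "cmod c"])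
  show "c *\<^sub>C (r *\<^sub>R x) = r *\<^sub>R (c *\<^sub>C x)" for r and x :: 'a
    by (metis scaleC_of_real scaleC_scaleC mult.commute)
qed (auto simp: norm_scaleC scaleC_add_right mult.commute)

lemma bounded_linear_scaleC_left: "bounded_linear (\<lambda>c. c *\<^sub>C (x :: 'a::chilbert_space))"
proof (rule bounded_linear_intro[where K = "norm x"])
  show "(r *\<^sub>R c) *\<^sub>C x = r *\<^sub>R (c *\<^sub>C x)" for r and c
    by (metis scaleC_of_real scaleC_scaleC scaleR_conv_of_real)
qed (auto simp: norm_scaleC scaleC_add_left)


subsection \<open>Bounded operators\<close>

lemma bounded_clinearD:
  assumes "bounded_clinear f"
  shows "f (x + y) = f x + f y" "f (c *\<^sub>C x) = c *\<^sub>C f x" "f (x - y) = f x - f y" "f 0 = 0"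
proof -
  interpret bounded_linear f
    using assms by (simp add: bounded_clinear_def)
  show "f (x + y) = f x + f y" "f (c *\<^sub>C x) = c *\<^sub>C f x" "f (x - y) = f x - f y" "f 0 = 0"
    using assms by (auto simp: add diff zero bounded_clinear_def)
qed

lemma bounded_clinear_id: "bounded_clinear id"
  unfolding bounded_clinear_def id_def by (simp add: bounded_linear_ident)

lemma bounded_clinear_add:
  "bounded_clinear f \<Longrightarrow> bounded_clinear g \<Longrightarrow> bounded_clinear (\<lambda>h. f h + g h)"
  by (simp add: bounded_clinear_def bounded_linear_add scaleC_add_right)

lemma bounded_clinear_scaleC: "bounded_clinear f \<Longrightarrow> bounded_clinear (\<lambda>h. c *\<^sub>C f h)"
  by (simp add: bounded_clinear_def bounded_linear_compose[OF bounded_linear_scaleC]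
      scaleC_scaleC mult.commute)

lemma bounded_clinear_diff:
  "bounded_clinear f \<Longrightarrow> bounded_clinear g \<Longrightarrow> bounded_clinear (\<lambda>h. f h - g h)"
  using bounded_clinear_add[OF _ bounded_clinear_scaleC[of g "-1"]] by (simp add: scaleC_minus1)

lemma bounded_clinear_comp:
  "bounded_clinear f \<Longrightarrow> bounded_clinear g \<Longrightarrow> bounded_clinear (f \<circ> g)"
  by (simp add: bounded_clinear_def bounded_linear_compose comp_def)

lemma bounded_clinear_funpow:
  "bounded_clinear f \<Longrightarrow> bounded_clinear (f ^^ n)" for f :: "'a::chilbert_space \<Rightarrow> 'a"
  by (induction n) (simp_all only: funpow_simps_right bounded_clinear_comp bounded_clinear_id)

lemma bounded_clinear_tendsto:
  "bounded_clinear f \<Longrightarrow> (g \<longlongrightarrow> l) F \<Longrightarrow> ((\<lambda>x. f (g x)) \<longlongrightarrow> f l) F"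
  by (simp add: bounded_clinear_def bounded_linear.tendsto)

lemma bounded_clinear_continuous: "bounded_clinear f \<Longrightarrow> continuous_on A f"
  by (simp add: bounded_clinear_def linear_continuous_on)

lemma bounded_clinear_boundE:
  assumes "bounded_clinear a"
  obtains R where "R > 0" "\<And>h. norm (a h) \<le> R * norm h"
  using bounded_linear.pos_bounded[of a] assms by (auto simp: bounded_clinear_def mult.commute)

lemma cspan_subspace_induct [consumes 1, case_names base zero add scale]:
  assumes "x \<in> cspan S" and "\<And>x. x \<in> S \<Longrightarrow> P x" and "P 0"
    and "\<And>x y. P x \<Longrightarrow> P y \<Longrightarrow> P (x + y)" and "\<And>c x. P x \<Longrightarrow> P (c *\<^sub>C x)"
  shows "P (x :: 'a::chilbert_space)"
proof (rule cvec.span_induct[OF assms(1), of P])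
  show "cvec.subspace {x. P x}"
    by (rule cvec.subspaceI) (auto intro: assms)
qed (use assms in auto)

text \<open>Bounded operators are known here only on elementary tensors, so identities are extended from a set
  to the closure of its span again and again.\<close>

lemma closure_cspan_induct [consumes 1, case_names closed base zero add scale]:
  assumes "x \<in> closure (cspan S)" and "closed {x. P x}"
    and "\<And>x. x \<in> S \<Longrightarrow> P x" and "P 0"
    and "\<And>x y. P x \<Longrightarrow> P y \<Longrightarrow> P (x + y)" and "\<And>c x. P x \<Longrightarrow> P (c *\<^sub>C x)"
  shows "P (x :: 'a::chilbert_space)"
proof -
  have "cspan S \<subseteq> {x. P x}"
    using cspan_subspace_induct[of _ S P] assms(3-) by auto
  hence "closure (cspan S) \<subseteq> {x. P x}"
    using assms(2) by (rule closure_minimal)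
  thus ?thesis
    using assms(1) by auto
qed

lemma bounded_clinear_eqI:
  assumes "bounded_clinear f" "bounded_clinear g" and "closure (cspan S) = UNIV"
    and "\<And>x. x \<in> S \<Longrightarrow> f x = g x"
  shows "f = g"
proof
  fix x
  have "x \<in> closure (cspan S)"
    using assms(3) by simp
  thus "f x = g x"
    by (induction rule: closure_cspan_induct)
       (use assms in \<open>auto simp: bounded_clinearD intro!: closed_Collect_eq bounded_clinear_continuous\<close>)
qed

lemma bounded_selfadjointI_total:
  assumes a: "bounded_clinear a" and S: "closure (cspan S) = UNIV"
    and eq: "\<And>x y. x \<in> S \<Longrightarrow> y \<in> S \<Longrightarrow> cinner (a x) y = cinner x (a y)"
  shows "bounded_selfadjoint a"
proof -
  have bl: "bounded_linear (\<lambda>x. cinner (a x) y)" for y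
    using a bounded_linear_compose[OF bounded_linear_cinner_left] by (auto simp: bounded_clinear_def)
  have br: "bounded_linear (\<lambda>y. cinner x (a y))" for x
    using a bounded_linear_compose[OF bounded_linear_cinner_right] by (auto simp: bounded_clinear_def)
  note cont = linear_continuous_on bl br bounded_linear_cinner_right bounded_linear_cinner_left
  have *: "cinner (a x) y = cinner x (a y)" if "y \<in> S" for x y
  proof -
    have "x \<in> closure (cspan S)"
      using S by simp
    thus ?thesis
      by (induction rule: closure_cspan_induct)
         (use eq that in \<open>auto simp: cinner_simps bounded_clinearD[OF a] intro!: closed_Collect_eq cont\<close>)
  qed
  have "cinner (a x) y = cinner x (a y)" for x y
  proof -
    have "y \<in> closure (cspan S)"
      using S by simp
    thus ?thesis
      by (induction rule: closure_cspan_induct)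
         (use * in \<open>auto simp: cinner_simps bounded_clinearD[OF a] intro!: closed_Collect_eq cont\<close>)
  qed
  thus ?thesis
    using a by (simp add: bounded_selfadjoint_def)
qed

lemma bounded_selfadjointD:
  assumes "bounded_selfadjoint a"
  shows "bounded_clinear a" "cinner (a x) y = cinner x (a y)"
  using assms by (auto simp: bounded_selfadjoint_def)

lemma selfadjoint_funpow:
  assumes "bounded_selfadjoint a"
  shows "cinner ((a ^^ n) x) y = cinner x ((a ^^ n) y)"
  by (induction n arbitrary: x) (simp_all add: bounded_selfadjointD(2)[OF assms] funpow_swap1)

lemma bounded_selfadjoint_add:
  "bounded_selfadjoint f \<Longrightarrow> bounded_selfadjoint g \<Longrightarrow> bounded_selfadjoint (\<lambda>h. f h + g h)"
  by (simp add: bounded_selfadjoint_def bounded_clinear_add cinner_simps)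


subsection \<open>Orthogonal projections\<close>

lemma closest_point_exists:
  fixes M :: "'a::chilbert_space set"
  assumes M: "closed M" "cvec.subspace M"
  obtains y where "y \<in> M" "\<And>m. m \<in> M \<Longrightarrow> norm (x - y) \<le> norm (x - m)"
proof -
  define d where "d = (INF m\<in>M. norm (x - m))"
  have ne: "M \<noteq> {}"
    using M(2) cvec.subspace_0 by blast
  have bdd: "bdd_below ((\<lambda>m. norm (x - m)) ` M)"
    by (rule bdd_belowI[of _ 0]) auto
  have d_le: "d \<le> norm (x - m)" if "m \<in> M" for m
    unfolding d_def using that bdd by (intro cINF_lower)
  have d0: "d \<ge> 0"
    unfolding d_def using ne by (intro cINF_greatest) auto
  have "\<exists>m\<in>M. norm (x - m) < d + 1 / Suc n" for n
  proof (rule ccontr)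
    assume "\<not> ?thesis"
    hence "d + 1 / Suc n \<le> d"
      unfolding d_def by (intro cINF_greatest ne) (auto simp: not_less)
    thus False
      by simp
  qed
  then obtain f where f: "\<And>n. f n \<in> M" "\<And>n. norm (x - f n) < d + 1 / Suc n"
    by metis
  have lim: "(\<lambda>n. norm (x - f n)) \<longlonglongrightarrow> d"
  proof (rule tendsto_sandwich)
    show "(\<lambda>n. d) \<longlonglongrightarrow> d" "(\<lambda>n. d + 1 / Suc n) \<longlonglongrightarrow> d"
      using tendsto_add[OF tendsto_const LIMSEQ_Suc[OF lim_1_over_n], of d] by auto
  qed (use f d_le in \<open>auto intro!: always_eventually less_imp_le simp del: of_nat_Suc\<close>)
  have sq: "(norm (f m - f n))\<^sup>2 \<le> 2 * (norm (x - f m))\<^sup>2 + 2 * (norm (x - f n))\<^sup>2 - 4 * d\<^sup>2" for m n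
  proof -
    \<comment> \<open>The midpoint of two near-minimizers lies in \<open>M\<close>, so it is at distance at least \<open>d\<close> from
      \<open>x\<close>; by the parallelogram law the near-minimizers are then close to each other.\<close>
    define mid where "mid = (1/2 :: complex) *\<^sub>C (f m + f n)"
    have "mid \<in> M"
      unfolding mid_def using f M(2) by (intro cvec.subspace_scale cvec.subspace_add)
    hence "d\<^sup>2 \<le> (norm (x - mid))\<^sup>2"
      using d_le d0 by (intro power_mono) auto
    moreover have "norm (x - f m + (x - f n)) = 2 * norm (x - mid)"
    proof -
      have "2 *\<^sub>R mid = f m + f n"
        unfolding mid_def by (subst scaleC_of_real[symmetric]) (simp only: scaleC_scaleC, simp)
      hence "x - f m + (x - f n) = 2 *\<^sub>R (x - mid)"
        by (simp add: scaleR_diff_right scaleR_2)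
      thus ?thesis
        by simp
    qed
    moreover have "norm (x - f m - (x - f n)) = norm (f m - f n)"
      by (simp add: norm_minus_commute)
    ultimately show ?thesis
      using parallelogram[of "x - f m" "x - f n"] by (simp add: power_mult_distrib)
  qed
  have "Cauchy f"
  proof (rule metric_CauchyI)
    fix e :: real
    assume e: "e > 0"
    have "(\<lambda>n. (norm (x - f n))\<^sup>2) \<longlonglongrightarrow> d\<^sup>2"
      by (intro tendsto_intros lim)
    moreover have "d\<^sup>2 < d\<^sup>2 + e\<^sup>2 / 4"
      using e by simp
    ultimately have "\<forall>\<^sub>F n in sequentially. (norm (x - f n))\<^sup>2 < d\<^sup>2 + e\<^sup>2 / 4"
      by (rule order_tendstoD)
    then obtain N where N: "\<And>n. n \<ge> N \<Longrightarrow> (norm (x - f n))\<^sup>2 < d\<^sup>2 + e\<^sup>2 / 4"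
      by (auto simp: eventually_at_top_linorder)
    have "dist (f m) (f n) < e" if "m \<ge> N" "n \<ge> N" for m n
    proof -
      have "(norm (f m - f n))\<^sup>2 < e\<^sup>2"
        using sq[of m n] N[OF that(1)] N[OF that(2)] by linarith
      thus ?thesis
        using e by (simp add: dist_norm power_less_imp_less_base)
    qed
    thus "\<exists>N. \<forall>m\<ge>N. \<forall>n\<ge>N. dist (f m) (f n) < e"
      by blast
  qed
  then obtain y where y: "f \<longlonglongrightarrow> y"
    using Cauchy_convergent convergent_def by blast
  have "y \<in> M"
    using M(1) f(1) y closed_sequentially by blast
  moreover have "norm (x - y) = d"
    by (rule LIMSEQ_unique[OF _ lim]) (intro tendsto_intros y)
  ultimately show ?thesis
    using that d_le by simp
qed

lemma orth_decomposition_exists: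
  fixes M :: "'a::chilbert_space set"
  assumes M: "closed M" "cvec.subspace M"
  shows "\<exists>y. y \<in> M \<and> (\<forall>m\<in>M. cinner (x - y) m = 0)"
proof -
  obtain y where y: "y \<in> M" "\<And>m. m \<in> M \<Longrightarrow> norm (x - y) \<le> norm (x - m)"
    using closest_point_exists[OF M, of x] by blast
  have "cinner (x - y) m = 0" if m: "m \<in> M" for m
  proof (cases "m = 0")
    case False
    \<comment> \<open>If \<open>y + c *\<^sub>C m\<close> is the foot of the perpendicular in the direction \<open>m\<close>, then it is
      no closer to \<open>x\<close> than \<open>y\<close> is, which forces \<open>c = 0\<close>.\<close>
    define c where "c = cinner (x - y) m / cinner m m"
    have "cinner (x - (y + c *\<^sub>C m)) (c *\<^sub>C m) = 0"
      using False by (simp add: cinner_simps c_def field_simps)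
    hence "(norm (x - y))\<^sup>2 = (norm (x - (y + c *\<^sub>C m)))\<^sup>2 + (norm (c *\<^sub>C m))\<^sup>2"
      using pythagoras[of "x - (y + c *\<^sub>C m)" "c *\<^sub>C m"] by simp
    moreover have "(norm (x - y))\<^sup>2 \<le> (norm (x - (y + c *\<^sub>C m)))\<^sup>2"
      using M(2) y(1) m by (intro power_mono y(2) cvec.subspace_add cvec.subspace_scale) auto
    ultimately have "c *\<^sub>C m = 0"
      by simp
    thus ?thesis
      using False by (auto simp: c_def)
  qed simp
  thus ?thesis
    using y(1) by blast
qed

lemma orth_proj_unique:
  assumes "y \<in> M" "\<And>m. m \<in> M \<Longrightarrow> cinner (x - y) m = 0" and "cvec.subspace M"
  shows "orth_proj M x = y"
  unfolding orth_proj_def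
proof (rule the_equality)
  fix z
  assume z: "z \<in> M \<and> (\<forall>m\<in>M. cinner (x - z) m = 0)"
  have "y - z \<in> M"
    using z assms cvec.subspace_diff by blast
  hence "cinner ((x - z) - (x - y)) (y - z) = 0"
    using z assms(2) by (simp add: cinner_diff_left)
  hence "cinner (y - z) (y - z) = 0"
    by simp
  thus "z = y"
    by simp
qed (use assms in auto)

lemma
  assumes "closed M" "cvec.subspace M"
  shows orth_proj_in: "orth_proj M x \<in> M"
    and orth_proj_orth: "m \<in> M \<Longrightarrow> cinner (x - orth_proj M x) m = 0"
proof -
  obtain y where "y \<in> M" "\<forall>m\<in>M. cinner (x - y) m = 0"
    using orth_decomposition_exists[OF assms, of x] by blast
  moreover from this have "orth_proj M x = y"
    using orth_proj_unique assms by blast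
  ultimately show "orth_proj M x \<in> M" "m \<in> M \<Longrightarrow> cinner (x - orth_proj M x) m = 0"
    by auto
qed

lemma norm_orth_proj_le:
  assumes "closed M" "cvec.subspace M"
  shows "norm (orth_proj M x) \<le> norm x"
proof -
  have "cinner (x - orth_proj M x) (orth_proj M x) = 0"
    using orth_proj_in[OF assms] by (intro orth_proj_orth assms)
  hence "(norm x)\<^sup>2 = (norm (x - orth_proj M x))\<^sup>2 + (norm (orth_proj M x))\<^sup>2"
    using pythagoras[of "x - orth_proj M x" "orth_proj M x"] by simp
  hence "(norm (orth_proj M x))\<^sup>2 \<le> (norm x)\<^sup>2"
    by simp
  thus ?thesis
    by (rule power2_le_imp_le) simp
qed

lemma bounded_clinear_orth_proj:
  assumes M: "closed M" "cvec.subspace M"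
  shows "bounded_clinear (orth_proj M)"
proof -
  have add: "orth_proj M (x + y) = orth_proj M x + orth_proj M y" for x y
  proof (rule orth_proj_unique)
    show "orth_proj M x + orth_proj M y \<in> M"
      by (intro cvec.subspace_add M orth_proj_in)
    show "cinner (x + y - (orth_proj M x + orth_proj M y)) m = 0" if "m \<in> M" for m
      using cinner_add_left[of "x - orth_proj M x" "y - orth_proj M y" m]
      by (simp add: orth_proj_orth[OF M that] add_diff_add)
  qed (rule M)
  have scale: "orth_proj M (c *\<^sub>C x) = c *\<^sub>C orth_proj M x" for c x
  proof (rule orth_proj_unique)
    show "c *\<^sub>C orth_proj M x \<in> M"
      by (intro cvec.subspace_scale M orth_proj_in)
    show "cinner (c *\<^sub>C x - c *\<^sub>C orth_proj M x) m = 0" if "m \<in> M" for m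
      using orth_proj_orth[OF M that, of x] by (simp add: cinner_simps)
  qed (rule M)
  have "bounded_linear (orth_proj M)"
    by (rule bounded_linear_intro[where K = 1])
       (simp_all add: add scale norm_orth_proj_le[OF M] flip: scaleC_of_real)
  thus ?thesis
    using scale by (simp add: bounded_clinear_def)
qed

lemma closed_subspace_closure_cspan:
  "closed (closure (cspan S))" "cvec.subspace (closure (cspan (S :: 'a::chilbert_space set)))"
proof -
  show "cvec.subspace (closure (cspan S))"
  proof (rule cvec.subspaceI)
    show "0 \<in> closure (cspan S)"
      using cvec.span_zero[of S] closure_subset by blast
  next
    fix x y
    assume "x \<in> closure (cspan S)" "y \<in> closure (cspan S)"
    then obtain f g where "\<And>n. f n \<in> cspan S" "f \<longlonglongrightarrow> x" "\<And>n. g n \<in> cspan S" "g \<longlonglongrightarrow> y"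
      by (auto simp: closure_sequential)
    hence "\<And>n. f n + g n \<in> cspan S" "(\<lambda>n. f n + g n) \<longlonglongrightarrow> x + y"
      by (auto intro: tendsto_add cvec.span_add)
    thus "x + y \<in> closure (cspan S)"
      unfolding closure_sequential by (intro exI[of _ "\<lambda>n. f n + g n"]) blast
  next
    fix c x
    assume "x \<in> closure (cspan S)"
    then obtain f where "\<And>n. f n \<in> cspan S" "f \<longlonglongrightarrow> x"
      by (auto simp: closure_sequential)
    hence "\<And>n. c *\<^sub>C f n \<in> cspan S" "(\<lambda>n. c *\<^sub>C f n) \<longlonglongrightarrow> c *\<^sub>C x"
      by (auto intro: bounded_linear.tendsto[OF bounded_linear_scaleC] cvec.span_scale)
    thus "c *\<^sub>C x \<in> closure (cspan S)"
      unfolding closure_sequential by (intro exI[of _ "\<lambda>n. c *\<^sub>C f n"]) blast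
  qed
qed simp

text \<open>A uniformly bounded sequence of operators converges strongly as soon as it does so on a total set.\<close>

lemma strong_convergence_total:
  assumes D: "\<And>n. bounded_clinear (D n)" and bd: "\<And>n x. norm (D n x) \<le> C * norm x"
    and S: "closure (cspan S) = UNIV" and lim: "\<And>x. x \<in> S \<Longrightarrow> (\<lambda>n. D n x) \<longlonglongrightarrow> 0"
  shows "(\<lambda>n. D n x) \<longlonglongrightarrow> 0"
proof -
  have "x \<in> closure (cspan S)"
    using S by simp
  thus ?thesis
  proof (induction rule: closure_cspan_induct)
    case closed
    show ?case
      unfolding closed_sequential_limits
    proof safe
      fix f l
      assume f: "\<forall>n. f n \<in> {x. (\<lambda>n. D n x) \<longlonglongrightarrow> 0}" "f \<longlonglongrightarrow> l"
      show "(\<lambda>n. D n l) \<longlonglongrightarrow> 0"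
      proof (rule LIMSEQ_I)
        fix e :: real
        assume "e > 0"
        define C' where "C' = max C 1"
        have C': "C' > 0" "norm (D n x) \<le> C' * norm x" for n x
          using bd[of n x] mult_right_mono[of C C' "norm x"] by (auto simp: C'_def)
        obtain k where k: "norm (f k - l) < e / (2 * C')"
          using LIMSEQ_D[OF f(2), of "e / (2 * C')"] \<open>e > 0\<close> C'(1) by auto
        obtain N where N: "\<And>n. n \<ge> N \<Longrightarrow> norm (D n (f k)) < e / 2"
          using f(1) LIMSEQ_D[of "\<lambda>n. D n (f k)" 0 "e / 2"] \<open>e > 0\<close> by auto
        have "norm (D n l - 0) < e" if "n \<ge> N" for n
        proof -
          have "D n l = D n (f k) - D n (f k - l)"
            by (simp add: bounded_clinearD(3)[OF D])
          hence "norm (D n l) \<le> norm (D n (f k)) + norm (D n (f k - l))"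
            by (metis norm_triangle_ineq4)
          moreover have "norm (D n (f k - l)) \<le> C' * norm (f k - l)"
            by (rule C')
          moreover have "C' * norm (f k - l) < e / 2"
            using k C'(1) by (simp add: field_simps)
          ultimately show ?thesis
            using N[OF that] by simp
        qed
        thus "\<exists>N. \<forall>n\<ge>N. norm (D n l - 0) < e"
          by blast
      qed
    qed
  next
    case (add x y)
    thus ?case
      using tendsto_add[of _ 0 _ _ 0] by (simp add: bounded_clinearD(1)[OF D])
  next
    case (scale c x)
    thus ?case
      using bounded_linear.tendsto[OF bounded_linear_scaleC scale, of c]
      by (simp add: bounded_clinearD(2)[OF D])
  qed (use lim in \<open>simp_all add: bounded_clinearD(4)[OF D]\<close>)
qed


section \<open>Compactly supported measures and their moments\<close>

lemma compact_probE:
  assumes "compact_prob \<rho>"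
  obtains R where "real_distribution \<rho>" "R > 0" "AE x in \<rho>. \<bar>x\<bar> \<le> R"
proof -
  obtain R where R: "real_distribution \<rho>" "AE x in \<rho>. \<bar>x\<bar> \<le> R"
    using assms by (auto simp: compact_prob_def)
  have "AE x in \<rho>. \<bar>x\<bar> \<le> max R 1"
    using R(2) by eventually_elim auto
  with R(1) that[of "max R 1"] show ?thesis
    by auto
qed

lemma integrable_power_bounded_support:
  assumes "real_distribution \<rho>" "AE x in \<rho>. \<bar>x\<bar> \<le> R"
  shows "integrable \<rho> (\<lambda>x. x ^ n)"
proof -
  interpret real_distribution \<rho>
    by fact
  have "AE x in \<rho>. norm (x ^ n) \<le> R ^ n"
    using assms(2) by eventually_elim (auto simp: power_abs intro!: power_mono)
  thus ?thesis
    by (intro integrable_const_bound) auto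
qed

lemma tendsto_norm_diffI:
  assumes "\<forall>\<^sub>F x in F. norm (f x - l) \<le> g x" and "(g \<longlongrightarrow> 0) F"
  shows "(f \<longlongrightarrow> (l :: 'a::real_normed_vector)) F"
  using assms by (rule LIM_zero_cancel[OF Lim_null_comparison])

text \<open>Bounded support makes the remainder in the expansion of \<open>exp (i t x)\<close> integrate to something of
  order \<open>(\<bar>t\<bar> R)\<^sup>n / n!\<close>.  Together with Levy's theorem this shows that a compactly supported
  measure is determined by its moments.\<close>

lemma char_moment_series:
  assumes \<rho>: "real_distribution \<rho>" "AE x in \<rho>. \<bar>x\<bar> \<le> R"
  shows "(\<lambda>n. \<Sum>k\<le>n. (\<i> * t) ^ k / fact k * complex_of_real (\<integral>x. x ^ k \<partial>\<rho>)) \<longlonglongrightarrow> char \<rho> t"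
proof -
  interpret real_distribution \<rho>
    by fact
  note int = integrable_power_bounded_support[OF \<rho>]
  have "(\<integral>x. \<bar>x\<bar> ^ n \<partial>\<rho>) \<le> R ^ n" for n
  proof -
    have "AE x in \<rho>. \<bar>x\<bar> ^ n \<le> R ^ n"
      using \<rho>(2) by eventually_elim (auto intro!: power_mono)
    hence "(\<integral>x. \<bar>x\<bar> ^ n \<partial>\<rho>) \<le> (\<integral>x. R ^ n \<partial>\<rho>)"
      using int[of n] by (intro integral_mono_AE) (auto simp flip: power_abs)
    thus ?thesis
      using prob_space by simp
  qed
  hence le: "(2*\<bar>t\<bar>^n / fact n) * (\<integral>x. \<bar>x\<bar> ^ n \<partial>\<rho>) \<le> 2 * ((\<bar>t\<bar> * R) ^ n / fact n)" for n
    using mult_left_mono[of "\<integral>x. \<bar>x\<bar> ^ n \<partial>\<rho>" "R ^ n" "2*\<bar>t\<bar>^n / fact n"]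
    by (simp add: power_mult_distrib)
  have bound: "cmod ((\<Sum>k\<le>n. (\<i> * t) ^ k / fact k * complex_of_real (\<integral>x. x ^ k \<partial>\<rho>)) - char \<rho> t)
      \<le> 2 * ((\<bar>t\<bar> * R) ^ n / fact n)" for n
    using char_approx1[of n t, OF int] le[of n] by (simp add: norm_minus_commute)
  have "(\<lambda>n. 2 * ((\<bar>t\<bar> * R) ^ n / fact n)) \<longlonglongrightarrow> 2 * 0"
    using summable_LIMSEQ_zero[OF summable_exp[of "\<bar>t\<bar> * R"]]
    by (intro tendsto_intros) (simp add: divide_inverse mult.commute)
  hence "(\<lambda>n. 2 * ((\<bar>t\<bar> * R) ^ n / fact n)) \<longlonglongrightarrow> 0"
    by simp
  with bound show ?thesis
    by (rule tendsto_norm_diffI[OF always_eventually[OF allI]])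
qed

lemma compact_prob_eqI_moments:
  assumes "compact_prob \<rho>" "compact_prob \<rho>'"
    and eq: "\<And>n. (\<integral>x. x ^ n \<partial>\<rho>) = (\<integral>x. x ^ n \<partial>\<rho>')"
  shows "\<rho> = \<rho>'"
proof -
  obtain R where R: "real_distribution \<rho>" "AE x in \<rho>. \<bar>x\<bar> \<le> R"
    using assms(1) by (rule compact_probE)
  obtain R' where R': "real_distribution \<rho>'" "AE x in \<rho>'. \<bar>x\<bar> \<le> R'"
    using assms(2) by (rule compact_probE)
  have "char \<rho> = char \<rho>'"
  proof
    fix t
    show "char \<rho> t = char \<rho>' t"
      using char_moment_series[OF R, of t] char_moment_series[OF R', of t]
      unfolding eq by (rule LIMSEQ_unique)
  qed
  thus ?thesis
    using R R' Levy_uniqueness by blast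
qed

lemma has_distr_unique:
  assumes "has_distr a \<xi> \<rho>" "has_distr a' \<xi>' \<rho>'"
    and "\<And>n. vector_state \<xi> (a ^^ n) = vector_state \<xi>' (a' ^^ n)"
  shows "\<rho> = \<rho>'"
  using assms by (intro compact_prob_eqI_moments) (auto simp: has_distr_def)

lemma sum_choose_Suc:
  "(\<Sum>j\<le>Suc N. real (Suc N choose j) * f j) = (\<Sum>j\<le>N. real (N choose j) * (f j + f (Suc j)))"
proof -
  have "(\<Sum>j\<le>Suc N. real (Suc N choose j) * f j)
      = f 0 + (\<Sum>j\<le>N. real (N choose Suc j) * f (Suc j)) + (\<Sum>j\<le>N. real (N choose j) * f (Suc j))"
    by (subst sum.atMost_Suc_shift) (simp add: sum.distrib algebra_simps)
  also have "f 0 + (\<Sum>j\<le>N. real (N choose Suc j) * f (Suc j)) = (\<Sum>j\<le>Suc N. real (N choose j) * f j)"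
    by (subst sum.atMost_Suc_shift) simp
  also have "\<dots> = (\<Sum>j\<le>N. real (N choose j) * f j)"
    by simp
  finally show ?thesis
    by (simp add: sum.distrib algebra_simps)
qed

text \<open>For \<open>L k l = \<integral>x\<^sup>k (1 - x)\<^sup>l\<close> this integrates \<open>x\<^sup>m\<close> times the binomial expansion of
  \<open>(x + (1 - x))\<^sup>N\<close>; the recursion plays the role of \<open>x + (1 - x) = 1\<close>.\<close>

lemma hausdorff_sum:
  fixes L :: "nat \<Rightarrow> nat \<Rightarrow> real"
  assumes "\<And>k l. L k l = L (Suc k) l + L k (Suc l)"
  shows "(\<Sum>j\<le>N. real (N choose j) * L (m + j) (N - j)) = L m 0"
proof (induction N)
  case (Suc N)
  have "L (m + j) (Suc N - j) + L (m + Suc j) (Suc N - Suc j) = L (m + j) (N - j)" if "j \<le> N" for j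
    using assms[of "m + j" "N - j"] that by (simp add: Suc_diff_le)
  hence "(\<Sum>j\<le>Suc N. real (Suc N choose j) * L (m + j) (Suc N - j))
      = (\<Sum>j\<le>N. real (N choose j) * L (m + j) (N - j))"
    unfolding sum_choose_Suc by (intro sum.cong) auto
  thus ?case
    using Suc by simp
qed simp

text \<open>Binomial moments of the Bernstein weights.  Unlike the power moments they come out exactly, and
  they differ from the power moments by terms of order \<open>1/n\<close>.\<close>

lemma hausdorff_factorial_moments:
  fixes L :: "nat \<Rightarrow> nat \<Rightarrow> real"
  assumes L: "\<And>k l. L k l = L (Suc k) l + L k (Suc l)"
  shows "(\<Sum>k\<le>n. real (n choose k) * L k (n - k) * real (k choose m)) = real (n choose m) * L m 0"
proof (cases "m \<le> n")
  case True
  have "(\<Sum>k\<le>n. real (n choose k) * L k (n - k) * real (k choose m))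
      = (\<Sum>k\<in>{m..n}. real (n choose k) * L k (n - k) * real (k choose m))"
    by (intro sum.mono_neutral_right) auto
  also have "\<dots> = (\<Sum>k\<in>{m..n}. real (n choose m) * (real ((n - m) choose (k - m)) * L k (n - k)))"
  proof (rule sum.cong)
    fix k
    assume "k \<in> {m..n}"
    hence "real (n choose k) * real (k choose m) = real (n choose m) * real ((n - m) choose (k - m))"
      using choose_mult[of m k n] by (simp flip: of_nat_mult)
    thus "real (n choose k) * L k (n - k) * real (k choose m)
        = real (n choose m) * (real ((n - m) choose (k - m)) * L k (n - k))"
      by (simp add: algebra_simps)
  qed simp
  also have "\<dots> = real (n choose m) * (\<Sum>j\<le>n - m. real ((n - m) choose j) * L (m + j) (n - m - j))"
    unfolding sum_distrib_left
    by (rule sum.reindex_bij_witness[of _ "\<lambda>j. m + j" "\<lambda>k. k - m"]) (use True in auto)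
  finally show ?thesis
    unfolding hausdorff_sum[of L, OF L] .
next
  case False
  thus ?thesis
    by (simp add: binomial_eq_0)
qed

lemma prod_scaled_choose:
  assumes "n > 0"
  shows "(\<Prod>i<m. real k / real n - real i / real n) = fact m * real (k choose m) / real n ^ m"
proof -
  have "(\<Prod>i<m. real k / real n - real i / real n) = (\<Prod>i<m. real k - real i) / real n ^ m"
    by (simp add: prod_dividef flip: diff_divide_distrib)
  also have "(\<Prod>i<m. real k - real i) = fact m * (real k gchoose m)"
    by (simp add: gbinomial_prod_rev atLeast0LessThan)
  also have "real k gchoose m = real (k choose m)"
    by (simp add: binomial_gbinomial)
  finally show ?thesis .
qed

lemma prod_shift_approx:
  fixes x :: real
  assumes "0 \<le> x" "x \<le> 1" "n \<ge> m" "n > 0"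
  shows "\<bar>(\<Prod>i<m. x - real i / real n) - x ^ m\<bar> \<le> real (m * m) / real n"
proof -
  have "norm ((\<Prod>i<m. x - real i / real n) - (\<Prod>i<m. x)) \<le> (\<Sum>i<m. norm (x - real i / real n - x))"
  proof (rule norm_prod_diff)
    fix i
    assume "i \<in> {..<m}"
    hence "real i / real n \<le> 1" "real i / real n \<ge> 0"
      using assms by auto
    thus "norm (x - real i / real n) \<le> 1"
      using assms(1,2) unfolding real_norm_def by linarith
  qed (use assms in auto)
  also have "\<dots> \<le> (\<Sum>i<m. real m / real n)"
    by (intro sum_mono) (auto simp: divide_right_mono)
  finally show ?thesis
    by simp
qed

text \<open>The Bernstein weights \<open>(n choose k) L k (n - k)\<close> define a probability measure on the points
  \<open>k/n\<close> of the unit interval, whose \<open>m\<close>-th moment tends to \<open>L m 0\<close>.  All these measures live on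
  \<open>[0, 1]\<close>, so Helly's theorem yields a weak limit.\<close>

lemma Hausdorff_moment_problem:
  fixes L :: "nat \<Rightarrow> nat \<Rightarrow> real"
  assumes rec: "\<And>k l. L k l = L (Suc k) l + L k (Suc l)"
    and nonneg: "\<And>k l. L k l \<ge> 0" and one: "L 0 0 = 1"
  obtains \<rho> where "real_distribution \<rho>" "AE x in \<rho>. 0 \<le> x \<and> x \<le> 1"
    and "\<And>m. (\<integral>x. x ^ m \<partial>\<rho>) = L m 0"
proof -
  define w where "w n k = real (n choose k) * L k (n - k)" for n k
  define \<mu> where "\<mu> n = distr (point_measure {..n} (w n)) borel (\<lambda>k. real k / real n)" for n
  have w0: "w n k \<ge> 0" for n k
    by (simp add: w_def nonneg)
  have w1: "(\<Sum>k\<le>n. w n k) = 1" for n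
    using hausdorff_sum[of L, OF rec, where m = 0 and N = n] one by (simp add: w_def)
  have rd: "real_distribution (\<mu> n)" for n
  proof -
    have "prob_space (point_measure {..n} (w n))"
      by (rule prob_spaceI)
         (simp add: emeasure_point_measure_finite space_point_measure w0 w1 sum_ennreal)
    hence "prob_space (\<mu> n)"
      unfolding \<mu>_def by (intro prob_space.prob_space_distr) auto
    thus ?thesis
      by (simp add: real_distribution_def real_distribution_axioms_def \<mu>_def)
  qed
  have int: "(\<integral>x. g x \<partial>\<mu> n) = (\<Sum>k\<le>n. w n k * g (real k / real n))"
    if [measurable]: "g \<in> borel_measurable borel" for g :: "real \<Rightarrow> real" and n
    unfolding \<mu>_def by (subst integral_distr) (auto simp: lebesgue_integral_point_measure_finite w0)
  have "tight \<mu>"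
    unfolding tight_def
  proof (intro conjI allI impI rd)
    fix e :: real
    assume e: "e > 0"
    have "measure (\<mu> n) {-1<..1} = (\<Sum>k\<le>n. w n k * indicator {-1<..1} (real k / real n))" for n
    proof -
      interpret real_distribution "\<mu> n"
        by (rule rd)
      show ?thesis
        using int[of "indicator {-1<..1}" n] by simp
    qed
    also have "\<And>n. (\<Sum>k\<le>n. w n k * indicator {-1<..1} (real k / real n)) = (\<Sum>k\<le>n. w n k)"
    proof (rule sum.cong)
      fix n k :: nat
      assume "k \<in> {..n}"
      hence "real k / real n \<in> {-1<..1}"
        by (auto simp: divide_le_eq intro: less_le_trans[of _ 0])
      thus "w n k * indicator {-1<..1} (real k / real n) = w n k"
        by simp
    qed simp
    finally have "measure (\<mu> n) {-1<..1} > 1 - e" for n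
      using e by (simp add: w1)
    thus "\<exists>a b. a < b \<and> (\<forall>n. measure (\<mu> n) {a<..b} > 1 - e)"
      by (intro exI[of _ "-1"] exI[of _ 1]) auto
  qed
  then obtain r \<rho> where r: "strict_mono (r :: nat \<Rightarrow> nat)" and \<rho>: "real_distribution \<rho>"
    and wc: "weak_conv_m (\<mu> \<circ> id \<circ> r) \<rho>"
    using tight_imp_convergent_subsubsequence[of \<mu> id] by (auto simp: strict_mono_id)
  interpret real_distribution \<rho>
    by (rule \<rho>)
  have conv: "(\<lambda>n. \<integral>x. g x \<partial>\<mu> (r n)) \<longlonglongrightarrow> (\<integral>x. g x \<partial>\<rho>)"
    if "\<And>x. isCont g x" "\<And>x. norm (g x) \<le> B" for g :: "real \<Rightarrow> real" and B
    using weak_conv_imp_integral_bdd_continuous_conv[of "\<mu> \<circ> id \<circ> r" \<rho> g B] rd \<rho> wc that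
    by (simp add: comp_def)
  \<comment> \<open>Weak convergence only speaks about bounded continuous functions, so the powers are cut off
    outside the unit interval.\<close>
  define clamp where "clamp x = max 0 (min 1 x)" for x :: real
  have clamp: "clamp x = x" if "0 \<le> x" "x \<le> 1" for x
    using that by (auto simp: clamp_def)
  have clamp01: "0 \<le> clamp x" "clamp x \<le> 1" for x
    by (auto simp: clamp_def)
  have cont_clamp: "isCont clamp x" for x
    unfolding clamp_def by (intro continuous_intros)
  have supp: "AE x in \<rho>. 0 \<le> x \<and> x \<le> 1"
  proof -
    \<comment> \<open>A bounded continuous function vanishing exactly on the unit interval.\<close>
    define g where "g x = min 1 \<bar>x - clamp x\<bar>" for x
    have g: "isCont g x" "norm (g x) \<le> 1" "0 \<le> g x" for x
      unfolding g_def by (auto intro!: continuous_intros cont_clamp)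
    have [measurable]: "g \<in> borel_measurable borel"
      using g(1) by (intro borel_measurable_continuous_onI continuous_at_imp_continuous_on) auto
    have "(\<integral>x. g x \<partial>\<mu> n) = 0" for n
      by (subst int) (auto intro!: sum.neutral simp: g_def clamp divide_le_eq)
    hence "(\<integral>x. g x \<partial>\<rho>) = 0"
      using conv[OF g(1,2)] by (simp add: LIMSEQ_const_iff)
    moreover have "integrable \<rho> g"
      using g(2) by (intro integrable_const_bound[where B = 1]) auto
    ultimately have "AE x in \<rho>. g x = 0"
      using integral_nonneg_eq_0_iff_AE[of \<rho> g] g(3) by auto
    thus ?thesis
      by eventually_elim (auto simp: g_def clamp_def split: if_splits)
  qed
  moreover have "(\<integral>x. x ^ m \<partial>\<rho>) = L m 0" for m
  proof -
    have fac: "(\<Sum>k\<le>n. w n k * (\<Prod>i<m. real k / real n - real i / real n))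
        = (\<Prod>i<m. 1 - real i / real n) * L m 0" if "n > 0" for n
    proof -
      have "(\<Sum>k\<le>n. w n k * (\<Prod>i<m. real k / real n - real i / real n))
          = fact m / real n ^ m * (\<Sum>k\<le>n. real (n choose k) * L k (n - k) * real (k choose m))"
        unfolding prod_scaled_choose[OF that] sum_distrib_left
        by (intro sum.cong) (auto simp: w_def)
      also have "\<dots> = fact m * real (n choose m) / real n ^ m * L m 0"
        unfolding hausdorff_factorial_moments[of L, OF rec] by simp
      finally show ?thesis
        using prod_scaled_choose[OF that, of n m] that by simp
    qed
    have "\<bar>(\<integral>x. clamp x ^ m \<partial>\<mu> n) - L m 0\<bar> \<le> (1 + \<bar>L m 0\<bar>) * (real (m * m) / real n)"
      if n: "n \<ge> max m 1" for n
    proof -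
      have [measurable]: "clamp \<in> borel_measurable borel"
        using cont_clamp by (intro borel_measurable_continuous_onI continuous_at_imp_continuous_on) auto
      have "(\<integral>x. clamp x ^ m \<partial>\<mu> n) = (\<Sum>k\<le>n. w n k * (real k / real n) ^ m)"
        by (subst int) (auto intro!: sum.cong simp: clamp divide_le_eq)
      moreover have "\<bar>(\<Sum>k\<le>n. w n k * (\<Prod>i<m. real k / real n - real i / real n))
          - (\<Sum>k\<le>n. w n k * (real k / real n) ^ m)\<bar> \<le> real (m * m) / real n"
      proof -
        have "\<bar>(\<Sum>k\<le>n. w n k * (\<Prod>i<m. real k / real n - real i / real n))
            - (\<Sum>k\<le>n. w n k * (real k / real n) ^ m)\<bar>
          \<le> (\<Sum>k\<le>n. w n k * \<bar>(\<Prod>i<m. real k / real n - real i / real n) - (real k / real n) ^ m\<bar>)"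
          unfolding sum_subtractf[symmetric] right_diff_distrib[symmetric]
          by (rule order_trans[OF sum_abs]) (simp add: abs_mult w0)
        also have "\<dots> \<le> (\<Sum>k\<le>n. w n k * (real (m * m) / real n))"
          using n by (intro sum_mono mult_left_mono prod_shift_approx w0) (auto simp: divide_le_eq)
        also have "\<dots> = real (m * m) / real n"
          unfolding sum_distrib_right[symmetric] w1 by simp
        finally show ?thesis .
      qed
      moreover have "\<bar>(\<Prod>i<m. 1 - real i / real n) * L m 0 - L m 0\<bar> \<le> real (m * m) / real n * \<bar>L m 0\<bar>"
      proof -
        have "\<bar>(\<Prod>i<m. 1 - real i / real n) * L m 0 - L m 0\<bar>
            = \<bar>(\<Prod>i<m. 1 - real i / real n) - 1 ^ m\<bar> * \<bar>L m 0\<bar>"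
          by (simp add: algebra_simps flip: abs_mult)
        also have "\<dots> \<le> real (m * m) / real n * \<bar>L m 0\<bar>"
          using n by (intro mult_right_mono prod_shift_approx) auto
        finally show ?thesis .
      qed
      moreover have "(1 + \<bar>L m 0\<bar>) * (real (m * m) / real n)
          = real (m * m) / real n + real (m * m) / real n * \<bar>L m 0\<bar>"
        by (simp only: distrib_right mult_1 mult.commute)
      ultimately show ?thesis
        using fac[of n] n by linarith
    qed
    hence ev: "\<forall>\<^sub>F n in sequentially.
        norm ((\<integral>x. clamp x ^ m \<partial>\<mu> n) - L m 0) \<le> (1 + \<bar>L m 0\<bar>) * (real (m * m) / real n)"
      unfolding eventually_at_top_linorder by (intro exI[of _ "max m 1"]) auto
    have "(\<lambda>n. (1 + \<bar>L m 0\<bar>) * (real (m * m) / real n)) \<longlonglongrightarrow> (1 + \<bar>L m 0\<bar>) * 0"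
      by (intro tendsto_mult tendsto_const lim_const_over_n)
    hence "(\<lambda>n. \<integral>x. clamp x ^ m \<partial>\<mu> n) \<longlonglongrightarrow> L m 0"
      using tendsto_norm_diffI[OF ev] by simp
    hence "(\<lambda>n. \<integral>x. clamp x ^ m \<partial>\<mu> (r n)) \<longlonglongrightarrow> L m 0"
      using r LIMSEQ_subseq_LIMSEQ[of _ _ r] by (simp add: comp_def)
    moreover have "(\<lambda>n. \<integral>x. clamp x ^ m \<partial>\<mu> (r n)) \<longlonglongrightarrow> (\<integral>x. clamp x ^ m \<partial>\<rho>)"
      using clamp01
      by (intro conv[of _ 1] continuous_intros cont_clamp) (auto simp: power_abs power_le_one)
    ultimately have "(\<integral>x. clamp x ^ m \<partial>\<rho>) = L m 0"
      using LIMSEQ_unique by blast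
    moreover have "(\<integral>x. clamp x ^ m \<partial>\<rho>) = (\<integral>x. x ^ m \<partial>\<rho>)"
    proof (rule integral_cong_AE)
      show "AE x in \<rho>. clamp x ^ m = x ^ m"
        using supp by eventually_elim (simp add: clamp)
      have "clamp \<in> borel_measurable borel"
        using cont_clamp by (intro borel_measurable_continuous_onI continuous_at_imp_continuous_on) auto
      thus "(\<lambda>x. clamp x ^ m) \<in> borel_measurable \<rho>"
        by simp
    qed simp
    ultimately show ?thesis
      by simp
  qed
  ultimately show ?thesis
    using that \<rho> by blast
qed

text \<open>The two operators commute because \<open>c = 1 - b\<close>.  Hence half of any pair of equal factors can be moved
  to the other side of the inner product, and only the exponents 0 and 1 remain.\<close>

lemma positive_word_nonneg:
  fixes b c :: "'a::chilbert_space \<Rightarrow> 'a"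
  assumes b: "bounded_selfadjoint b" and c: "bounded_selfadjoint c"
    and sum: "\<And>h. b h + c h = h"
    and pos: "\<And>h. Re (cinner (b h) h) \<ge> 0" "\<And>h. Re (cinner (c h) h) \<ge> 0"
  shows "Re (cinner ((b ^^ k) ((c ^^ l) h)) h) \<ge> 0"
proof -
  have c_eq: "c h = h - b h" for h
    using sum[of h] by (simp add: algebra_simps)
  have comm: "b (c h) = c (b h)" for h
    by (simp add: c_eq bounded_clinearD(3)[OF bounded_selfadjointD(1)[OF b]])
  have comm_pow: "b ((c ^^ l) h) = (c ^^ l) (b h)" for l h
    by (induction l) (simp_all add: comm)
  have comm_pow': "c ((b ^^ k) h) = (b ^^ k) (c h)" for k h
    by (induction k) (simp_all flip: comm)
  have cl: "Re (cinner ((c ^^ l) h) h) \<ge> 0 \<and> Re (cinner (b ((c ^^ l) h)) h) \<ge> 0" for l h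
  proof (induction l arbitrary: h rule: nat_less_induct)
    case (1 l)
    consider "l = 0" | "l = 1" | l' where "l = Suc (Suc l')"
      by (metis One_nat_def not0_implies_Suc)
    thus ?case
    proof cases
      case 1
      thus ?thesis
        using pos by (simp add: cinner_self)
    next
      case 2
      \<comment> \<open>\<open>bc = bc(b + c) = bcb + cbc\<close>, a sum of two positive operators.\<close>
      have "cinner (b (c h)) h = cinner (b (c h)) (b h) + cinner (b (c h)) (c h)"
        using sum[of h] cinner_add_right[of "b (c h)" "b h" "c h"] by simp
      moreover have "cinner (b (c h)) (b h) = cinner (c (b h)) (b h)"
        by (simp add: comm)
      ultimately show ?thesis
        using 2 pos(1)[of "c h"] pos(2)[of "b h"] pos(2)[of h] by simp
    next
      case 3
      have "(c ^^ l) h = c ((c ^^ l') (c h))"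
        by (simp add: 3 funpow_swap1)
      hence "cinner ((c ^^ l) h) h = cinner ((c ^^ l') (c h)) (c h)"
        "cinner (b ((c ^^ l) h)) h = cinner (b ((c ^^ l') (c h))) (c h)"
        by (simp_all add: bounded_selfadjointD(2)[OF c] comm)
      thus ?thesis
        using 1 3 by simp
    qed
  qed
  show ?thesis
  proof (induction k arbitrary: h rule: nat_less_induct)
    case (1 k)
    consider "k = 0" | "k = 1" | k' where "k = Suc (Suc k')"
      by (metis One_nat_def not0_implies_Suc)
    thus ?case
    proof cases
      case 3
      have "(b ^^ k) ((c ^^ l) h) = b ((b ^^ k') ((c ^^ l) (b h)))"
        by (simp add: 3 funpow_swap1 comm_pow)
      hence "cinner ((b ^^ k) ((c ^^ l) h)) h = cinner ((b ^^ k') ((c ^^ l) (b h))) (b h)"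
        by (simp add: bounded_selfadjointD(2)[OF b])
      thus ?thesis
        using 1 3 by simp
    qed (use cl in auto)
  qed
qed

text \<open>If \<open>a\<close> has norm at most \<open>R\<close>, then \<open>b = (R + a) / 2R\<close> and \<open>c = (R - a) / 2R\<close> are positive with
  sum 1, so that \<open>L k l = \<langle>b\<^sup>k c\<^sup>l \<xi>, \<xi>\<rangle>\<close> satisfies the hypotheses of Hausdorff's theorem.  The
  distribution of \<open>a\<close> is the image of the measure found there under \<open>x \<mapsto> 2Rx - R\<close>.\<close>

lemma has_distr_exists:
  fixes a :: "'h::chilbert_space \<Rightarrow> 'h"
  assumes a: "bounded_selfadjoint a" and \<xi>: "norm \<xi> = 1"
  shows "\<exists>\<rho>. has_distr a \<xi> \<rho>"
proof -
  note lin = bounded_clinearD[OF bounded_selfadjointD(1)[OF a]]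
  note sa = bounded_selfadjointD(2)[OF a]
  obtain R where R: "R > 0" "\<And>h. norm (a h) \<le> R * norm h"
    using bounded_clinear_boundE[OF bounded_selfadjointD(1)[OF a]] by blast
  define b where "b h = complex_of_real (1 / (2 * R)) *\<^sub>C (complex_of_real R *\<^sub>C h + a h)" for h
  define c where "c h = complex_of_real (1 / (2 * R)) *\<^sub>C (complex_of_real R *\<^sub>C h - a h)" for h
  have bnd: "\<bar>Re (cinner (a h) h)\<bar> \<le> R * (norm h)\<^sup>2" for h
  proof -
    have "cmod (cinner (a h) h) \<le> (R * norm h) * norm h"
      by (rule order_trans[OF cauchy_schwarz]) (intro mult_right_mono R norm_ge_zero)
    thus ?thesis
      using abs_Re_le_cmod[of "cinner (a h) h"] by (simp add: power2_eq_square)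
  qed
  have cl_id: "bounded_clinear (\<lambda>h :: 'h. h)"
    using bounded_clinear_id by (simp add: id_def)
  have b: "bounded_selfadjoint b" and c: "bounded_selfadjoint c"
    unfolding bounded_selfadjoint_def b_def c_def using a
    by (auto intro!: bounded_clinear_add bounded_clinear_diff bounded_clinear_scaleC cl_id
        simp: bounded_selfadjoint_def cinner_simps)
  have sum: "b h + c h = h" for h
  proof -
    have "b h + c h = complex_of_real (1 / (2 * R)) *\<^sub>C
        (complex_of_real R *\<^sub>C h + complex_of_real R *\<^sub>C h)"
      unfolding b_def c_def scaleC_add_right[symmetric] by (simp only: add_diff_add diff_add_cancel algebra_simps)
    also have "\<dots> = (complex_of_real (1 / (2 * R)) * (complex_of_real R + complex_of_real R)) *\<^sub>C h"
      by (simp only: scaleC_add_left[symmetric] scaleC_scaleC)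
    also have "complex_of_real (1 / (2 * R)) * (complex_of_real R + complex_of_real R) = 1"
      using R(1) by (simp add: field_simps)
    finally show ?thesis
      by simp
  qed
  have pos: "Re (cinner (b h) h) \<ge> 0" "Re (cinner (c h) h) \<ge> 0" for h
  proof -
    have Re_of_real_mult: "Re (complex_of_real r * z) = r * Re z" for r z
      by simp
    have "Re (cinner (b h) h) = 1 / (2 * R) * (R * (norm h)\<^sup>2 + Re (cinner (a h) h))"
      "Re (cinner (c h) h) = 1 / (2 * R) * (R * (norm h)\<^sup>2 - Re (cinner (a h) h))"
      unfolding b_def c_def cinner_simps Re_of_real_mult
      by (simp_all only: plus_complex.simps minus_complex.simps Re_of_real_mult cinner_self
          Re_complex_of_real)
    moreover have "R * (norm h)\<^sup>2 + Re (cinner (a h) h) \<ge> 0" "R * (norm h)\<^sup>2 - Re (cinner (a h) h) \<ge> 0"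
      using bnd[of h] by linarith+
    ultimately show "Re (cinner (b h) h) \<ge> 0" "Re (cinner (c h) h) \<ge> 0"
      using R(1) by simp_all
  qed
  define L where "L k l = Re (cinner ((b ^^ k) ((c ^^ l) \<xi>)) \<xi>)" for k l
  obtain \<rho> where \<rho>: "real_distribution \<rho>" "AE x in \<rho>. 0 \<le> x \<and> x \<le> 1"
    "\<And>m. (\<integral>x. x ^ m \<partial>\<rho>) = L m 0"
  proof (rule Hausdorff_moment_problem[of L])
    fix k l
    have "(b ^^ k) ((c ^^ l) \<xi>) = (b ^^ k) (b ((c ^^ l) \<xi>) + c ((c ^^ l) \<xi>))"
      by (simp add: sum)
    also have "\<dots> = (b ^^ Suc k) ((c ^^ l) \<xi>) + (b ^^ k) ((c ^^ Suc l) \<xi>)"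
      by (simp add: bounded_clinearD(1)[OF bounded_clinear_funpow[OF bounded_selfadjointD(1)[OF b]]]
          funpow_swap1)
    finally show "L k l = L (Suc k) l + L k (Suc l)"
      by (simp only: L_def cinner_add_left plus_complex.simps)
    show "L k l \<ge> 0"
      unfolding L_def by (rule positive_word_nonneg[OF b c sum pos])
  qed (use \<xi> in \<open>auto simp: L_def cinner_unit\<close>)
  interpret real_distribution \<rho>
    by (rule \<rho>)
  have "AE x in \<rho>. norm (x ^ k * (2 * R * x - R) ^ n) \<le> R ^ n" for k n
    using \<rho>(2)
  proof eventually_elim
    case (elim x)
    have "\<bar>x\<bar> ^ k * \<bar>2 * R * x - R\<bar> ^ n \<le> 1 ^ k * R ^ n"
      using elim R(1) mult_left_mono[of x 1 R] by (intro mult_mono power_mono) (auto simp: abs_le_iff)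
    thus ?case
      by (simp add: abs_mult power_abs)
  qed
  hence int: "integrable \<rho> (\<lambda>x. x ^ k * (2 * R * x - R) ^ n)" for k n
    by (intro integrable_const_bound[where B = "R ^ n"]) auto
  have a_eq: "a h = complex_of_real (2 * R) *\<^sub>C b h - complex_of_real R *\<^sub>C h" for h
    using R(1) by (simp add: b_def scaleC_scaleC)
  \<comment> \<open>Mixed moments of \<open>b\<close> and \<open>a\<close>: one power of \<open>a\<close> at a time is expressed through \<open>b\<close>,
    which avoids expanding \<open>(2Rb - R)\<^sup>n\<close>.\<close>
  have mom: "Re (cinner ((b ^^ k) ((a ^^ n) \<xi>)) \<xi>) = (\<integral>x. x ^ k * (2 * R * x - R) ^ n \<partial>\<rho>)" for k n
  proof (induction n arbitrary: k)
    case 0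
    show ?case
      using \<rho>(3)[of k] by (simp add: L_def)
  next
    case (Suc n)
    note blin = bounded_clinearD[OF bounded_clinear_funpow[OF bounded_selfadjointD(1)[OF b]]]
    have "(b ^^ k) ((a ^^ Suc n) \<xi>)
        = (b ^^ k) (complex_of_real (2 * R) *\<^sub>C b ((a ^^ n) \<xi>) - complex_of_real R *\<^sub>C (a ^^ n) \<xi>)"
      by (simp only: funpow.simps(2) comp_apply a_eq[of "(a ^^ n) \<xi>"])
    also have "\<dots> = complex_of_real (2 * R) *\<^sub>C (b ^^ k) (b ((a ^^ n) \<xi>))
        - complex_of_real R *\<^sub>C (b ^^ k) ((a ^^ n) \<xi>)"
      by (simp only: blin)
    also have "(b ^^ k) (b ((a ^^ n) \<xi>)) = (b ^^ Suc k) ((a ^^ n) \<xi>)"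
      by (simp add: funpow_swap1)
    finally have "(b ^^ k) ((a ^^ Suc n) \<xi>) = complex_of_real (2 * R) *\<^sub>C (b ^^ Suc k) ((a ^^ n) \<xi>)
        - complex_of_real R *\<^sub>C (b ^^ k) ((a ^^ n) \<xi>)" .
    hence "Re (cinner ((b ^^ k) ((a ^^ Suc n) \<xi>)) \<xi>)
        = 2 * R * Re (cinner ((b ^^ Suc k) ((a ^^ n) \<xi>)) \<xi>) - R * Re (cinner ((b ^^ k) ((a ^^ n) \<xi>)) \<xi>)"
      by (simp only: cinner_simps minus_complex.simps times_complex.simps Re_complex_of_real
          Im_complex_of_real mult_zero_left diff_0_right)
    also have "\<dots> = (\<integral>x. 2 * R * (x ^ Suc k * (2 * R * x - R) ^ n) - R * (x ^ k * (2 * R * x - R) ^ n) \<partial>\<rho>)"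
      unfolding Suc.IH using int[of "Suc k" n] int[of k n] by (simp del: power_Suc)
    also have "\<dots> = (\<integral>x. x ^ k * (2 * R * x - R) ^ Suc n \<partial>\<rho>)"
      by (rule Bochner_Integration.integral_cong) (auto simp: algebra_simps)
    finally show ?case .
  qed
  define \<rho>' where "\<rho>' = distr \<rho> borel (\<lambda>x. 2 * R * x - R)"
  have rd: "real_distribution \<rho>'"
    unfolding \<rho>'_def by (intro real_distribution_distr) simp
  have "AE x in \<rho>'. \<bar>x\<bar> \<le> R"
    unfolding \<rho>'_def
  proof (subst AE_distr_iff)
    show "AE x in \<rho>. \<bar>2 * R * x - R\<bar> \<le> R"
      using \<rho>(2) by eventually_elim (use R(1) mult_left_mono[of _ 1 R] in \<open>auto simp: abs_le_iff\<close>)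
  qed auto
  with rd have "compact_prob \<rho>'"
    by (auto simp: compact_prob_def)
  moreover have "vector_state \<xi> (a ^^ n) = complex_of_real (\<integral>x. x ^ n \<partial>\<rho>')" for n
  proof -
    have "cnj (cinner ((a ^^ n) \<xi>) \<xi>) = cinner ((a ^^ n) \<xi>) \<xi>"
      using selfadjoint_funpow[OF a, of n \<xi> \<xi>] by (simp flip: cinner_commute)
    hence "cinner ((a ^^ n) \<xi>) \<xi> = complex_of_real (Re (cinner ((a ^^ n) \<xi>) \<xi>))"
      by (simp add: complex_eq_iff)
    also have "Re (cinner ((a ^^ n) \<xi>) \<xi>) = (\<integral>x. x ^ n \<partial>\<rho>')"
      using mom[of 0 n] by (simp add: \<rho>'_def integral_distr)
    finally show ?thesis
      by (simp add: vector_state_def)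
  qed
  ultimately show ?thesis
    using a by (auto simp: has_distr_def)
qed


section \<open>Cauchy transforms\<close>

lemma cmod_cauchy_kernel_ge: "\<bar>Im z\<bar> \<le> cmod (z - complex_of_real x)"
  using abs_Im_le_cmod[of "z - complex_of_real x"] by simp

lemma cauchy_kernel_nonzero: "Im z > 0 \<Longrightarrow> z - complex_of_real x \<noteq> 0"
  by (auto simp: complex_eq_iff)

lemma integrable_cauchy_kernel:
  assumes "real_distribution \<rho>" "Im z > 0"
  shows "integrable \<rho> (\<lambda>x. 1 / (z - complex_of_real x))"
proof -
  interpret real_distribution \<rho>
    by fact
  have "norm (1 / (z - complex_of_real x)) \<le> 1 / Im z" for x
    using cmod_cauchy_kernel_ge[of z x] assms(2)
    by (simp only: norm_divide norm_one) (rule frac_le, auto)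
  thus ?thesis
    by (intro integrable_const_bound[where B = "1 / Im z"]) auto
qed

lemma minus_Im_cauchy_kernel:
  "- Im (1 / (z - complex_of_real x)) = Im z / ((Re z - x)\<^sup>2 + (Im z)\<^sup>2)"
  by (simp add: Im_divide)

lemma minus_Im_cauchy_transform:
  assumes "real_distribution \<rho>" "Im z > 0"
  shows "- Im (cauchy_transform \<rho> z) = (\<integral>x. Im z / ((Re z - x)\<^sup>2 + (Im z)\<^sup>2) \<partial>\<rho>)"
    and "integrable \<rho> (\<lambda>x. Im z / ((Re z - x)\<^sup>2 + (Im z)\<^sup>2))"
proof -
  note int = integrable_cauchy_kernel[OF assms]
  show "integrable \<rho> (\<lambda>x. Im z / ((Re z - x)\<^sup>2 + (Im z)\<^sup>2))"
    using integrable_Im[OF int] integrable_minus[of \<rho> "\<lambda>x. Im (1 / (z - complex_of_real x))"]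
    unfolding minus_Im_cauchy_kernel by blast
  have "- Im (cauchy_transform \<rho> z) = (\<integral>x. - Im (1 / (z - complex_of_real x)) \<partial>\<rho>)"
    unfolding cauchy_transform_def using int by (simp add: integral_Im)
  thus "- Im (cauchy_transform \<rho> z) = (\<integral>x. Im z / ((Re z - x)\<^sup>2 + (Im z)\<^sup>2) \<partial>\<rho>)"
    unfolding minus_Im_cauchy_kernel .
qed

lemma cauchy_transform_nonzero:
  assumes \<rho>: "real_distribution \<rho>" and z: "Im z > 0"
  shows "cauchy_transform \<rho> z \<noteq> 0"
proof
  interpret real_distribution \<rho>
    by fact
  assume "cauchy_transform \<rho> z = 0"
  hence "(\<integral>x. Im z / ((Re z - x)\<^sup>2 + (Im z)\<^sup>2) \<partial>\<rho>) = 0"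
    using minus_Im_cauchy_transform(1)[OF assms] by simp
  moreover have pos: "Im z / ((Re z - x)\<^sup>2 + (Im z)\<^sup>2) > 0" for x
    using z by (intro divide_pos_pos add_nonneg_pos) auto
  ultimately have "AE x in \<rho>. Im z / ((Re z - x)\<^sup>2 + (Im z)\<^sup>2) = 0"
    using integral_nonneg_eq_0_iff_AE[OF minus_Im_cauchy_transform(2)[OF assms]] less_imp_le[OF pos]
    by simp
  hence "AE x in \<rho>. False"
    by eventually_elim (use pos in \<open>auto simp: less_le\<close>)
  thus False
    by simp
qed

lemma
  shows integrable_lorentz: "integrable lborel (\<lambda>u::real. 1 / (1 + u\<^sup>2))"
    and integral_lorentz: "(\<integral>u. 1 / (1 + u\<^sup>2) \<partial>lborel) = pi"
proof -
  show "integrable lborel (\<lambda>u::real. 1 / (1 + u\<^sup>2))"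
    using integrable_inverse_1_plus_square by (simp add: set_integrable_def divide_inverse)
  show "(\<integral>u. 1 / (1 + u\<^sup>2) \<partial>lborel) = pi"
    using LBINT_inverse_1_plus_square
    by (simp add: interval_lebesgue_integral_def set_lebesgue_integral_def divide_inverse)
qed

text \<open>\<open>pi\<close> times the characteristic function of the Cauchy (Lorentz) distribution.\<close>

definition lorentz_char :: "real \<Rightarrow> complex" where
  "lorentz_char v = (\<integral>u. iexp (v * u) * complex_of_real (1 / (1 + u\<^sup>2)) \<partial>lborel)"

lemma lorentz_char_tendsto: "(\<lambda>n. lorentz_char (t / real (Suc n))) \<longlonglongrightarrow> complex_of_real pi"
proof -
  have "(\<lambda>n. lorentz_char (t / real (Suc n)))
      \<longlonglongrightarrow> (\<integral>u. complex_of_real (1 / (1 + u\<^sup>2)) \<partial>lborel)"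
    unfolding lorentz_char_def
  proof (rule integral_dominated_convergence[where w = "\<lambda>u. 1 / (1 + u\<^sup>2)"])
    have "(\<lambda>n. iexp (t / real (Suc n) * u) * complex_of_real (1 / (1 + u\<^sup>2)))
        \<longlonglongrightarrow> iexp (0 * u) * complex_of_real (1 / (1 + u\<^sup>2))" for u
      by (intro tendsto_intros isCont_tendsto_compose[OF isCont_iexp]
          LIMSEQ_Suc[OF lim_const_over_n])
    thus "AE u in lborel. (\<lambda>n. iexp (t / real (Suc n) * u) * complex_of_real (1 / (1 + u\<^sup>2)))
        \<longlonglongrightarrow> complex_of_real (1 / (1 + u\<^sup>2))"
      by simp
    show "AE u in lborel. norm (iexp (t / real (Suc n) * u) * complex_of_real (1 / (1 + u\<^sup>2)))
        \<le> 1 / (1 + u\<^sup>2)" for n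
      by (simp add: norm_mult del: of_real_divide)
  qed (use integrable_lorentz in auto)
  thus ?thesis
    by (simp add: integral_lorentz integral_complex_of_real del: of_real_divide)
qed

lemma poisson_kernel_affine:
  assumes "e > 0"
  shows "e / ((s + e * u - s)\<^sup>2 + e\<^sup>2) = 1 / e * (1 / (1 + u\<^sup>2 :: real))"
proof -
  have "(s + e * u - s)\<^sup>2 + e\<^sup>2 = e * (e * (1 + u\<^sup>2))"
    by (simp add: power2_eq_square algebra_simps)
  thus ?thesis
    using assms by simp
qed

text \<open>On a horizontal line, minus the imaginary part of the Cauchy transform is (up to \<open>pi\<close>) the density
  of the convolution of \<open>\<rho>\<close> with a scaled Cauchy distribution, and a Fourier transform turns
  convolutions into products.\<close>

lemma fourier_minus_Im_cauchy_transform: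
  assumes \<rho>: "real_distribution \<rho>" and e: "e > 0"
  shows "(\<integral>x. iexp (t * x) * complex_of_real (- Im (cauchy_transform \<rho> (Complex x e))) \<partial>lborel)
      = char \<rho> t * lorentz_char (t * e)"
proof -
  interpret real_distribution \<rho>
    by fact
  interpret pair_sigma_finite \<rho> lborel
    by standard
  define p where "p s x = e / ((x - s)\<^sup>2 + e\<^sup>2)" for s x
  define f where "f s x = iexp (t * x) * complex_of_real (p s x)" for s x
  have p0: "p s x \<ge> 0" for s x
    using e by (simp add: p_def)
  have [measurable]: "(\<lambda>(s, x). p s x) \<in> borel_measurable (\<rho> \<Otimes>\<^sub>M lborel)"
    unfolding p_def by measurable
  have [measurable]: "p s \<in> borel_measurable borel" for s
    unfolding p_def by measurable
  have [measurable]: "(\<lambda>(s, x). f s x) \<in> borel_measurable (\<rho> \<Otimes>\<^sub>M lborel)"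
    unfolding f_def by measurable
  have [measurable]: "f s \<in> borel_measurable borel" for s
    unfolding f_def by measurable
  have p_affine: "p s (s + e * u) = 1 / e * (1 / (1 + u\<^sup>2))" for s u
    unfolding p_def by (rule poisson_kernel_affine[OF e])
  have p_int: "integrable lborel (p s)" for s
    using lborel_integrable_real_affine_iff[of e "p s" s] e integrable_mult_right[OF integrable_lorentz, of "1 / e"]
    unfolding p_affine by blast
  have p_integral: "(\<integral>x. p s x \<partial>lborel) = pi" for s
  proof -
    have "(\<integral>x. p s x \<partial>lborel) = e * (1 / e * pi)"
      using lborel_integral_real_affine[of e "p s" s] e
      unfolding p_affine integral_mult_right_zero integral_lorentz by simp
    thus ?thesis
      using e by simp
  qed
  have norm_f: "norm (f s x) = p s x" for s x
    using p0 by (simp add: f_def norm_mult)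
  have f_int: "integrable lborel (f s)" for s
    by (rule Bochner_Integration.integrable_bound[OF p_int]) (use p0 in \<open>auto simp: norm_f\<close>)
  have "integrable (\<rho> \<Otimes>\<^sub>M lborel) (\<lambda>(s, x). f s x)"
    by (rule Fubini_integrable) (auto simp: norm_f p_integral f_int)
  hence "(\<integral>x. (\<integral>s. f s x \<partial>\<rho>) \<partial>lborel) = (\<integral>s. (\<integral>x. f s x \<partial>lborel) \<partial>\<rho>)"
    by (rule Fubini_integral)
  also have "(\<lambda>x. \<integral>s. f s x \<partial>\<rho>)
      = (\<lambda>x. iexp (t * x) * complex_of_real (- Im (cauchy_transform \<rho> (Complex x e))))"
  proof
    fix x
    have "- Im (cauchy_transform \<rho> (Complex x e)) = (\<integral>s. p s x \<partial>\<rho>)"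
      using minus_Im_cauchy_transform(1)[OF \<rho>, of "Complex x e"] e by (simp add: p_def)
    thus "(\<integral>s. f s x \<partial>\<rho>) = iexp (t * x) * complex_of_real (- Im (cauchy_transform \<rho> (Complex x e)))"
      unfolding f_def integral_mult_right_zero integral_complex_of_real by simp
  qed
  also have "(\<lambda>s. \<integral>x. f s x \<partial>lborel) = (\<lambda>s. iexp (t * s) * lorentz_char (t * e))"
  proof
    fix s
    have "(\<integral>x. f s x \<partial>lborel) = e *\<^sub>R (\<integral>u. f s (s + e * u) \<partial>lborel)"
      using e by (subst lborel_integral_real_affine[of e _ s]) auto
    also have "(\<lambda>u. f s (s + e * u))
        = (\<lambda>u. (complex_of_real (1 / e) * iexp (t * s)) * (iexp (t * e * u) * complex_of_real (1 / (1 + u\<^sup>2))))"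
    proof
      fix u
      have "iexp (t * (s + e * u)) = iexp (t * s) * iexp (t * e * u)"
        by (simp add: algebra_simps flip: exp_add)
      thus "f s (s + e * u)
          = (complex_of_real (1 / e) * iexp (t * s)) * (iexp (t * e * u) * complex_of_real (1 / (1 + u\<^sup>2)))"
        by (simp only: f_def p_affine of_real_mult mult_ac)
    qed
    also have "e *\<^sub>R (\<integral>u. \<dots> u \<partial>lborel) = iexp (t * s) * lorentz_char (t * e)"
      unfolding integral_mult_right_zero lorentz_char_def[symmetric]
      using e by (simp add: scaleR_conv_of_real)
    finally show "(\<integral>x. f s x \<partial>lborel) = iexp (t * s) * lorentz_char (t * e)" .
  qed
  also have "(\<integral>s. iexp (t * s) * lorentz_char (t * e) \<partial>\<rho>) = char \<rho> t * lorentz_char (t * e)"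
    by (simp add: char_def)
  finally show ?thesis .
qed

text \<open>Close to the real line the factor \<open>lorentz_char\<close> of the preceding lemma tends to \<open>pi\<close>, so it can
  be cancelled and the characteristic function is recovered from the Cauchy transform.\<close>

lemma cauchy_transform_inj:
  assumes \<rho>: "real_distribution \<rho>" and \<rho>': "real_distribution \<rho>'"
    and eq: "\<And>z. Im z > 0 \<Longrightarrow> cauchy_transform \<rho> z = cauchy_transform \<rho>' z"
  shows "\<rho> = \<rho>'"
proof -
  have "char \<rho> t = char \<rho>' t" for t
  proof -
    have "\<forall>\<^sub>F n in sequentially. lorentz_char (t / real (Suc n)) \<noteq> 0"
      by (rule tendsto_imp_eventually_ne[OF lorentz_char_tendsto]) simp
    then obtain n where n: "lorentz_char (t * (1 / real (Suc n))) \<noteq> 0"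
      by (auto simp: eventually_at_top_linorder)
    have "char \<rho> t * lorentz_char (t * (1 / real (Suc n)))
        = char \<rho>' t * lorentz_char (t * (1 / real (Suc n)))"
      using fourier_minus_Im_cauchy_transform[OF \<rho>, of "1 / real (Suc n)" t]
        fourier_minus_Im_cauchy_transform[OF \<rho>', of "1 / real (Suc n)" t]
      by (simp add: eq)
    thus ?thesis
      using n by simp
  qed
  thus ?thesis
    using Levy_uniqueness[OF \<rho> \<rho>'] by blast
qed

lemma K_transform_inj:
  assumes "real_distribution \<rho>" "real_distribution \<rho>'"
    and "\<And>z. Im z > 0 \<Longrightarrow> K_transform \<rho> z = K_transform \<rho>' z"
  shows "\<rho> = \<rho>'"
  using assms by (intro cauchy_transform_inj) (auto simp: K_transform_def)

lemma boolean_conv_eqI: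
  assumes "real_distribution \<rho>"
    and "\<And>z. Im z > 0 \<Longrightarrow> K_transform \<rho> z = K_transform \<mu> z + K_transform \<nu> z"
  shows "\<mu> \<uplus> \<nu> = \<rho>"
  unfolding boolean_conv_def
  by (rule the_equality) (use assms in \<open>auto intro: K_transform_inj\<close>)

text \<open>The difference quotient minus the candidate derivative is again an integral, whose integrand
  \<open>(z - w) / ((z - x) (w - x)\<^sup>2)\<close> is of order \<open>z - w\<close> uniformly in \<open>x\<close>.\<close>

lemma holomorphic_cauchy_transform:
  assumes \<rho>: "real_distribution \<rho>"
  shows "cauchy_transform \<rho> holomorphic_on {z. Im z > 0}"
proof (rule holomorphic_onI)
  interpret real_distribution \<rho>
    by fact
  fix w
  assume "w \<in> {z. Im z > 0}"
  hence w: "Im w > 0"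
    by simp
  define D where "D = - (\<integral>x. 1 / (w - complex_of_real x)\<^sup>2 \<partial>\<rho>)"
  have int2: "integrable \<rho> (\<lambda>x. 1 / (w - complex_of_real x)\<^sup>2)"
  proof (rule integrable_const_bound[where B = "1 / (Im w)\<^sup>2"])
    have "norm (1 / (w - complex_of_real x)\<^sup>2) \<le> 1 / (Im w)\<^sup>2" for x
      using cmod_cauchy_kernel_ge[of w x] w
      by (auto simp: norm_divide norm_power intro!: divide_left_mono power_mono mult_pos_pos zero_less_power
        dest: cauchy_kernel_nonzero)
    thus "AE x in \<rho>. norm (1 / (w - complex_of_real x)\<^sup>2) \<le> 1 / (Im w)\<^sup>2"
      by simp
  qed simp
  have bound: "norm ((cauchy_transform \<rho> z - cauchy_transform \<rho> w) / (z - w) - D)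
      \<le> 2 / (Im w) ^ 3 * cmod (z - w)" if z: "z \<noteq> w" "cmod (z - w) < Im w / 2" for z
  proof -
    have Imz: "Im z > Im w / 2"
      using z abs_Im_le_cmod[of "z - w"] by (simp add: abs_le_iff)
    hence Imz0: "Im z > 0"
      using w by simp
    have int: "integrable \<rho> (\<lambda>x. (1 / (z - complex_of_real x) - 1 / (w - complex_of_real x)) / (z - w))"
      by (intro integrable_divide Bochner_Integration.integrable_diff integrable_cauchy_kernel \<rho> Imz0 w)
    have eq: "(1 / (z - complex_of_real x) - 1 / (w - complex_of_real x)) / (z - w)
        + 1 / (w - complex_of_real x)\<^sup>2
        = (z - w) / ((z - complex_of_real x) * (w - complex_of_real x)\<^sup>2)" for x
    proof -
      have "(1 / a - 1 / b) / (a - b) + 1 / b\<^sup>2 = (a - b) / (a * b\<^sup>2)"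
        if "a \<noteq> 0" "b \<noteq> 0" "a \<noteq> b" for a b :: complex
        using that by (simp add: divide_simps) (simp add: power2_eq_square algebra_simps)
      from this[OF cauchy_kernel_nonzero[OF Imz0] cauchy_kernel_nonzero[OF w], of x x] show ?thesis
        using z(1) by simp
    qed
    have "(cauchy_transform \<rho> z - cauchy_transform \<rho> w) / (z - w) - D
        = (\<integral>x. (1 / (z - complex_of_real x) - 1 / (w - complex_of_real x)) / (z - w)
            + 1 / (w - complex_of_real x)\<^sup>2 \<partial>\<rho>)"
      unfolding D_def cauchy_transform_def
      using int int2 integrable_cauchy_kernel[OF \<rho> Imz0] integrable_cauchy_kernel[OF \<rho> w] by simp
    also have "\<dots> = (\<integral>x. (z - w) / ((z - complex_of_real x) * (w - complex_of_real x)\<^sup>2) \<partial>\<rho>)"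
      unfolding eq ..
    also have "norm \<dots> \<le> (\<integral>x. 2 / (Im w) ^ 3 * cmod (z - w) \<partial>\<rho>)"
    proof (rule Bochner_Integration.integral_norm_bound_integral)
      show "integrable \<rho> (\<lambda>x. (z - w) / ((z - complex_of_real x) * (w - complex_of_real x)\<^sup>2))"
        using Bochner_Integration.integrable_add[OF int int2] unfolding eq .
      fix x
      have "Im w / 2 * (Im w)\<^sup>2 \<le> cmod (z - complex_of_real x) * (cmod (w - complex_of_real x))\<^sup>2"
        using cmod_cauchy_kernel_ge[of w x] cmod_cauchy_kernel_ge[of z x] w Imz
        by (intro mult_mono power_mono) auto
      hence "cmod (z - w) / (cmod (z - complex_of_real x) * (cmod (w - complex_of_real x))\<^sup>2)
          \<le> cmod (z - w) / (Im w / 2 * (Im w)\<^sup>2)"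
        using w by (intro divide_left_mono mult_pos_pos) (auto intro: cauchy_kernel_nonzero Imz0
           simp: zero_less_power cauchy_kernel_nonzero[OF w, simplified] cauchy_kernel_nonzero[OF Imz0, simplified])
      also have "\<dots> = 2 / (Im w) ^ 3 * cmod (z - w)"
        by (simp add: power2_eq_square power3_eq_cube mult_ac)
      finally show "norm ((z - w) / ((z - complex_of_real x) * (w - complex_of_real x)\<^sup>2))
          \<le> 2 / (Im w) ^ 3 * cmod (z - w)"
        by (simp add: norm_divide norm_mult norm_power)
    qed simp
    finally show ?thesis
      using prob_space by simp
  qed
  have "((\<lambda>z. (cauchy_transform \<rho> z - cauchy_transform \<rho> w) / (z - w)) \<longlongrightarrow> D) (at w)"
  proof (rule tendsto_norm_diffI)
    show "\<forall>\<^sub>F z in at w. norm ((cauchy_transform \<rho> z - cauchy_transform \<rho> w) / (z - w) - D)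
        \<le> 2 / (Im w) ^ 3 * cmod (z - w)"
      unfolding eventually_at using w bound by (intro exI[of _ "Im w / 2"]) (auto simp: dist_norm)
    have "((\<lambda>z. 2 / (Im w) ^ 3 * cmod (z - w)) \<longlongrightarrow> 2 / (Im w) ^ 3 * cmod (w - w)) (at w)"
      by (intro tendsto_intros)
    thus "((\<lambda>z. 2 / (Im w) ^ 3 * cmod (z - w)) \<longlongrightarrow> 0) (at w)"
      by simp
  qed
  hence "(cauchy_transform \<rho> has_field_derivative D) (at w)"
    by (simp add: has_field_derivative_iff)
  thus "cauchy_transform \<rho> field_differentiable at w within {z. Im z > 0}"
    using field_differentiable_def field_differentiable_at_within by blast
qed

lemma holomorphic_K_transform:
  assumes \<rho>: "real_distribution \<rho>"
  shows "K_transform \<rho> holomorphic_on {z. Im z > 0}"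
  unfolding K_transform_def
  by (intro holomorphic_intros holomorphic_cauchy_transform \<rho>) (auto simp: cauchy_transform_nonzero[OF \<rho>])

text \<open>For \<open>\<bar>x\<bar> \<le> R < \<bar>z\<bar>\<close> the kernel is a geometric series in \<open>x / z\<close> with uniformly small remainder.\<close>

lemma cauchy_transform_moment_series:
  assumes \<rho>: "real_distribution \<rho>" "AE x in \<rho>. \<bar>x\<bar> \<le> R"
    and z: "Im z > 0" "cmod z > R"
  shows "(\<lambda>N. \<Sum>n<N. 1 / z ^ Suc n * complex_of_real (\<integral>x. x ^ n \<partial>\<rho>)) \<longlonglongrightarrow> cauchy_transform \<rho> z"
proof -
  interpret real_distribution \<rho>
    by fact
  have z0: "z \<noteq> 0"
    using z(1) by auto
  have R0: "R \<ge> 0"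
    using eventually_happens'[OF ae_filter_bot \<rho>(2)] by force
  note int = integrable_power_bounded_support[OF \<rho>]
  have "cmod ((\<Sum>n<N. 1 / z ^ Suc n * complex_of_real (\<integral>x. x ^ n \<partial>\<rho>)) - cauchy_transform \<rho> z)
      \<le> (R / cmod z) ^ N / (cmod z - R)" for N
  proof -
    have geo: "(\<Sum>n<N. 1 / z ^ Suc n * complex_of_real (x ^ n)) - 1 / (z - complex_of_real x)
        = - ((complex_of_real x / z) ^ N / (z - complex_of_real x))" for x
    proof -
      have nz: "z - complex_of_real x \<noteq> 0"
        using z(1) by (rule cauchy_kernel_nonzero)
      have "(\<Sum>n<N. 1 / z ^ Suc n * complex_of_real (x ^ n)) = (\<Sum>n<N. (complex_of_real x / z) ^ n) / z"
        by (simp add: sum_divide_distrib power_divide field_simps)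
      also have "\<dots> = (1 - (complex_of_real x / z) ^ N) / (1 - complex_of_real x / z) / z"
        using nz z0 by (subst sum_gp_strict) auto
      also have "\<dots> = (1 - (complex_of_real x / z) ^ N) / ((1 - complex_of_real x / z) * z)"
        by simp
      also have "(1 - complex_of_real x / z) * z = z - complex_of_real x"
        using z0 by (simp add: left_diff_distrib)
      finally show ?thesis
        by (simp add: diff_divide_distrib)
    qed
    have int_s: "integrable \<rho> (\<lambda>x. \<Sum>n<N. 1 / z ^ Suc n * complex_of_real (x ^ n))"
      by (intro Bochner_Integration.integrable_sum integrable_mult_right integrable_of_real int)
    have "(\<Sum>n<N. 1 / z ^ Suc n * complex_of_real (\<integral>x. x ^ n \<partial>\<rho>)) - cauchy_transform \<rho> z
        = (\<integral>x. (\<Sum>n<N. 1 / z ^ Suc n * complex_of_real (x ^ n)) - 1 / (z - complex_of_real x) \<partial>\<rho>)"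
    proof -
      have "(\<integral>x. (\<Sum>n<N. 1 / z ^ Suc n * complex_of_real (x ^ n)) \<partial>\<rho>)
          = (\<Sum>n<N. \<integral>x. 1 / z ^ Suc n * complex_of_real (x ^ n) \<partial>\<rho>)"
        by (intro Bochner_Integration.integral_sum integrable_mult_right integrable_of_real int)
      also have "\<dots> = (\<Sum>n<N. 1 / z ^ Suc n * complex_of_real (\<integral>x. x ^ n \<partial>\<rho>))"
        unfolding integral_mult_right_zero integral_complex_of_real ..
      finally show ?thesis
        using Bochner_Integration.integral_diff[OF int_s integrable_cauchy_kernel[OF \<rho>(1) z(1)]]
        by (simp only: cauchy_transform_def)
    qed
    also have "norm \<dots> \<le> (\<integral>x. norm ((\<Sum>n<N. 1 / z ^ Suc n * complex_of_real (x ^ n)) - 1 / (z - complex_of_real x)) \<partial>\<rho>)"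
      by (rule integral_norm_bound)
    also have "\<dots> \<le> (\<integral>x. (R / cmod z) ^ N / (cmod z - R) \<partial>\<rho>)"
    proof (rule integral_mono_AE)
      show "integrable \<rho> (\<lambda>x. norm ((\<Sum>n<N. 1 / z ^ Suc n * complex_of_real (x ^ n)) - 1 / (z - complex_of_real x)))"
        by (intro integrable_norm Bochner_Integration.integrable_diff int_s integrable_cauchy_kernel \<rho> z)
      show "AE x in \<rho>. norm ((\<Sum>n<N. 1 / z ^ Suc n * complex_of_real (x ^ n)) - 1 / (z - complex_of_real x))
          \<le> (R / cmod z) ^ N / (cmod z - R)"
        using \<rho>(2)
      proof eventually_elim
        case (elim x)
        have "cmod z - R \<le> cmod (z - complex_of_real x)"
          using elim norm_triangle_ineq2[of z "complex_of_real x"] by simp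
        moreover have "cmod (complex_of_real x / z) ^ N \<le> (R / cmod z) ^ N"
          using elim by (intro power_mono) (auto simp: norm_divide divide_right_mono)
        ultimately have "cmod (complex_of_real x / z) ^ N / cmod (z - complex_of_real x)
            \<le> (R / cmod z) ^ N / (cmod z - R)"
          using z R0 by (intro frac_le) auto
        thus ?case
          unfolding geo norm_minus_cancel norm_divide norm_power .
      qed
    qed simp
    finally show ?thesis
      using prob_space by simp
  qed
  moreover have "(\<lambda>N. (R / cmod z) ^ N / (cmod z - R)) \<longlonglongrightarrow> 0"
    using tendsto_divide[OF LIMSEQ_power_zero[of "R / cmod z"] tendsto_const[of "cmod z - R"]] z R0 z0
    by simp
  ultimately show ?thesis
    by (rule tendsto_norm_diffI[OF always_eventually[OF allI]])
qed

subsection \<open>Resolvent vectors and the additivity of \<open>K\<close>\<close>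

text \<open>The Neumann series of the resolvent, applied to one vector; \<open>z - a\<close> telescopes on its partial sums.\<close>

lemma neumann_series_vector:
  fixes a :: "'h::chilbert_space \<Rightarrow> 'h"
  assumes a: "bounded_clinear a" and R: "R > 0" "\<And>h. norm (a h) \<le> R * norm h" and z: "cmod z > R"
  obtains u where "(\<lambda>N. \<Sum>n<N. (1 / z ^ Suc n) *\<^sub>C (a ^^ n) \<xi>) \<longlonglongrightarrow> u" "z *\<^sub>C u - a u = \<xi>"
proof -
  have z0: "z \<noteq> 0"
    using z R(1) by auto
  have norm_pow: "norm ((a ^^ n) \<xi>) \<le> R ^ n * norm \<xi>" for n
  proof (induction n)
    case (Suc n)
    have "norm ((a ^^ Suc n) \<xi>) \<le> R * norm ((a ^^ n) \<xi>)"
      using R(2) by simp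
    also have "\<dots> \<le> R * (R ^ n * norm \<xi>)"
      using R(1) Suc by (intro mult_left_mono) auto
    finally show ?case
      by simp
  qed simp
  define U where "U N = (\<Sum>n<N. (1 / z ^ Suc n) *\<^sub>C (a ^^ n) \<xi>)" for N
  have "summable (\<lambda>n. (1 / z ^ Suc n) *\<^sub>C (a ^^ n) \<xi>)"
  proof (rule summable_comparison_test')
    have "norm (R / cmod z) < 1"
      using R(1) z z0 by simp
    thus "summable (\<lambda>n. norm \<xi> / cmod z * (R / cmod z) ^ n)"
      using R(1) by (intro summable_mult summable_geometric) simp
    fix n
    have "norm ((1 / z ^ Suc n) *\<^sub>C (a ^^ n) \<xi>) = 1 / cmod z ^ Suc n * norm ((a ^^ n) \<xi>)"
      by (simp only: norm_scaleC norm_divide norm_power norm_one)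
    also have "\<dots> \<le> 1 / cmod z ^ Suc n * (R ^ n * norm \<xi>)"
      by (intro mult_left_mono norm_pow) simp
    also have "\<dots> = norm \<xi> / cmod z * (R / cmod z) ^ n"
      by (simp add: power_divide)
    finally show "norm ((1 / z ^ Suc n) *\<^sub>C (a ^^ n) \<xi>) \<le> norm \<xi> / cmod z * (R / cmod z) ^ n" .
  qed
  then obtain u where u: "U \<longlonglongrightarrow> u"
    unfolding U_def by (auto simp: summable_def sums_def)
  have tel: "z *\<^sub>C U N - a (U N) = \<xi> - (1 / z ^ N) *\<^sub>C (a ^^ N) \<xi>" for N
  proof (induction N)
    case 0
    show ?case
      by (simp add: U_def bounded_clinearD(4)[OF a])
  next
    case (Suc N)
    have "z *\<^sub>C U (Suc N) - a (U (Suc N)) = (z *\<^sub>C U N - a (U N))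
        + ((z * (1 / z ^ Suc N)) *\<^sub>C (a ^^ N) \<xi> - (1 / z ^ Suc N) *\<^sub>C (a ^^ Suc N) \<xi>)"
      by (simp add: U_def bounded_clinearD[OF a] scaleC_add_right scaleC_scaleC)
    also have "z * (1 / z ^ Suc N) = 1 / z ^ N"
      using z0 by simp
    finally show ?case
      using Suc by simp
  qed
  have "(\<lambda>N. z *\<^sub>C U N - a (U N)) \<longlonglongrightarrow> z *\<^sub>C u - a u"
    by (intro tendsto_diff bounded_linear.tendsto[OF bounded_linear_scaleC]
        bounded_clinear_tendsto[OF a] u)
  moreover have "(\<lambda>N. (1 / z ^ N) *\<^sub>C (a ^^ N) \<xi>) \<longlonglongrightarrow> 0"
  proof (rule Lim_null_comparison[OF always_eventually[OF allI]])
    fix N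
    have "norm ((1 / z ^ N) *\<^sub>C (a ^^ N) \<xi>) = 1 / cmod z ^ N * norm ((a ^^ N) \<xi>)"
      by (simp only: norm_scaleC norm_divide norm_power norm_one)
    also have "\<dots> \<le> 1 / cmod z ^ N * (R ^ N * norm \<xi>)"
      by (intro mult_left_mono norm_pow) simp
    also have "\<dots> = (R / cmod z) ^ N * norm \<xi>"
      by (simp add: power_divide)
    finally show "norm ((1 / z ^ N) *\<^sub>C (a ^^ N) \<xi>) \<le> (R / cmod z) ^ N * norm \<xi>" .
  next
    show "(\<lambda>N. (R / cmod z) ^ N * norm \<xi>) \<longlonglongrightarrow> 0"
      using tendsto_mult[OF LIMSEQ_power_zero[of "R / cmod z"] tendsto_const[of "norm \<xi>"]] R(1) z z0
      by simp
  qed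
  hence "(\<lambda>N. z *\<^sub>C U N - a (U N)) \<longlonglongrightarrow> \<xi> - 0"
    unfolding tel by (intro tendsto_intros)
  ultimately have "z *\<^sub>C u - a u = \<xi>"
    using LIMSEQ_unique by fastforce
  with u that show ?thesis
    unfolding U_def by blast
qed

lemma large_scalar_not_eigenvalue:
  assumes "bounded_clinear a"
  obtains R where "\<And>z v. cmod z > R \<Longrightarrow> z *\<^sub>C v = a v \<Longrightarrow> v = 0"
proof -
  obtain R where R: "R > 0" "\<And>h. norm (a h) \<le> R * norm h"
    using bounded_clinear_boundE[OF assms] by blast
  have "v = 0" if z: "cmod z > R" and v: "z *\<^sub>C v = a v" for z v
  proof -
    have "cmod z * norm v \<le> R * norm v"
      using R(2)[of v] by (simp flip: v add: norm_scaleC)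
    thus ?thesis
      using z by (simp add: mult_le_cancel_right)
  qed
  thus ?thesis
    by (rule that)
qed

text \<open>The hypothesis on \<open>b\<close> says that \<open>b\<close> sees of each \<open>a\<^sup>n \<xi>\<close> only its component along \<open>\<xi>\<close>; the same then
  holds for the resolvent vector, which is a limit of combinations of them.\<close>

lemma resolvent_vector:
  fixes a b :: "'h::chilbert_space \<Rightarrow> 'h"
  assumes a: "has_distr a \<xi> \<rho>" and b: "bounded_clinear b"
    and ba: "\<And>n. b ((a ^^ n) \<xi>) = vector_state \<xi> (a ^^ n) *\<^sub>C b \<xi>"
  shows "\<exists>R>0. \<forall>z. Im z > 0 \<longrightarrow> cmod z > R \<longrightarrow>
    (\<exists>u. z *\<^sub>C u - a u = \<xi> \<and> cinner u \<xi> = cauchy_transform \<rho> z \<and> b u = cauchy_transform \<rho> z *\<^sub>C b \<xi>)"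
proof -
  have cl: "bounded_clinear a" and "compact_prob \<rho>"
    and mom: "\<And>n. vector_state \<xi> (a ^^ n) = complex_of_real (\<integral>x. x ^ n \<partial>\<rho>)"
    using a by (auto simp: has_distr_def bounded_selfadjoint_def)
  obtain R1 where R1: "real_distribution \<rho>" "R1 > 0" "AE x in \<rho>. \<bar>x\<bar> \<le> R1"
    using \<open>compact_prob \<rho>\<close> by (rule compact_probE)
  obtain R2 where R2: "R2 > 0" "\<And>h. norm (a h) \<le> R2 * norm h"
    using bounded_clinear_boundE[OF cl] by blast
  have "\<exists>u. z *\<^sub>C u - a u = \<xi> \<and> cinner u \<xi> = cauchy_transform \<rho> z \<and> b u = cauchy_transform \<rho> z *\<^sub>C b \<xi>"
    if z: "Im z > 0" "cmod z > max R1 R2" for z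
  proof -
    have zR2: "cmod z > R2" and zR1: "cmod z > R1"
      using z by simp_all
    obtain u where u: "(\<lambda>N. \<Sum>n<N. (1 / z ^ Suc n) *\<^sub>C (a ^^ n) \<xi>) \<longlonglongrightarrow> u" "z *\<^sub>C u - a u = \<xi>"
      by (rule neumann_series_vector[OF cl R2 zR2])
    have G: "(\<lambda>N. \<Sum>n<N. 1 / z ^ Suc n * vector_state \<xi> (a ^^ n)) \<longlonglongrightarrow> cauchy_transform \<rho> z"
      using cauchy_transform_moment_series[OF R1(1,3) z(1) zR1] unfolding mom .
    have "(\<lambda>N. cinner (\<Sum>n<N. (1 / z ^ Suc n) *\<^sub>C (a ^^ n) \<xi>) \<xi>) \<longlonglongrightarrow> cinner u \<xi>"
      by (intro tendsto_cinner_left u)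
    hence "cinner u \<xi> = cauchy_transform \<rho> z"
      unfolding cinner_sum_left cinner_scaleC_left vector_state_def[symmetric]
      using G by (rule LIMSEQ_unique)
    moreover have "b u = cauchy_transform \<rho> z *\<^sub>C b \<xi>"
    proof -
      have eq: "b (\<Sum>n<N. (1 / z ^ Suc n) *\<^sub>C (a ^^ n) \<xi>)
          = (\<Sum>n<N. 1 / z ^ Suc n * vector_state \<xi> (a ^^ n)) *\<^sub>C b \<xi>" for N
        by (induction N)
           (simp_all add: bounded_clinearD[OF b] ba scaleC_scaleC scaleC_add_left del: power_Suc)
      have "(\<lambda>N. b (\<Sum>n<N. (1 / z ^ Suc n) *\<^sub>C (a ^^ n) \<xi>)) \<longlonglongrightarrow> cauchy_transform \<rho> z *\<^sub>C b \<xi>"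
        unfolding eq by (rule bounded_linear.tendsto[OF bounded_linear_scaleC_left G])
      with bounded_clinear_tendsto[OF b u(1)] show ?thesis
        by (rule LIMSEQ_unique)
    qed
    ultimately show ?thesis
      using u(2) by blast
  qed
  thus ?thesis
    using R1(2) by (intro exI[of _ "max R1 R2"]) auto
qed

text \<open>The two cross conditions are what is used of boolean independence: each variable acts on the
  cyclic space of the other one only through the component along \<open>\<xi>\<close>.  The resolvent vector of the sum
  is built from those of the summands for large \<open>z\<close>, where all three Neumann series converge, and the
  identity extends to the upper half-plane by analytic continuation.\<close>

lemma K_transform_additive:
  fixes b1 b2 :: "'h::chilbert_space \<Rightarrow> 'h"
  assumes \<xi>: "norm \<xi> = 1"
    and b1: "has_distr b1 \<xi> \<rho>1" and b2: "has_distr b2 \<xi> \<rho>2" and s: "has_distr (\<lambda>h. b1 h + b2 h) \<xi> \<rho>"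
    and b21: "\<And>n. b2 ((b1 ^^ n) \<xi>) = vector_state \<xi> (b1 ^^ n) *\<^sub>C b2 \<xi>"
    and b12: "\<And>n. b1 ((b2 ^^ n) \<xi>) = vector_state \<xi> (b2 ^^ n) *\<^sub>C b1 \<xi>"
    and z: "Im z > 0"
  shows "K_transform \<rho> z = K_transform \<rho>1 z + K_transform \<rho>2 z"
proof -
  have cl: "bounded_clinear b1" "bounded_clinear b2" "bounded_clinear (\<lambda>h. b1 h + b2 h)"
    and rd: "real_distribution \<rho>1" "real_distribution \<rho>2" "real_distribution \<rho>"
    using b1 b2 s by (auto simp: has_distr_def bounded_selfadjoint_def compact_prob_def)
  obtain R1 where R1: "R1 > 0"
    "\<forall>z. Im z > 0 \<longrightarrow> cmod z > R1 \<longrightarrow> (\<exists>u. z *\<^sub>C u - b1 u = \<xi> \<and> cinner u \<xi> = cauchy_transform \<rho>1 z \<and>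
       b2 u = cauchy_transform \<rho>1 z *\<^sub>C b2 \<xi>)"
    using resolvent_vector[OF b1 cl(2) b21] by blast
  obtain R2 where R2:
    "\<forall>z. Im z > 0 \<longrightarrow> cmod z > R2 \<longrightarrow> (\<exists>u. z *\<^sub>C u - b2 u = \<xi> \<and> cinner u \<xi> = cauchy_transform \<rho>2 z \<and>
       b1 u = cauchy_transform \<rho>2 z *\<^sub>C b1 \<xi>)"
    using resolvent_vector[OF b2 cl(1) b12] by blast
  have "bounded_clinear (\<lambda>h :: 'h. 0 :: 'h)"
    by (simp add: bounded_clinear_def)
  from resolvent_vector[OF s this] obtain R3 where R3:
    "\<forall>z. Im z > 0 \<longrightarrow> cmod z > R3 \<longrightarrow> (\<exists>u. z *\<^sub>C u - (b1 u + b2 u) = \<xi> \<and> cinner u \<xi> = cauchy_transform \<rho> z)"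
    by auto
  obtain R4 where R4: "\<And>z v. cmod z > R4 \<Longrightarrow> z *\<^sub>C v = b1 v + b2 v \<Longrightarrow> v = 0"
    using large_scalar_not_eigenvalue[OF cl(3)] by blast
  define R where "R = Max {R1, R2, R3, R4}"
  have large: "K_transform \<rho> z = K_transform \<rho>1 z + K_transform \<rho>2 z"
    if z: "Im z > 0" "cmod z > R" for z
  proof -
    define G1 where "G1 = cauchy_transform \<rho>1 z"
    define G2 where "G2 = cauchy_transform \<rho>2 z"
    define G where "G = cauchy_transform \<rho> z"
    have G0: "G1 \<noteq> 0" "G2 \<noteq> 0" "G \<noteq> 0"
      unfolding G1_def G2_def G_def using rd z(1) by (simp_all add: cauchy_transform_nonzero)
    obtain u1 where u1: "z *\<^sub>C u1 - b1 u1 = \<xi>" "cinner u1 \<xi> = G1" "b2 u1 = G1 *\<^sub>C b2 \<xi>"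
      using R1(2) z unfolding G1_def R_def by auto
    obtain u2 where u2: "z *\<^sub>C u2 - b2 u2 = \<xi>" "cinner u2 \<xi> = G2" "b1 u2 = G2 *\<^sub>C b1 \<xi>"
      using R2 z unfolding G2_def R_def by auto
    obtain u where u: "z *\<^sub>C u - (b1 u + b2 u) = \<xi>" "cinner u \<xi> = G"
      using R3 z unfolding G_def R_def by auto
    \<comment> \<open>Normalized to have component 1 along \<open>\<xi>\<close>, so that \<open>b2 k1 = b2 \<xi>\<close> and \<open>b1 k2 = b1 \<xi>\<close>.\<close>
    define k1 where "k1 = (1 / G1) *\<^sub>C u1"
    define k2 where "k2 = (1 / G2) *\<^sub>C u2"
    define v where "v = k1 + k2 - \<xi>"
    define c where "c = 1 / G1 + 1 / G2 - z"
    have k: "z *\<^sub>C (c *\<^sub>C w) - b (c *\<^sub>C w) = c *\<^sub>C (z *\<^sub>C w - b w)"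
      if "bounded_clinear b" for b :: "'h \<Rightarrow> 'h" and c w
      by (simp add: bounded_clinearD[OF that] scaleC_diff_right scaleC_scaleC mult.commute)
    have k1: "z *\<^sub>C k1 - b1 k1 = (1 / G1) *\<^sub>C \<xi>" "b2 k1 = b2 \<xi>" "cinner k1 \<xi> = 1"
    proof -
      show "z *\<^sub>C k1 - b1 k1 = (1 / G1) *\<^sub>C \<xi>"
        unfolding k1_def k[OF cl(1)] u1(1) ..
      show "b2 k1 = b2 \<xi>" "cinner k1 \<xi> = 1"
        using G0 u1 by (simp_all add: k1_def bounded_clinearD(2)[OF cl(2)] scaleC_scaleC cinner_scaleC_left)
    qed
    have k2: "z *\<^sub>C k2 - b2 k2 = (1 / G2) *\<^sub>C \<xi>" "b1 k2 = b1 \<xi>" "cinner k2 \<xi> = 1"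
    proof -
      show "z *\<^sub>C k2 - b2 k2 = (1 / G2) *\<^sub>C \<xi>"
        unfolding k2_def k[OF cl(2)] u2(1) ..
      show "b1 k2 = b1 \<xi>" "cinner k2 \<xi> = 1"
        using G0 u2 by (simp_all add: k2_def bounded_clinearD(2)[OF cl(1)] scaleC_scaleC cinner_scaleC_left)
    qed
    have "z *\<^sub>C v - (b1 v + b2 v) = (z *\<^sub>C k1 - b1 k1) + (z *\<^sub>C k2 - b2 k2) - z *\<^sub>C \<xi>"
    proof -
      have "b1 v = b1 k1" "b2 v = b2 k2"
        by (simp_all add: v_def bounded_clinearD[OF cl(1)] bounded_clinearD[OF cl(2)] k1(2) k2(2))
      thus ?thesis
        by (simp add: v_def scaleC_add_right scaleC_diff_right)
    qed
    also have "\<dots> = c *\<^sub>C \<xi>"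
      by (simp add: k1(1) k2(1) c_def scaleC_add_left cvec.scale_left_diff_distrib)
    finally have v: "z *\<^sub>C v - (b1 v + b2 v) = c *\<^sub>C \<xi>" .
    have "z *\<^sub>C (v - c *\<^sub>C u) - (b1 (v - c *\<^sub>C u) + b2 (v - c *\<^sub>C u))
        = (z *\<^sub>C v - (b1 v + b2 v)) - c *\<^sub>C (z *\<^sub>C u - (b1 u + b2 u))"
      by (simp add: bounded_clinearD[OF cl(1)] bounded_clinearD[OF cl(2)] scaleC_add_right
          scaleC_diff_right scaleC_scaleC mult.commute)
    hence "z *\<^sub>C (v - c *\<^sub>C u) = b1 (v - c *\<^sub>C u) + b2 (v - c *\<^sub>C u)"
      by (simp add: v u(1))
    \<comment> \<open>For large \<open>z\<close> the resolvent equation has only one solution.\<close>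
    hence "v - c *\<^sub>C u = 0"
      using R4[of z "v - c *\<^sub>C u"] z unfolding R_def by auto
    hence "cinner v \<xi> = c * G"
      using u(2) by (simp add: cinner_scaleC_left)
    moreover have "cinner v \<xi> = 1"
      using k1(3) k2(3) \<xi> by (simp add: v_def cinner_simps cinner_unit)
    ultimately have "1 / G = c"
      using G0(3) by (simp add: field_simps)
    thus ?thesis
      unfolding K_transform_def G_def[symmetric] G1_def[symmetric] G2_def[symmetric] c_def
      by (simp add: algebra_simps)
  qed
  show ?thesis
  proof (rule analytic_continuation_open[where f = "K_transform \<rho>"
        and g = "\<lambda>z. K_transform \<rho>1 z + K_transform \<rho>2 z" and s = "{z. Im z > 0} \<inter> {z. cmod z > R}" and s' = "{z. Im z > 0}"])
    show "open {z. Im z > 0}"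
      by (rule open_halfspace_Im_gt)
    show "open ({z. Im z > 0} \<inter> {z. cmod z > R})"
      by (intro open_Int open_halfspace_Im_gt open_Collect_less continuous_intros)
    have "Complex 0 (R + 1) \<in> {z. Im z > 0} \<inter> {z. cmod z > R}"
      using R1(1) by (auto simp: R_def complex_norm less_max_iff_disj)
    thus "{z. Im z > 0} \<inter> {z. cmod z > R} \<noteq> {}"
      by blast
    show "connected {z. Im z > 0}"
      by (intro convex_connected convex_halfspace_Im_gt)
    show "K_transform \<rho> holomorphic_on {z. Im z > 0}"
      "(\<lambda>z. K_transform \<rho>1 z + K_transform \<rho>2 z) holomorphic_on {z. Im z > 0}"
      using rd by (auto intro!: holomorphic_K_transform holomorphic_on_add)
  qed (use large z in auto)
qed


section \<open>Alternating index lists\<close>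

lemma bar_bar [simp]: "bar (bar j) = j"
  by (cases j) auto

lemma bar_neq [simp]: "bar j \<noteq> j" "j \<noteq> bar j"
  by (cases j; simp)+

lemma neq_iff_eq_bar: "i \<noteq> j \<longleftrightarrow> i = bar j"
  by (cases i; cases j) auto

lemma neq_bar_iff: "i \<noteq> bar j \<longleftrightarrow> i = j"
  by (cases i; cases j) auto

lemma alternating_iff_idx: "alternating w \<longleftrightarrow> successively (\<noteq>) (map idx_of w)"
  by (simp add: alternating_def successively_map)

text \<open>With two indices, the first letter and the parity of the length determine the last letter.\<close>

lemma last_alternating:
  "successively (\<noteq>) (x # i) \<Longrightarrow> last (x # i) = (if even (length i) then x else bar x)"
  by (induction i arbitrary: x) (auto simp: neq_iff_eq_bar)

text \<open>The index lists of the summands that make up the range of \<open>P\<^sub>j(n)\<close>, for \<open>n \<ge> 1\<close>.\<close>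

definition leg_class :: "idx \<Rightarrow> nat \<Rightarrow> idx list \<Rightarrow> bool" where
  "leg_class j n i \<longleftrightarrow> (length i = n - 1 \<and> (i \<noteq> [] \<longrightarrow> hd i \<noteq> j)) \<or>
     (length i = n \<and> (i \<noteq> [] \<longrightarrow> hd i \<noteq> bar j))"

text \<open>The parity of \<open>n\<close> turns the conditions on length and first index into one on the last index.
  This is the combinatorial core of the decomposition into branches.\<close>

lemma ex_odd_leg_class:
  assumes "successively (\<noteq>) i"
  shows "(\<exists>r. leg_class j (2 * r + 1) i) \<longleftrightarrow> i = [] \<or> last i = j"
proof (cases i)
  case Nil
  have "leg_class j (2 * 0 + 1) []"
    by (simp add: leg_class_def)
  thus ?thesis
    using Nil by blast
next
  case (Cons x i')
  have l: "last i = (if even (length i') then x else bar x)"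
    using last_alternating[of x i'] assms Cons by simp
  have "leg_class j (2 * r + 1) i \<longleftrightarrow>
      (Suc (length i') = 2 * r \<and> x \<noteq> j) \<or> (length i' = 2 * r \<and> x = j)" for r
    using Cons by (simp add: leg_class_def neq_bar_iff)
  hence "(\<exists>r. leg_class j (2 * r + 1) i) \<longleftrightarrow>
      (odd (length i') \<and> x \<noteq> j) \<or> (even (length i') \<and> x = j)"
    by (metis evenE even_Suc dvd_triv_left)
  thus ?thesis
    using l Cons by (cases x; cases j) auto
qed

lemma ex_even_leg_class:
  assumes "successively (\<noteq>) i"
  shows "(\<exists>r. leg_class j (2 * r + 2) i) \<longleftrightarrow> i \<noteq> [] \<and> last i = bar j"
proof (cases i)
  case Nil
  thus ?thesis
    by (simp add: leg_class_def)
next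
  case (Cons x i')
  have l: "last i = (if even (length i') then x else bar x)"
    using last_alternating[of x i'] assms Cons by simp
  have "leg_class j (2 * r + 2) i \<longleftrightarrow>
      (length i' = 2 * r \<and> x \<noteq> j) \<or> (length i' = Suc (2 * r) \<and> x = j)" for r
    using Cons by (auto simp: leg_class_def neq_bar_iff)
  hence "(\<exists>r. leg_class j (2 * r + 2) i) \<longleftrightarrow>
      (even (length i') \<and> x \<noteq> j) \<or> (odd (length i') \<and> x = j)"
    by (metis evenE oddE Suc_eq_plus1 even_Suc dvd_triv_left)
  thus ?thesis
    using l Cons by (cases x; cases j) auto
qed


section \<open>Projections onto sums of summands of the free product\<close>

lemma letter_inner_idx: "idx_of u \<noteq> idx_of v \<Longrightarrow> letter_inner u v = 0"
  by (cases u; cases v) auto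

locale free_product =
  fixes \<xi>1 :: "'a::chilbert_space" and \<xi>2 :: "'b::chilbert_space" and \<xi> :: "'h::chilbert_space"
    and T :: "('a + 'b) list \<Rightarrow> 'h"
  assumes space: "free_product_space \<xi>1 \<xi>2 \<xi> T"
begin

abbreviation "words \<equiv> reduced \<xi>1 \<xi>2"

abbreviation type_of :: "('a + 'b) list \<Rightarrow> idx list" where
  "type_of w \<equiv> map idx_of w"

lemma T_Nil: "T [] = \<xi>"
  and total: "closure (cspan (T ` words)) = UNIV"
  using space by (auto simp: free_product_space_def)

lemma T_inner:
  "w \<in> words \<Longrightarrow> w' \<in> words \<Longrightarrow> cinner (T w) (T w') =
     (if length w = length w' then \<Prod>k<length w. letter_inner (w ! k) (w' ! k) else 0)"
  using space by (auto simp: free_product_space_def)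

lemma Nil_in_words: "[] \<in> words"
  by (simp add: reduced_def alternating_def)

lemma words_alternating: "w \<in> words \<Longrightarrow> successively (\<noteq>) (type_of w)"
  by (simp add: reduced_def alternating_iff_idx)

lemma norm_xi: "norm \<xi> = 1"
proof -
  have "cinner \<xi> \<xi> = 1"
    using T_inner[OF Nil_in_words Nil_in_words] by (simp add: T_Nil)
  hence "(norm \<xi>)\<^sup>2 = 1"
    unfolding cinner_self using of_real_eq_1_iff by blast
  thus ?thesis
    using power2_eq_1_iff[of "norm \<xi>"] norm_ge_zero[of \<xi>] by auto
qed

lemma T_orthogonal:
  assumes "w \<in> words" "w' \<in> words" "type_of w \<noteq> type_of w'"
  shows "cinner (T w) (T w') = 0"
proof (cases "length w = length w'")
  case True
  then obtain k where k: "k < length w" "idx_of (w ! k) \<noteq> idx_of (w' ! k)"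
    using assms(3) by (auto simp: list_eq_iff_nth_eq)
  hence "(\<Prod>k<length w. letter_inner (w ! k) (w' ! k)) = 0"
    using letter_inner_idx by (intro prod_zero) auto
  thus ?thesis
    using T_inner[OF assms(1,2)] True by simp
qed (use T_inner assms in auto)

lemma operator_eqI:
  assumes "bounded_clinear f" "bounded_clinear g" and "\<And>w. w \<in> words \<Longrightarrow> f (T w) = g (T w)"
  shows "f = g"
  by (rule bounded_clinear_eqI[OF assms(1,2) total]) (use assms(3) in auto)

text \<open>Families of summands are described by predicates on index lists.\<close>

definition tensors :: "(idx list \<Rightarrow> bool) \<Rightarrow> 'h set" where
  "tensors p = T ` {w \<in> words. p (type_of w)}"

definition summand :: "(idx list \<Rightarrow> bool) \<Rightarrow> 'h set" where
  "summand p = closure (cspan (tensors p))"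

definition proj :: "(idx list \<Rightarrow> bool) \<Rightarrow> 'h \<Rightarrow> 'h" where
  "proj p = orth_proj (summand p)"

lemma summand_closed_subspace: "closed (summand p)" "cvec.subspace (summand p)"
  unfolding summand_def by (rule closed_subspace_closure_cspan)+

lemma summand_mono: "(\<And>i. p i \<Longrightarrow> q i) \<Longrightarrow> summand p \<subseteq> summand q"
  unfolding summand_def tensors_def by (intro closure_mono cvec.span_mono image_mono) auto

lemma tensors_cong:
  assumes "\<And>i. successively (\<noteq>) i \<Longrightarrow> p i \<longleftrightarrow> q i"
  shows "tensors p = tensors q"
proof -
  have "{w \<in> words. p (type_of w)} = {w \<in> words. q (type_of w)}"
    using assms words_alternating by blast
  thus ?thesis
    by (simp only: tensors_def)
qed

lemma proj_cong:
  assumes "\<And>i. successively (\<noteq>) i \<Longrightarrow> p i \<longleftrightarrow> q i"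
  shows "proj p = proj q"
  using tensors_cong[of p q, OF assms] by (simp add: proj_def summand_def)

lemma bounded_clinear_proj: "bounded_clinear (proj p)"
  unfolding proj_def by (rule bounded_clinear_orth_proj[OF summand_closed_subspace])

lemmas proj_linear = bounded_clinearD[OF bounded_clinear_proj]

lemma norm_proj_le: "norm (proj p h) \<le> norm h"
  unfolding proj_def by (rule norm_orth_proj_le[OF summand_closed_subspace])

lemma proj_T:
  assumes w: "w \<in> words"
  shows "proj p (T w) = (if p (type_of w) then T w else 0)"
  unfolding proj_def
proof (rule orth_proj_unique[OF _ _ summand_closed_subspace(2)])
  show "(if p (type_of w) then T w else 0) \<in> summand p"
  proof (cases "p (type_of w)")
    case True
    hence "T w \<in> cspan (tensors p)"
      using w by (intro cvec.span_base) (auto simp: tensors_def)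
    thus ?thesis
      using True closure_subset by (auto simp: summand_def)
  next
    case False
    thus ?thesis
      using cvec.subspace_0[OF summand_closed_subspace(2)] by simp
  qed
  fix m
  assume "m \<in> summand p"
  thus "cinner (T w - (if p (type_of w) then T w else 0)) m = 0"
    unfolding summand_def
  proof (induction rule: closure_cspan_induct)
    case (base m)
    then obtain w' where w': "w' \<in> words" "p (type_of w')" "m = T w'"
      by (auto simp: tensors_def)
    show ?case
    proof (cases "p (type_of w)")
      case False
      hence "type_of w \<noteq> type_of w'"
        using w'(2) by metis
      thus ?thesis
        using T_orthogonal[OF w w'(1)] False by (simp add: w'(3))
    qed simp
  qed (auto simp: cinner_simps
      intro!: closed_Collect_eq linear_continuous_on bounded_linear_cinner_right)
qed

lemma proj_all: "proj (\<lambda>_. True) h = h"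
  using operator_eqI[OF bounded_clinear_proj bounded_clinear_id, of "\<lambda>_. True"]
  by (simp add: proj_T fun_eq_iff)

lemma proj_add:
  assumes "\<And>i. successively (\<noteq>) i \<Longrightarrow> p i \<longleftrightarrow> q i \<or> r i"
    and "\<And>i. successively (\<noteq>) i \<Longrightarrow> \<not> (q i \<and> r i)"
  shows "proj p h = proj q h + proj r h"
proof -
  have "proj p = (\<lambda>h. proj q h + proj r h)"
    by (rule operator_eqI)
       (use assms words_alternating in \<open>auto simp: proj_T intro!: bounded_clinear_add bounded_clinear_proj\<close>)
  thus ?thesis
    by metis
qed

lemma proj_proj: "proj p (proj p h) = proj p h"
proof -
  have "proj p \<circ> proj p = proj p"
    by (rule operator_eqI)
       (auto simp: proj_T proj_linear intro!: bounded_clinear_comp bounded_clinear_proj)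
  thus ?thesis
    by (metis comp_apply)
qed

lemma bounded_selfadjoint_proj: "bounded_selfadjoint (proj p)"
  by (rule bounded_selfadjointI_total[OF bounded_clinear_proj total])
     (auto simp: proj_T intro!: T_orthogonal dest!: sym[of 0])

text \<open>The remainders of the series are projections too, hence uniformly bounded, and on each elementary
  tensor they are eventually zero.\<close>

lemma proj_sums:
  assumes disj: "\<And>i m n. q m i \<Longrightarrow> q n i \<Longrightarrow> m = n"
  shows "(\<lambda>n :: nat. proj (q n) h) sums proj (\<lambda>i. \<exists>n. q n i) h"
proof -
  define tail where "tail N = proj (\<lambda>i. \<exists>n\<ge>N. q n i)" for N
  have partial: "(\<Sum>n<N. proj (q n) h) = proj (\<lambda>i. \<exists>n. q n i) h - tail N h" for N
  proof (induction N)
    case (Suc N)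
    have "tail N h = proj (q N) h + tail (Suc N) h"
      unfolding tail_def
    proof (rule proj_add)
      show "(\<exists>n\<ge>N. q n i) \<longleftrightarrow> q N i \<or> (\<exists>n\<ge>Suc N. q n i)" for i
        by (metis le_eq_less_or_eq Suc_le_eq)
      show "\<not> (q N i \<and> (\<exists>n\<ge>Suc N. q n i))" for i
        using disj Suc_n_not_le_n by blast
    qed
    thus ?case
      using Suc by simp
  qed (simp add: tail_def)
  have "(\<lambda>N. tail N h) \<longlonglongrightarrow> 0"
  proof (rule strong_convergence_total[OF _ _ total])
    show "bounded_clinear (tail N)" for N
      unfolding tail_def by (rule bounded_clinear_proj)
    show "norm (tail N x) \<le> 1 * norm x" for N x
      unfolding tail_def using norm_proj_le by simp
    fix x
    assume "x \<in> T ` words"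
    then obtain w where w: "w \<in> words" "x = T w"
      by blast
    show "(\<lambda>N. tail N x) \<longlonglongrightarrow> 0"
    proof (rule tendsto_eventually)
      show "\<forall>\<^sub>F N in sequentially. tail N x = 0"
      proof (cases "\<exists>n. q n (type_of w)")
        case True
        then obtain n where "q n (type_of w)"
          by blast
        hence "tail N x = 0" if "N \<ge> Suc n" for N
          using disj that w unfolding tail_def by (force simp: proj_T)
        thus ?thesis
          unfolding eventually_at_top_linorder by blast
      qed (auto simp: tail_def w proj_T)
    qed
  qed
  hence "(\<lambda>N. proj (\<lambda>i. \<exists>n. q n i) h - tail N h) \<longlonglongrightarrow> proj (\<lambda>i. \<exists>n. q n i) h - 0"
    by (intro tendsto_intros)
  thus ?thesis
    by (simp add: sums_def partial)
qed

lemma leg_class_disjoint: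
  assumes "leg_class j m i" "leg_class j n i" "m \<ge> 1" "n \<ge> 1"
  shows "m = n"
  using assms by (cases i) (auto simp: leg_class_def neq_bar_iff)

lemma level_eq_summand:
  "level \<xi>1 \<xi>2 T j n = summand (\<lambda>i. length i = n \<and> (i \<noteq> [] \<longrightarrow> hd i \<noteq> j))"
proof -
  have "{w \<in> words. length w = n \<and> (w \<noteq> [] \<longrightarrow> idx_of (hd w) \<noteq> j)}
      = {w \<in> words. length (type_of w) = n \<and> (type_of w \<noteq> [] \<longrightarrow> hd (type_of w) \<noteq> j)}"
    by (auto simp: hd_map)
  thus ?thesis
    by (simp only: level_def summand_def tensors_def)
qed

text \<open>Both sides are characterized by \<open>x - y\<close> being orthogonal to the two levels.  The decomposition
  \<open>y = u + v\<close> required on the left is the splitting of the projection along the two levels.\<close>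

lemma orth_proj_leg:
  assumes n: "n \<ge> 1"
  shows "orth_proj {u + v |u v. u \<in> level \<xi>1 \<xi>2 T j (n - 1) \<and> v \<in> level \<xi>1 \<xi>2 T (bar j) n}
    = proj (leg_class j n)"
proof
  fix x
  define p where "p i \<longleftrightarrow> length i = n - 1 \<and> (i \<noteq> [] \<longrightarrow> hd i \<noteq> j)" for i
  define q where "q i \<longleftrightarrow> length i = n \<and> (i \<noteq> [] \<longrightarrow> hd i \<noteq> bar j)" for i
  have sub: "summand p \<subseteq> summand (leg_class j n)" "summand q \<subseteq> summand (leg_class j n)"
    by (rule summand_mono; simp add: p_def q_def leg_class_def)+
  have eq: "proj (leg_class j n) x = proj p x + proj q x"
    by (rule proj_add) (use n in \<open>auto simp: p_def q_def leg_class_def neq_bar_iff\<close>)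
  have "orth_proj {u + v |u v. u \<in> summand p \<and> v \<in> summand q} x = proj (leg_class j n) x"
  proof (rule orth_proj_unique)
    show "proj (leg_class j n) x \<in> {u + v |u v. u \<in> summand p \<and> v \<in> summand q}"
      unfolding eq unfolding proj_def using orth_proj_in[OF summand_closed_subspace] by blast
    show "cvec.subspace {u + v |u v. u \<in> summand p \<and> v \<in> summand q}"
      by (intro cvec.subspace_sums summand_closed_subspace)
    fix m
    assume "m \<in> {u + v |u v. u \<in> summand p \<and> v \<in> summand q}"
    hence "m \<in> summand (leg_class j n)"
      using sub by (auto intro!: cvec.subspace_add[OF summand_closed_subspace(2)])
    thus "cinner (x - proj (leg_class j n) x) m = 0"
      unfolding proj_def by (rule orth_proj_orth[OF summand_closed_subspace])
  qed
  thus "orth_proj {u + v |u v. u \<in> level \<xi>1 \<xi>2 T j (n - 1) \<and> v \<in> level \<xi>1 \<xi>2 T (bar j) n} x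
      = proj (leg_class j n) x"
    unfolding level_eq_summand p_def q_def .
qed

end


section \<open>The operators \<open>\<lambda>\<^sub>j(a)\<close>\<close>

text \<open>A family of summands is saturated if it is a union of the pieces on which operators acting on the
  leg \<open>j\<close> are confined: a summand not starting with \<open>j\<close> together with the one obtained by putting an
  index \<open>j\<close> in front.\<close>

definition leg_saturated :: "idx \<Rightarrow> (idx list \<Rightarrow> bool) \<Rightarrow> bool" where
  "leg_saturated j p \<longleftrightarrow> (\<forall>i. (i \<noteq> [] \<longrightarrow> hd i \<noteq> j) \<longrightarrow> p (j # i) = p i)"

lemma leg_saturated_leg_class: "n \<ge> 1 \<Longrightarrow> leg_saturated j (leg_class j n)"
  by (fastforce simp: leg_saturated_def leg_class_def neq_bar_iff)

text \<open>Both legs of the free product at once: \<open>(e, \<iota>, j)\<close> stands for \<open>(\<xi>1, Inl, One)\<close> or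
  \<open>(\<xi>2, Inr, Two)\<close>, whose vectors have different types.\<close>

locale free_leg = free_product \<xi>1 \<xi>2 \<xi> T
  for \<xi>1 :: "'a::chilbert_space" and \<xi>2 :: "'b::chilbert_space" and \<xi> :: "'h::chilbert_space"
    and T :: "('a + 'b) list \<Rightarrow> 'h" +
  fixes e :: "'k::chilbert_space" and \<iota> :: "'k \<Rightarrow> 'a + 'b" and j :: idx
  assumes idx_inj: "idx_of (\<iota> h) = j"
    and inner_inj: "letter_inner (\<iota> h) (\<iota> h') = cinner h h'"
    and inj_onto: "idx_of u = j \<Longrightarrow> \<exists>h. u = \<iota> h"
    and inj_orth: "(case \<iota> h of Inl a \<Rightarrow> cinner a \<xi>1 = 0 | Inr b \<Rightarrow> cinner b \<xi>2 = 0) \<longleftrightarrow> cinner h e = 0"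
    and unit_e: "norm e = 1"
begin

text \<open>The words to which a letter of index \<open>j\<close> can be prepended.\<close>

definition base_words :: "('a + 'b) list set" where
  "base_words = {w \<in> words. w \<noteq> [] \<longrightarrow> idx_of (hd w) \<noteq> j}"

abbreviation lt :: "'k \<Rightarrow> ('a + 'b) list \<Rightarrow> 'h" where
  "lt \<equiv> left_tensor e \<iota> T"

lemma cinner_e: "cinner e e = 1"
  using unit_e by (rule cinner_unit)

lemma base_words_in: "w \<in> base_words \<Longrightarrow> w \<in> words"
  by (simp add: base_words_def)

lemma Cons_in_words: "\<iota> h # w \<in> words \<longleftrightarrow> cinner h e = 0 \<and> w \<in> base_words"
proof -
  have "alternating (\<iota> h # w) \<longleftrightarrow> (w \<noteq> [] \<longrightarrow> idx_of (hd w) \<noteq> j) \<and> alternating w"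
    by (auto simp: alternating_def successively_Cons idx_inj)
  thus ?thesis
    using inj_orth[of h] by (auto simp: reduced_def base_words_def)
qed

lemma words_cases:
  assumes "w \<in> words"
  obtains "w \<in> base_words" | h w' where "w = \<iota> h # w'" "cinner h e = 0" "w' \<in> base_words"
proof (cases w)
  case Nil
  thus ?thesis
    using that(1) assms by (simp add: base_words_def)
next
  case (Cons u w')
  show ?thesis
  proof (cases "idx_of u = j")
    case True
    then obtain h where "u = \<iota> h"
      using inj_onto by blast
    thus ?thesis
      using that(2) Cons Cons_in_words assms by blast
  qed (use that(1) assms Cons in \<open>auto simp: base_words_def\<close>)
qed

lemma T_Cons_inner:
  assumes "cinner h e = 0" "cinner h' e = 0" "w \<in> base_words" "w' \<in> base_words"
  shows "cinner (T (\<iota> h # w)) (T (\<iota> h' # w')) = cinner h h' * cinner (T w) (T w')"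
proof -
  have "\<iota> h # w \<in> words" "\<iota> h' # w' \<in> words"
    using assms by (auto simp: Cons_in_words)
  moreover have "w \<in> words" "w' \<in> words"
    using assms base_words_in by auto
  ultimately show ?thesis
    by (simp add: T_inner prod.lessThan_Suc_shift inner_inj del: prod.lessThan_Suc)
qed

lemma T_Cons_orthogonal:
  assumes "cinner h e = 0" "w \<in> base_words" "w' \<in> base_words"
  shows "cinner (T (\<iota> h # w)) (T w') = 0" "cinner (T w') (T (\<iota> h # w)) = 0"
proof -
  show "cinner (T (\<iota> h # w)) (T w') = 0"
  proof (rule T_orthogonal)
    show "\<iota> h # w \<in> words" "w' \<in> words"
      using assms base_words_in by (auto simp: Cons_in_words)
    show "type_of (\<iota> h # w) \<noteq> type_of w'"
      using assms(3) by (cases w') (auto simp: base_words_def idx_inj)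
  qed
  thus "cinner (T w') (T (\<iota> h # w)) = 0"
    by (simp add: cinner_eq_0_commute)
qed

text \<open>The map \<open>h \<otimes> T w \<mapsto> lt h w\<close> is isometric: this is the identification of the free product with the
  tensor product of the leg and the span of the base words.  All linearity properties of \<open>T\<close> in the first
  letter follow, since a vector of norm 0 vanishes.\<close>

lemma lt_inner:
  assumes "w \<in> base_words" "w' \<in> base_words"
  shows "cinner (lt h w) (lt h' w') = cinner h h' * cinner (T w) (T w')"
proof -
  have orth: "cinner (h - cinner h e *\<^sub>C e) e = 0" for h
    by (simp add: cinner_simps cinner_e)
  have "cinner (h - cinner h e *\<^sub>C e) (h' - cinner h' e *\<^sub>C e) + cinner h e * cnj (cinner h' e)
      = cinner h h'"
    using cinner_commute[of e h'] by (simp add: cinner_simps cinner_e algebra_simps)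
  moreover have "cinner (lt h w) (lt h' w')
      = (cinner (h - cinner h e *\<^sub>C e) (h' - cinner h' e *\<^sub>C e) + cinner h e * cnj (cinner h' e))
        * cinner (T w) (T w')"
    unfolding left_tensor_def cinner_add_left cinner_add_right cinner_scaleC_left cinner_scaleC_right
      T_Cons_inner[OF orth orth assms] T_Cons_orthogonal[OF orth assms]
      T_Cons_orthogonal(2)[OF orth assms(2,1)]
    by (simp add: algebra_simps)
  ultimately show ?thesis
    by simp
qed

lemma lt_add: "w \<in> base_words \<Longrightarrow> lt (h + h') w = lt h w + lt h' w"
proof -
  assume w: "w \<in> base_words"
  have "cinner (lt (h + h') w - (lt h w + lt h' w)) (lt (h + h') w - (lt h w + lt h' w)) = 0"
    by (simp add: cinner_simps lt_inner[OF w w] algebra_simps)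
  thus ?thesis
    by simp
qed

lemma lt_scaleC: "w \<in> base_words \<Longrightarrow> lt (c *\<^sub>C h) w = c *\<^sub>C lt h w"
proof -
  assume w: "w \<in> base_words"
  have "cinner (lt (c *\<^sub>C h) w - c *\<^sub>C lt h w) (lt (c *\<^sub>C h) w - c *\<^sub>C lt h w) = 0"
    by (simp add: cinner_simps lt_inner[OF w w])
  thus ?thesis
    by simp
qed

lemma lt_diff: "w \<in> base_words \<Longrightarrow> lt (h - h') w = lt h w - lt h' w"
  using lt_add[of w "h - h'" h'] by simp

lemma T_zero_Cons: "w \<in> base_words \<Longrightarrow> T (\<iota> 0 # w) = 0"
  using T_Cons_inner[of 0 0 w w] by simp

lemma lt_e: "w \<in> base_words \<Longrightarrow> lt e w = T w"
  by (simp add: left_tensor_def cinner_e T_zero_Cons)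

lemma lt_orth: "cinner h e = 0 \<Longrightarrow> lt h w = T (\<iota> h # w)"
  by (simp add: left_tensor_def)

text \<open>The left tensors exhaust the elementary tensors, so they are total; a base word is its own tensor
  with the distinguished vector.\<close>

lemma T_eq_lt:
  assumes "w \<in> words"
  obtains h w' where "w' \<in> base_words" "T w = lt h w'"
    "type_of w = type_of w' \<or> type_of w = j # type_of w'"
  using assms
proof (cases rule: words_cases)
  case 1
  thus ?thesis
    using that[of w e] by (simp add: lt_e)
next
  case (2 h w')
  thus ?thesis
    using that[of w' h] by (simp add: lt_orth idx_inj)
qed

lemma lambda_lt:
  assumes "is_lambda \<xi>1 \<xi>2 T e \<iota> a A" "w \<in> base_words"
  shows "A (lt h w) = lt (a h) w"
  using assms by (auto simp: is_lambda_def base_words_def idx_inj)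

lemma bounded_selfadjoint_lambda:
  assumes A: "is_lambda \<xi>1 \<xi>2 T e \<iota> a A" and a: "bounded_selfadjoint a"
  shows "bounded_selfadjoint A"
proof (rule bounded_selfadjointI_total[OF _ total])
  show "bounded_clinear A"
    using A by (simp add: is_lambda_def)
  fix x y
  assume "x \<in> T ` words" "y \<in> T ` words"
  then obtain h w h' w' where w: "w \<in> base_words" "w' \<in> base_words" and xy: "x = lt h w" "y = lt h' w'"
    by (metis T_eq_lt imageE)
  show "cinner (A x) y = cinner x (A y)"
    using a unfolding xy lambda_lt[OF A w(1)] lambda_lt[OF A w(2)] lt_inner[OF w]
    by (simp add: bounded_selfadjoint_def)
qed

lemma lt_in_cspan_tensors:
  assumes w: "w \<in> base_words" and p: "p (type_of w)" "p (j # type_of w)"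
  shows "lt h w \<in> cspan (tensors p)"
proof -
  have "cinner (h - cinner h e *\<^sub>C e) e = 0"
    by (simp add: cinner_simps cinner_e)
  hence "\<iota> (h - cinner h e *\<^sub>C e) # w \<in> words"
    using w by (simp add: Cons_in_words)
  hence "T (\<iota> (h - cinner h e *\<^sub>C e) # w) \<in> tensors p"
    unfolding tensors_def using p by (intro imageI) (simp add: idx_inj)
  moreover have "T w \<in> tensors p"
    unfolding tensors_def using p w base_words_in by (intro imageI) simp
  ultimately show ?thesis
    unfolding left_tensor_def by (intro cvec.span_add cvec.span_scale cvec.span_base)
qed

lemma lambda_cspan_tensors:
  assumes A: "is_lambda \<xi>1 \<xi>2 T e \<iota> a A" and p: "leg_saturated j p"
    and w: "w \<in> words" "p (type_of w)"
  shows "A (T w) \<in> cspan (tensors p)"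
proof -
  obtain h w' where w': "w' \<in> base_words" "T w = lt h w'"
    "type_of w = type_of w' \<or> type_of w = j # type_of w'"
    using T_eq_lt[OF w(1)] .
  have "p (j # type_of w') = p (type_of w')"
    using p w'(1) by (auto simp: leg_saturated_def base_words_def hd_map)
  thus ?thesis
    unfolding w'(2) lambda_lt[OF A w'(1)] using w' w(2) by (intro lt_in_cspan_tensors) auto
qed

lemma proj_cspan_tensors:
  assumes "h \<in> cspan (tensors q)"
  shows "(\<And>i. q i \<Longrightarrow> p i) \<Longrightarrow> proj p h = h" "(\<And>i. q i \<Longrightarrow> \<not> p i) \<Longrightarrow> proj p h = 0"
  using assms
  by (induction rule: cspan_subspace_induct) (auto simp: tensors_def proj_T proj_linear)

lemma leg_saturated_not: "leg_saturated k p \<Longrightarrow> leg_saturated k (\<lambda>i. \<not> p i)"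
  by (simp add: leg_saturated_def)

text \<open>A saturated family and its complement are both preserved by the operator.\<close>

lemma proj_lambda_commute:
  assumes A: "is_lambda \<xi>1 \<xi>2 T e \<iota> a A" and p: "leg_saturated j p"
  shows "proj p (A h) = A (proj p h)"
proof -
  have cl: "bounded_clinear A"
    using A by (simp add: is_lambda_def)
  have "proj p \<circ> A = A \<circ> proj p"
  proof (rule operator_eqI)
    fix w
    assume w: "w \<in> words"
    show "(proj p \<circ> A) (T w) = (A \<circ> proj p) (T w)"
    proof (cases "p (type_of w)")
      case True
      thus ?thesis
        using proj_cspan_tensors(1)[OF lambda_cspan_tensors[OF A p w True]] w by (simp add: proj_T)
    next
      case False
      thus ?thesis
        using proj_cspan_tensors(2)[OF lambda_cspan_tensors[OF A leg_saturated_not[OF p] w False], of p] w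
        by (simp add: proj_T bounded_clinearD(4)[OF cl])
    qed
  qed (intro bounded_clinear_comp cl bounded_clinear_proj)+
  thus ?thesis
    by (metis comp_apply)
qed

end


section \<open>Boolean independence from a splitting of the space\<close>

lemma op_alg_splitting:
  fixes b :: "'h::chilbert_space \<Rightarrow> 'h"
  assumes b: "bounded_clinear b" and D: "cvec.subspace D" "\<And>h. h \<in> D \<Longrightarrow> b h \<in> D"
    and K: "\<And>h. h \<in> D' \<Longrightarrow> b h = cinner h \<xi> *\<^sub>C b \<xi>"
    and c: "c \<in> op_alg {b}"
  shows "bounded_clinear c \<and> (\<forall>h\<in>D. c h \<in> D) \<and> (\<forall>h\<in>D'. c h = cinner h \<xi> *\<^sub>C c \<xi>)"
  using c
proof induction
  case (gen c)
  thus ?case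
    using b D K by simp
next
  case (add c c')
  thus ?case
    using D(1) by (auto intro: bounded_clinear_add cvec.subspace_add simp: scaleC_add_right)
next
  case (scale c k)
  thus ?case
    using D(1) by (auto intro: bounded_clinear_scaleC cvec.subspace_scale simp: scaleC_scaleC mult.commute)
next
  case (mult c c')
  hence "bounded_clinear (c \<circ> c')"
    by (auto intro: bounded_clinear_comp)
  moreover have "(c \<circ> c') h = cinner h \<xi> *\<^sub>C (c \<circ> c') \<xi>" if "h \<in> D'" for h
  proof -
    have "c' h = cinner h \<xi> *\<^sub>C c' \<xi>"
      using mult.IH(2) that by blast
    thus ?thesis
      using mult.IH(1) by (simp add: bounded_clinearD(2))
  qed
  moreover have "\<forall>h\<in>D. (c \<circ> c') h \<in> D"
    using mult.IH by simp
  ultimately show ?case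
    by blast
qed

lemma op_product_Nil: "op_product [] = id"
  by (simp add: op_product_def)

lemma op_product_Cons: "op_product (c # cs) h = op_of c (op_product cs h)"
  by (simp add: op_product_def)

text \<open>The picture is an orthogonal sum \<open>\<complex>\<xi> \<oplus> K\<^sub>1 \<oplus> K\<^sub>2\<close> with \<open>D j = \<complex>\<xi> \<oplus> K\<^sub>j\<close>, where \<open>b j\<close> preserves \<open>D j\<close>
  and annihilates the other \<open>K\<close>.  The last hypothesis expresses the annihilation without naming \<open>K\<^sub>j\<close>.
  Applying an alternating product to \<open>\<xi>\<close> from the right, each factor meets a vector from the domain
  of the other variable and keeps only its component along \<open>\<xi>\<close>, which contributes one factor of the
  product of states.\<close>

lemma boolean_indepI:
  fixes b :: "idx \<Rightarrow> 'h::chilbert_space \<Rightarrow> 'h"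
  assumes \<xi>: "norm \<xi> = 1" "\<And>j. \<xi> \<in> D j" and b: "\<And>j. bounded_clinear (b j)"
    and D: "\<And>j. cvec.subspace (D j)" "\<And>j h. h \<in> D j \<Longrightarrow> b j h \<in> D j"
    and K: "\<And>j h. h \<in> D j \<Longrightarrow> b (bar j) h = cinner h \<xi> *\<^sub>C b (bar j) \<xi>"
  shows "boolean_indep \<xi> (b One) (b Two)"
proof -
  have split: "bounded_clinear c \<and> (\<forall>h\<in>D j. c h \<in> D j) \<and> (\<forall>h\<in>D (bar j). c h = cinner h \<xi> *\<^sub>C c \<xi>)"
    if "c \<in> op_alg {b j}" for c j
    by (rule op_alg_splitting[OF b D(1) D(2) _ that]) (use K[of _ "bar j"] in auto)
  have in_alg: "op_of c \<in> op_alg {b (idx_of c)}" if "c \<in> op_alg {b One} <+> op_alg {b Two}" for c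
    using that by auto
  have main: "op_product cs \<xi> \<in> D (idx_of (hd cs)) \<and>
      cinner (op_product cs \<xi>) \<xi> = (\<Prod>c\<leftarrow>cs. vector_state \<xi> (op_of c))"
    if "cs \<noteq> []" "alternating cs" "set cs \<subseteq> op_alg {b One} <+> op_alg {b Two}" for cs
    using that
  proof (induction cs)
    case (Cons c cs)
    have c: "op_of c \<in> op_alg {b (idx_of c)}"
      using Cons.prems by (intro in_alg) auto
    note c = split[OF c]
    have c\<xi>: "op_of c \<xi> \<in> D (idx_of c)"
      using c \<xi>(2) by blast
    note IH = Cons.IH and prems = Cons.prems
    show ?case
    proof (cases cs)
      case Nil
      thus ?thesis
        using c\<xi> by (simp add: op_product_Cons op_product_Nil vector_state_def)
    next
      case (Cons c' cs')
      have "idx_of (hd cs) = bar (idx_of c)" "alternating cs"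
        using prems(2) Cons neq_iff_eq_bar[of "idx_of c'" "idx_of c"]
        by (auto simp: alternating_def successively_Cons)
      moreover have "cs \<noteq> []" "set cs \<subseteq> op_alg {b One} <+> op_alg {b Two}"
        using prems(3) by (simp_all add: Cons)
      ultimately have cs: "op_product cs \<xi> \<in> D (bar (idx_of c))"
        "cinner (op_product cs \<xi>) \<xi> = (\<Prod>c\<leftarrow>cs. vector_state \<xi> (op_of c))"
        using IH by metis+
      have "op_product (c # cs) \<xi> = cinner (op_product cs \<xi>) \<xi> *\<^sub>C op_of c \<xi>"
        unfolding op_product_Cons using c cs(1) by blast
      thus ?thesis
        using c\<xi> cs(2) cvec.subspace_scale[OF D(1)]
        by (simp add: cinner_scaleC_left vector_state_def mult.commute)
    qed
  qed simp
  show ?thesis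
    unfolding boolean_indep_def using main by (auto simp: vector_state_def)
qed


section \<open>Free branches\<close>

lemma free_leg_One: "free_product_space \<xi>1 \<xi>2 \<xi> T \<Longrightarrow> free_leg \<xi>1 \<xi>2 \<xi> T \<xi>1 Inl One"
proof (unfold_locales; (simp; fail)?)
  show "\<exists>h. u = Inl h" if "idx_of u = One" for u :: "'a + 'b"
    using that by (cases u) auto
qed (auto simp: free_product_space_def)

lemma free_leg_Two: "free_product_space \<xi>1 \<xi>2 \<xi> T \<Longrightarrow> free_leg \<xi>1 \<xi>2 \<xi> T \<xi>2 Inr Two"
proof (unfold_locales; (simp; fail)?)
  show "\<exists>h. u = Inr h" if "idx_of u = Two" for u :: "'a + 'b"
    using that by (cases u) auto
qed (auto simp: free_product_space_def)

lemma leg_saturated_last: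
  "leg_saturated j (\<lambda>i. i = [] \<or> last i = j)" "leg_saturated (bar j) (\<lambda>i. i \<noteq> [] \<and> last i = j)"
  by (auto simp: leg_saturated_def)

locale free_pair = free_product \<xi>1 \<xi>2 \<xi> T
  for \<xi>1 :: "'a::chilbert_space" and \<xi>2 :: "'b::chilbert_space" and \<xi> :: "'h::chilbert_space"
    and T :: "('a + 'b) list \<Rightarrow> 'h" +
  fixes x1 :: "'a \<Rightarrow> 'a" and x2 :: "'b \<Rightarrow> 'b" and X :: "idx \<Rightarrow> 'h \<Rightarrow> 'h"
  assumes lambda1: "is_lambda \<xi>1 \<xi>2 T \<xi>1 Inl x1 (X One)"
    and lambda2: "is_lambda \<xi>1 \<xi>2 T \<xi>2 Inr x2 (X Two)"
    and selfadjoint1: "bounded_selfadjoint x1" and selfadjoint2: "bounded_selfadjoint x2"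
begin

sublocale leg1: free_leg \<xi>1 \<xi>2 \<xi> T \<xi>1 Inl One
  by (rule free_leg_One[OF space])

sublocale leg2: free_leg \<xi>1 \<xi>2 \<xi> T \<xi>2 Inr Two
  by (rule free_leg_Two[OF space])

lemma bounded_selfadjoint_X: "bounded_selfadjoint (X j)"
  using leg1.bounded_selfadjoint_lambda[OF lambda1 selfadjoint1]
    leg2.bounded_selfadjoint_lambda[OF lambda2 selfadjoint2] by (cases j) auto

lemma bounded_clinear_X: "bounded_clinear (X j)"
  using bounded_selfadjoint_X by (simp add: bounded_selfadjoint_def)

lemmas X_linear = bounded_clinearD[OF bounded_clinear_X]

lemma proj_X: "leg_saturated j p \<Longrightarrow> proj p (X j h) = X j (proj p h)"
  using leg1.proj_lambda_commute[OF lambda1] leg2.proj_lambda_commute[OF lambda2] by (cases j) auto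

lemma X_T_in_cspan:
  "leg_saturated j p \<Longrightarrow> w \<in> words \<Longrightarrow> p (type_of w) \<Longrightarrow> X j (T w) \<in> cspan (tensors p)"
  using leg1.lambda_cspan_tensors[OF lambda1] leg2.lambda_cspan_tensors[OF lambda2] by (cases j) auto

text \<open>The range of \<open>P\<^sub>j(n)\<close> is a saturated family, so one of the two projections can be absorbed.\<close>

lemma block_eq:
  assumes "n \<ge> 1"
  shows "block \<xi>1 \<xi>2 T X j n h = X j (proj (leg_class j n) h)"
  unfolding block_def Let_def orth_proj_leg[OF assms] comp_apply
    proj_X[OF leg_saturated_leg_class[OF assms]] proj_proj ..

lemma block_odd_sums:
  "(\<lambda>r. block \<xi>1 \<xi>2 T X j (2 * r + 1) h) sums X j (proj (\<lambda>i. i = [] \<or> last i = j) h)"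
proof -
  have "(\<lambda>r. proj (leg_class j (2 * r + 1)) h) sums proj (\<lambda>i. \<exists>r. leg_class j (2 * r + 1) i) h"
  proof (rule proj_sums)
    fix i m n
    assume "leg_class j (2 * m + 1) i" "leg_class j (2 * n + 1) i"
    thus "m = n"
      using leg_class_disjoint[of j "2 * m + 1" i "2 * n + 1"] by simp
  qed
  hence "(\<lambda>r. X j (proj (leg_class j (2 * r + 1)) h)) sums X j (proj (\<lambda>i. \<exists>r. leg_class j (2 * r + 1) i) h)"
    using bounded_clinear_X[of j] by (intro bounded_linear.sums[of "X j"]) (auto simp: bounded_clinear_def)
  moreover have "proj (\<lambda>i. \<exists>r. leg_class j (2 * r + 1) i) = proj (\<lambda>i. i = [] \<or> last i = j)"
    by (rule proj_cong[OF ex_odd_leg_class])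
  ultimately show ?thesis
    by (simp add: block_eq)
qed

lemma block_even_sums:
  "(\<lambda>r. block \<xi>1 \<xi>2 T X j (2 * r + 2) h) sums X j (proj (\<lambda>i. i \<noteq> [] \<and> last i = bar j) h)"
proof -
  have "(\<lambda>r. proj (leg_class j (2 * r + 2)) h) sums proj (\<lambda>i. \<exists>r. leg_class j (2 * r + 2) i) h"
  proof (rule proj_sums)
    fix i m n
    assume "leg_class j (2 * m + 2) i" "leg_class j (2 * n + 2) i"
    thus "m = n"
      using leg_class_disjoint[of j "2 * m + 2" i "2 * n + 2"] by simp
  qed
  hence "(\<lambda>r. X j (proj (leg_class j (2 * r + 2)) h)) sums X j (proj (\<lambda>i. \<exists>r. leg_class j (2 * r + 2) i) h)"
    using bounded_clinear_X[of j] by (intro bounded_linear.sums[of "X j"]) (auto simp: bounded_clinear_def)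
  moreover have "proj (\<lambda>i. \<exists>r. leg_class j (2 * r + 2) i) = proj (\<lambda>i. i \<noteq> [] \<and> last i = bar j)"
    by (rule proj_cong[OF ex_even_leg_class])
  ultimately show ?thesis
    by (simp add: block_eq)
qed

abbreviation branch :: "idx \<Rightarrow> 'h \<Rightarrow> 'h" where
  "branch \<equiv> free_branch \<xi>1 \<xi>2 T X"

lemma branch_eq:
  "branch j h = X j (proj (\<lambda>i. i = [] \<or> last i = j) h) + X (bar j) (proj (\<lambda>i. i \<noteq> [] \<and> last i = j) h)"
  using sums_unique[OF block_odd_sums[of j h]] sums_unique[OF block_even_sums[of "bar j" h]]
  by (simp add: free_branch_def)

lemma selfadjoint_X_proj:
  assumes "leg_saturated j p"
  shows "bounded_selfadjoint (\<lambda>h. X j (proj p h))"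
proof -
  have "bounded_clinear (\<lambda>h. X j (proj p h))"
    using bounded_clinear_comp[OF bounded_clinear_X bounded_clinear_proj] by (simp add: comp_def)
  thus ?thesis
    using bounded_selfadjointD(2)[OF bounded_selfadjoint_X] bounded_selfadjointD(2)[OF bounded_selfadjoint_proj]
    by (simp add: bounded_selfadjoint_def proj_X[OF assms])
qed

lemma bounded_selfadjoint_branch: "bounded_selfadjoint (branch j)"
proof -
  have "branch j = (\<lambda>h. X j (proj (\<lambda>i. i = [] \<or> last i = j) h) + X (bar j) (proj (\<lambda>i. i \<noteq> [] \<and> last i = j) h))"
    by (simp add: branch_eq fun_eq_iff)
  thus ?thesis
    using bounded_selfadjoint_add[OF selfadjoint_X_proj selfadjoint_X_proj] leg_saturated_last by simp
qed

lemma bounded_clinear_branch: "bounded_clinear (branch j)"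
  using bounded_selfadjoint_branch by (simp add: bounded_selfadjoint_def)

lemma X_split:
  "X j h = X j (proj (\<lambda>i. i = [] \<or> last i = j) h) + X j (proj (\<lambda>i. i \<noteq> [] \<and> last i = bar j) h)"
proof -
  have "proj (\<lambda>_. True) h = proj (\<lambda>i. i = [] \<or> last i = j) h + proj (\<lambda>i. i \<noteq> [] \<and> last i = bar j) h"
    by (rule proj_add) (auto simp: neq_iff_eq_bar)
  thus ?thesis
    by (simp add: proj_all flip: X_linear(1))
qed

lemma sum_eq_branches: "X One h + X Two h = branch One h + branch Two h"
  using X_split[of One h] X_split[of Two h] by (simp add: branch_eq)

text \<open>A nonempty tensor ending in \<open>j\<close> lies in the ranges of both families of projections that make up the
  branch \<open>j\<close>, a tensor with the other last index in neither, and the vacuum only in that of \<open>P\<^sub>j(1)\<close>.\<close>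

lemma branch_T:
  assumes "w \<in> words"
  shows "branch j (T w) = (if w = [] then X j (T w)
    else if idx_of (last w) = j then X j (T w) + X (bar j) (T w) else 0)"
  using assms by (simp add: branch_eq proj_T last_map X_linear)

text \<open>The vacuum and the tensors ending in \<open>j\<close>.  The algebraic span is preserved, as the
  operators map elementary tensors to finite combinations of such.\<close>

definition branch_space :: "idx \<Rightarrow> 'h set" where
  "branch_space j = cspan (tensors (\<lambda>i. i = [] \<or> last i = j))"

lemma subspace_branch_space: "cvec.subspace (branch_space j)"
  unfolding branch_space_def by (rule cvec.subspace_span)

lemma xi_in_branch_space: "\<xi> \<in> branch_space j"
  unfolding branch_space_def tensors_def
  by (intro cvec.span_base image_eqI[of _ _ "[]"]) (auto simp: T_Nil Nil_in_words)

lemma branch_in_branch_space: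
  assumes "h \<in> branch_space j"
  shows "branch j h \<in> branch_space j"
  using assms unfolding branch_space_def
proof (induction rule: cspan_subspace_induct)
  case (base h)
  then obtain w where w: "w \<in> words" "type_of w = [] \<or> last (type_of w) = j" "h = T w"
    by (auto simp: tensors_def)
  note X1 = X_T_in_cspan[OF leg_saturated_last(1) w(1,2)]
  show ?case
  proof (cases "w = []")
    case True
    thus ?thesis
      using X1 branch_T[OF w(1), of j] by (simp add: w(3))
  next
    case False
    hence "X (bar j) (T w) \<in> cspan (tensors (\<lambda>i. i \<noteq> [] \<and> last i = j))"
      using w by (intro X_T_in_cspan leg_saturated_last) auto
    also have "\<dots> \<subseteq> cspan (tensors (\<lambda>i. i = [] \<or> last i = j))"
      unfolding tensors_def by (intro cvec.span_mono image_mono) auto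
    finally show ?thesis
      using X1 False w(2) by (simp add: w(3) branch_T[OF w(1)] last_map cvec.span_add)
  qed
qed (auto simp: bounded_clinearD[OF bounded_clinear_branch] cvec.span_zero cvec.span_add cvec.span_scale)

lemma other_branch_on_branch_space:
  assumes "h \<in> branch_space j"
  shows "branch (bar j) h = cinner h \<xi> *\<^sub>C branch (bar j) \<xi>"
  using assms unfolding branch_space_def
proof (induction rule: cspan_subspace_induct)
  case (base h)
  then obtain w where w: "w \<in> words" "type_of w = [] \<or> last (type_of w) = j" "h = T w"
    by (auto simp: tensors_def)
  show ?case
  proof (cases "w = []")
    case True
    thus ?thesis
      using norm_xi by (simp add: w(3) T_Nil cinner_unit)
  next
    case False
    hence "cinner (T w) \<xi> = 0"
      using T_orthogonal[OF w(1) Nil_in_words] by (simp add: T_Nil)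
    thus ?thesis
      using False w(2) by (simp add: w(3) branch_T[OF w(1)] last_map)
  qed
qed (auto simp: bounded_clinearD[OF bounded_clinear_branch] cinner_simps scaleC_add_left scaleC_scaleC)

lemma boolean_indep_branches: "boolean_indep \<xi> (branch One) (branch Two)"
  by (rule boolean_indepI[where b = branch and D = branch_space, OF norm_xi xi_in_branch_space bounded_clinear_branch subspace_branch_space
        branch_in_branch_space other_branch_on_branch_space])

lemma branch_power_in_branch_space: "(branch j ^^ n) \<xi> \<in> branch_space j"
  by (induction n) (simp_all add: xi_in_branch_space branch_in_branch_space)

lemma other_branch_power:
  "branch (bar j) ((branch j ^^ n) \<xi>) = vector_state \<xi> (branch j ^^ n) *\<^sub>C branch (bar j) \<xi>"
  unfolding vector_state_def by (rule other_branch_on_branch_space[OF branch_power_in_branch_space])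

end


section \<open>Moments are determined by the two distributions\<close>

primrec letter :: "idx \<Rightarrow> nat \<Rightarrow> nat + nat" where
  "letter One k = Inl k"
| "letter Two k = Inr k"

lemma idx_of_letter [simp]: "idx_of (letter j k) = j"
  by (cases j) auto

lemma letter_exhaust: "\<exists>k. u = letter (idx_of u) k"
  by (cases u) auto

definition starts_off :: "idx \<Rightarrow> ('x + 'y) list \<Rightarrow> bool" where
  "starts_off j w \<longleftrightarrow> (w \<noteq> [] \<longrightarrow> idx_of (hd w) \<noteq> j)"

lemma alternating_Cons: "alternating (u # w) \<longleftrightarrow> alternating w \<and> starts_off (idx_of u) w"
  by (auto simp: alternating_def successively_Cons starts_off_def)

text \<open>The vector \<open>V [letter i\<^sub>1 k\<^sub>1, \<dots>, letter i\<^sub>n k\<^sub>n]\<close> stands for \<open>a\<^sub>1 \<cdots> a\<^sub>n \<xi>\<close> with the centered powers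
  \<open>a\<^sub>r = A i\<^sub>r ^^ k\<^sub>r - m i\<^sub>r k\<^sub>r\<close>.  The last axiom is the identity
  \<open>x (x\<^sup>k - m\<^sub>k) = (x\<^sup>k\<^sup>+\<^sup>1 - m\<^sub>k\<^sub>+\<^sub>1) + m\<^sub>k\<^sub>+\<^sub>1 - m\<^sub>k ((x - m\<^sub>1) + m\<^sub>1)\<close>, and freeness enters as the
  orthogonality of nonempty alternating words to \<open>\<xi>\<close>.\<close>

locale word_model =
  fixes m :: "idx \<Rightarrow> nat \<Rightarrow> complex" and \<xi> :: "'h::chilbert_space"
    and V :: "(nat + nat) list \<Rightarrow> 'h" and A :: "idx \<Rightarrow> 'h \<Rightarrow> 'h"
  assumes V_Nil: "V [] = \<xi>" and norm_xi: "norm \<xi> = 1"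
    and V_orth: "alternating w \<Longrightarrow> w \<noteq> [] \<Longrightarrow> cinner (V w) \<xi> = 0"
    and A_clinear: "bounded_clinear (A j)"
    and A_off: "alternating w \<Longrightarrow> starts_off j w \<Longrightarrow> A j (V w) = V (letter j 1 # w) + m j 1 *\<^sub>C V w"
    and A_on: "alternating w \<Longrightarrow> starts_off j w \<Longrightarrow> A j (V (letter j k # w)) =
      (V (letter j (Suc k) # w) + m j (Suc k) *\<^sub>C V w) - m j k *\<^sub>C (V (letter j 1 # w) + m j 1 *\<^sub>C V w)"

text \<open>Two models with the same \<open>m\<close> are compared through the span of the pairs of corresponding words.  It is
  a relation rather than a map because the vectors of a model need not be linearly independent.\<close>

inductive coupled :: "((nat + nat) list \<Rightarrow> 'h::chilbert_space) \<Rightarrow> ((nat + nat) list \<Rightarrow> 'g::chilbert_space) \<Rightarrow>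
    'h \<Rightarrow> 'g \<Rightarrow> bool" for V V' where
  word: "alternating w \<Longrightarrow> coupled V V' (V w) (V' w)"
| add: "coupled V V' v v' \<Longrightarrow> coupled V V' u u' \<Longrightarrow> coupled V V' (v + u) (v' + u')"
| scale: "coupled V V' v v' \<Longrightarrow> coupled V V' (c *\<^sub>C v) (c *\<^sub>C v')"

lemma coupled_zero: "coupled V V' 0 0"
  using coupled.scale[OF coupled.word[of "[]"], of V V' 0] by (simp add: alternating_def)

lemma coupled_diff: "coupled V V' v v' \<Longrightarrow> coupled V V' u u' \<Longrightarrow> coupled V V' (v - u) (v' - u')"
  using coupled.add[OF _ coupled.scale, of V V' v v' u u' "-1"] by (simp add: scaleC_minus1)

lemma coupled_generator:
  assumes "word_model m \<xi> V A" "word_model m \<xi>' V' A'" and w: "alternating w"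
  shows "coupled V V' (A j (V w)) (A' j (V' w))"
proof -
  interpret M: word_model m \<xi> V A
    by fact
  interpret M': word_model m \<xi>' V' A'
    by fact
  have alt: "alternating (letter j k # w)" if "alternating w" "starts_off j w" for k w
    using that by (simp add: alternating_Cons)
  show ?thesis
  proof (cases "starts_off j w")
    case True
    thus ?thesis
      using w alt[OF w True] by (auto simp: M.A_off M'.A_off intro!: coupled.intros)
  next
    case False
    then obtain u w' where uw: "w = u # w'" "idx_of u = j"
      by (cases w) (auto simp: starts_off_def)
    then obtain k where k: "w = letter j k # w'"
      using letter_exhaust by blast
    have w': "alternating w'" "starts_off j w'"
      using w by (auto simp: k alternating_Cons)
    show ?thesis
      unfolding k M.A_on[OF w'] M'.A_on[OF w']
      using w'(1) alt[OF w'] by (intro coupled_diff coupled.intros)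
  qed
qed

text \<open>The coupling is preserved by operators that are given by the same formula on words in both models, and
  coupled vectors have the same component along the vacuum.  The conditions \<open>c\<close> select on which words each
  of the two variables acts: always for the sum of the variables, according to the last letter for a free
  branch.\<close>

lemma word_model_moments_eq:
  assumes M: "word_model m \<xi> V A" and M': "word_model m \<xi>' V' A'"
    and D: "bounded_clinear D" "bounded_clinear D'"
    and V: "\<And>w. alternating w \<Longrightarrow>
      D (V w) = (if c One w then A One (V w) else 0) + (if c Two w then A Two (V w) else 0)"
    and V': "\<And>w. alternating w \<Longrightarrow>
      D' (V' w) = (if c One w then A' One (V' w) else 0) + (if c Two w then A' Two (V' w) else 0)"
  shows "vector_state \<xi> (D ^^ n) = vector_state \<xi>' (D' ^^ n)"
proof -
  interpret M: word_model m \<xi> V A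
    by fact
  interpret M': word_model m \<xi>' V' A'
    by fact
  have step: "coupled V V' (D v) (D' v')" if "coupled V V' v v'" for v v'
    using that
  proof induction
    case (word w)
    show ?case
      unfolding V[OF word] V'[OF word] using coupled_generator[OF M M' word]
      by (intro coupled.add) (auto simp: coupled_zero)
  qed (auto simp: bounded_clinearD[OF D(1)] bounded_clinearD[OF D(2)] intro: coupled.intros)
  have "coupled V V' ((D ^^ n) \<xi>) ((D' ^^ n) \<xi>')"
  proof (induction n)
    case 0
    show ?case
      using coupled.word[of "[]" V V'] by (simp add: M.V_Nil M'.V_Nil alternating_def)
  qed (simp add: step)
  moreover have "cinner v \<xi> = cinner v' \<xi>'" if "coupled V V' v v'" for v v'
    using that
  proof induction
    case (word w)
    thus ?case
      using M.V_orth M'.V_orth M.norm_xi M'.norm_xi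
      by (cases "w = []") (auto simp: M.V_Nil M'.V_Nil cinner_unit)
  qed (auto simp: cinner_simps)
  ultimately show ?thesis
    unfolding vector_state_def by blast
qed

primrec pair_moment :: "real measure \<Rightarrow> real measure \<Rightarrow> idx \<Rightarrow> nat \<Rightarrow> complex" where
  "pair_moment \<mu> \<nu> One k = complex_of_real (\<integral>x. x ^ k \<partial>\<mu>)"
| "pair_moment \<mu> \<nu> Two k = complex_of_real (\<integral>x. x ^ k \<partial>\<nu>)"

lemma has_distr_moment: "has_distr a \<xi> \<rho> \<Longrightarrow> cinner ((a ^^ k) \<xi>) \<xi> = complex_of_real (\<integral>x. x ^ k \<partial>\<rho>)"
  by (simp add: has_distr_def vector_state_def)


subsection \<open>Free variables\<close>

definition centered_power :: "(nat \<Rightarrow> complex) \<Rightarrow> ('h::chilbert_space \<Rightarrow> 'h) \<Rightarrow> nat \<Rightarrow> 'h \<Rightarrow> 'h" where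
  "centered_power m a k h = (a ^^ k) h - m k *\<^sub>C h"

lemma funpow_in_op_alg: "a ^^ k \<in> op_alg {id, a}"
proof (induction k)
  case 0
  show ?case
    by (simp add: op_alg.gen flip: id_def)
next
  case (Suc k)
  have "a \<circ> a ^^ k \<in> op_alg {id, a}"
    by (intro op_alg.mult Suc op_alg.gen) simp
  thus ?case
    by (simp add: id_def comp_def)
qed

lemma centered_power_in_op_alg: "centered_power m a k \<in> op_alg {id, a}"
proof -
  have "(\<lambda>h. (a ^^ k) h + (- m k) *\<^sub>C id h) \<in> op_alg {id, a}"
    by (intro op_alg.add op_alg.scale[of id] funpow_in_op_alg op_alg.gen) simp
  thus ?thesis
    by (simp add: centered_power_def[abs_def])
qed

text \<open>The model carried by an abstract free pair.\<close>

definition free_word :: "(idx \<Rightarrow> nat \<Rightarrow> complex) \<Rightarrow> 'h::chilbert_space \<Rightarrow> (idx \<Rightarrow> 'h \<Rightarrow> 'h) \<Rightarrow>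
    (nat + nat) list \<Rightarrow> 'h" where
  "free_word m \<xi> A w =
     op_product (map (map_sum (centered_power (m One) (A One)) (centered_power (m Two) (A Two))) w) \<xi>"

lemma free_word_Cons:
  "free_word m \<xi> A (letter j k # w) = (A j ^^ k) (free_word m \<xi> A w) - m j k *\<^sub>C free_word m \<xi> A w"
  by (cases j) (simp_all add: free_word_def op_product_Cons centered_power_def)

lemma idx_of_map_sum [simp]: "idx_of (map_sum f g u) = idx_of u"
  by (cases u) auto

lemma alternating_map_sum [simp]: "alternating (map (map_sum f g) w) \<longleftrightarrow> alternating w"
  by (simp add: alternating_def successively_map)

lemma word_model_free:
  fixes A :: "idx \<Rightarrow> 'h::chilbert_space \<Rightarrow> 'h"
  assumes \<xi>: "norm \<xi> = 1" and free: "free_indep \<xi> (A One) (A Two)"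
    and distr: "has_distr (A One) \<xi> \<mu>" "has_distr (A Two) \<xi> \<nu>"
  shows "word_model (pair_moment \<mu> \<nu>) \<xi> (free_word (pair_moment \<mu> \<nu>) \<xi> A) A"
proof
  let ?m = "pair_moment \<mu> \<nu>"
  let ?V = "free_word ?m \<xi> A"
  have mom: "cinner ((A j ^^ k) \<xi>) \<xi> = ?m j k" for j k
    using distr by (cases j) (simp_all add: has_distr_moment)
  show cl: "bounded_clinear (A j)" for j
    using distr by (cases j) (simp_all add: has_distr_def bounded_selfadjoint_def)
  show "?V [] = \<xi>"
    by (simp add: free_word_def op_product_Nil)
  show "cinner (?V w) \<xi> = 0" if w: "alternating w" "w \<noteq> []" for w
  proof -
    define f where "f = map_sum (centered_power (?m One) (A One)) (centered_power (?m Two) (A Two))"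
    have centered: "vector_state \<xi> (op_of (f u)) = 0" for u
      using mom[where j = One] mom[where j = Two] \<xi>
      by (cases u) (auto simp: f_def vector_state_def centered_power_def cinner_simps cinner_unit)
    have mem: "f u \<in> op_alg {id, A One} <+> op_alg {id, A Two}" for u
      by (cases u) (auto simp: f_def centered_power_in_op_alg)
    have "vector_state \<xi> (op_product (map f w)) = 0"
      using free[unfolded free_indep_def, rule_format, of "map f w"] centered mem w
      by (auto simp: f_def)
    thus ?thesis
      by (simp add: vector_state_def free_word_def f_def)
  qed
  show "A j (?V w) = ?V (letter j 1 # w) + ?m j 1 *\<^sub>C ?V w" for j w
    by (simp add: free_word_Cons)
  show "A j (?V (letter j k # w)) =
      (?V (letter j (Suc k) # w) + ?m j (Suc k) *\<^sub>C ?V w) - ?m j k *\<^sub>C (?V (letter j 1 # w) + ?m j 1 *\<^sub>C ?V w)"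
    for j w k
    by (simp add: free_word_Cons bounded_clinearD[OF cl])
qed (rule \<xi>)

text \<open>The moments of the sum are the same for all free pairs with the given distributions, so the
  description of the free convolution has only one solution.\<close>

lemma free_conv_eqI:
  fixes \<xi> :: "'h::chilbert_space"
  assumes \<xi>: "norm \<xi> = 1" and free: "free_indep \<xi> a b"
    and distr: "has_distr a \<xi> \<mu>" "has_distr b \<xi> \<nu>" "has_distr (\<lambda>h. a h + b h) \<xi> \<rho>"
  shows "free_conv TYPE('h) \<mu> \<nu> = \<rho>"
  unfolding free_conv_def
proof (rule the_equality)
  show "\<exists>(\<xi>::'h) a b. norm \<xi> = 1 \<and> free_indep \<xi> a b \<and>
      has_distr a \<xi> \<mu> \<and> has_distr b \<xi> \<nu> \<and> has_distr (\<lambda>h. a h + b h) \<xi> \<rho>"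
    using assms by blast
next
  fix \<rho>'
  assume "\<exists>(\<xi>::'h) a b. norm \<xi> = 1 \<and> free_indep \<xi> a b \<and>
      has_distr a \<xi> \<mu> \<and> has_distr b \<xi> \<nu> \<and> has_distr (\<lambda>h. a h + b h) \<xi> \<rho>'"
  then obtain \<xi>' :: 'h and a' b' where *: "norm \<xi>' = 1" "free_indep \<xi>' a' b'"
    "has_distr a' \<xi>' \<mu>" "has_distr b' \<xi>' \<nu>" "has_distr (\<lambda>h. a' h + b' h) \<xi>' \<rho>'"
    by blast
  define A where "A j = (if j = One then a else b)" for j
  define A' where "A' j = (if j = One then a' else b')" for j
  have M: "word_model (pair_moment \<mu> \<nu>) \<xi> (free_word (pair_moment \<mu> \<nu>) \<xi> A) A"
    by (rule word_model_free) (use assms in \<open>simp_all add: A_def\<close>)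
  have M': "word_model (pair_moment \<mu> \<nu>) \<xi>' (free_word (pair_moment \<mu> \<nu>) \<xi>' A') A'"
    by (rule word_model_free) (use * in \<open>simp_all add: A'_def\<close>)
  have "vector_state \<xi>' ((\<lambda>h. a' h + b' h) ^^ n) = vector_state \<xi> ((\<lambda>h. a h + b h) ^^ n)" for n
    by (rule word_model_moments_eq[OF M' M, where c = "\<lambda>_ _. True"])
       (use distr(3) *(5) in \<open>auto simp: A_def A'_def has_distr_def bounded_selfadjoint_def\<close>)
  with *(5) distr(3) show "\<rho>' = \<rho>"
    by (rule has_distr_unique)
qed


subsection \<open>The realization on the free product\<close>

context free_leg
begin

lemma is_lambda_op_alg:
  assumes A: "is_lambda \<xi>1 \<xi>2 T e \<iota> a A" and c: "c \<in> op_alg {id, A}"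
  shows "\<exists>c'. is_lambda \<xi>1 \<xi>2 T e \<iota> c' c"
proof -
  have lambda_iff: "is_lambda \<xi>1 \<xi>2 T e \<iota> c' c \<longleftrightarrow>
      bounded_clinear c \<and> (\<forall>h. \<forall>w\<in>base_words. c (lt h w) = lt (c' h) w)" for c' c
    by (auto simp: is_lambda_def base_words_def idx_inj)
  from c show ?thesis
  proof induction
    case (gen c)
    moreover have "is_lambda \<xi>1 \<xi>2 T e \<iota> id id"
      by (simp add: lambda_iff bounded_clinear_id)
    ultimately show ?case
      using A by auto
  next
    case (add c d)
    then obtain c' d' where "is_lambda \<xi>1 \<xi>2 T e \<iota> c' c" "is_lambda \<xi>1 \<xi>2 T e \<iota> d' d"
      by blast
    hence "is_lambda \<xi>1 \<xi>2 T e \<iota> (\<lambda>h. c' h + d' h) (\<lambda>h. c h + d h)"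
      by (simp add: lambda_iff lt_add bounded_clinear_add)
    thus ?case
      by blast
  next
    case (scale c k)
    then obtain c' where "is_lambda \<xi>1 \<xi>2 T e \<iota> c' c"
      by blast
    hence "is_lambda \<xi>1 \<xi>2 T e \<iota> (\<lambda>h. k *\<^sub>C c' h) (\<lambda>h. k *\<^sub>C c h)"
      by (simp add: lambda_iff lt_scaleC bounded_clinear_scaleC)
    thus ?case
      by blast
  next
    case (mult c d)
    then obtain c' d' where "is_lambda \<xi>1 \<xi>2 T e \<iota> c' c" "is_lambda \<xi>1 \<xi>2 T e \<iota> d' d"
      by blast
    hence "is_lambda \<xi>1 \<xi>2 T e \<iota> (c' \<circ> d') (c \<circ> d)"
      by (simp add: lambda_iff bounded_clinear_comp)
    thus ?case
      by blast
  qed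
qed

lemma Nil_in_base_words: "[] \<in> base_words"
  by (simp add: base_words_def Nil_in_words)

lemma cinner_lt_Nil: "cinner (lt h []) \<xi> = cinner h e"
  using lt_inner[OF Nil_in_base_words Nil_in_base_words, of h e] lt_e[OF Nil_in_base_words] norm_xi
  by (simp add: T_Nil cinner_unit)

lemma lambda_funpow_xi:
  assumes "is_lambda \<xi>1 \<xi>2 T e \<iota> a A"
  shows "(A ^^ n) \<xi> = lt ((a ^^ n) e) []"
  using lt_e[OF Nil_in_base_words] by (induction n) (simp_all add: T_Nil lambda_lt[OF assms Nil_in_base_words])

lemma has_distr_lambda:
  assumes A: "is_lambda \<xi>1 \<xi>2 T e \<iota> a A" and a: "has_distr a e \<mu>"
  shows "has_distr A \<xi> \<mu>"
  using a bounded_selfadjoint_lambda[OF A]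
  by (simp add: has_distr_def vector_state_def lambda_funpow_xi[OF A] cinner_lt_Nil)

text \<open>A centered element of the algebra of one leg creates a new first letter, because \<open>\<langle>c \<xi>, \<xi>\<rangle>\<close> is the
  component of the image of \<open>e\<close> along \<open>e\<close>.\<close>

lemma centered_lambda_word:
  assumes A: "is_lambda \<xi>1 \<xi>2 T e \<iota> a A" and c: "c \<in> op_alg {id, A}" "cinner (c \<xi>) \<xi> = 0"
    and w: "w \<in> base_words"
  shows "\<exists>w'\<in>words. type_of w' = j # type_of w \<and> c (T w) = T w'"
proof -
  obtain c' where c': "is_lambda \<xi>1 \<xi>2 T e \<iota> c' c"
    using is_lambda_op_alg[OF A c(1)] by blast
  have "c \<xi> = lt (c' e) []"
    using lambda_funpow_xi[OF c', of 1] by simp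
  hence orth: "cinner (c' e) e = 0"
    using c(2) by (simp add: cinner_lt_Nil)
  have "c (T w) = T (\<iota> (c' e) # w)"
    using lambda_lt[OF c' w, of e] by (simp add: lt_e[OF w] lt_orth[OF orth])
  moreover have "\<iota> (c' e) # w \<in> words"
    using orth w by (simp add: Cons_in_words)
  ultimately show ?thesis
    by (intro bexI[of _ "\<iota> (c' e) # w"]) (simp_all add: idx_inj)
qed

definition centered_vector :: "('k \<Rightarrow> 'k) \<Rightarrow> nat \<Rightarrow> 'k" where
  "centered_vector a k = (a ^^ k) e - cinner ((a ^^ k) e) e *\<^sub>C e"

lemma centered_vector_orth: "cinner (centered_vector a k) e = 0"
  by (simp add: centered_vector_def cinner_simps cinner_e)

lemma lt_power: "lt ((a ^^ k) e) w = T (\<iota> (centered_vector a k) # w) + cinner ((a ^^ k) e) e *\<^sub>C T w"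
  by (simp add: left_tensor_def centered_vector_def)

lemma lambda_off:
  assumes A: "is_lambda \<xi>1 \<xi>2 T e \<iota> a A" and w: "w \<in> base_words"
  shows "A (T w) = T (\<iota> (centered_vector a 1) # w) + cinner ((a ^^ 1) e) e *\<^sub>C T w"
  using lambda_lt[OF A w, of e] lt_power[where a = a and k = 1 and w = w] by (simp add: lt_e[OF w])

lemma lambda_on:
  assumes A: "is_lambda \<xi>1 \<xi>2 T e \<iota> a A" and a: "bounded_clinear a" and w: "w \<in> base_words"
  shows "A (T (\<iota> (centered_vector a k) # w)) =
    (T (\<iota> (centered_vector a (Suc k)) # w) + cinner ((a ^^ Suc k) e) e *\<^sub>C T w)
    - cinner ((a ^^ k) e) e *\<^sub>C (T (\<iota> (centered_vector a 1) # w) + cinner ((a ^^ 1) e) e *\<^sub>C T w)"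
proof -
  have "A (T (\<iota> (centered_vector a k) # w)) = lt (a (centered_vector a k)) w"
    using lambda_lt[OF A w, of "centered_vector a k"] by (simp add: lt_orth[OF centered_vector_orth])
  also have "a (centered_vector a k) = (a ^^ Suc k) e - cinner ((a ^^ k) e) e *\<^sub>C (a ^^ 1) e"
    by (simp add: centered_vector_def bounded_clinearD[OF a])
  also have "lt \<dots> w = lt ((a ^^ Suc k) e) w - cinner ((a ^^ k) e) e *\<^sub>C lt ((a ^^ 1) e) w"
    by (simp only: lt_diff[OF w] lt_scaleC[OF w])
  finally show ?thesis
    unfolding lt_power .
qed

end

context free_pair
begin

text \<open>An alternating product of centered elements, applied to the vacuum, builds up an elementary tensor letter
  by letter, and a nonempty tensor is orthogonal to the vacuum.\<close>

lemma free_indep_X: "free_indep \<xi> (X One) (X Two)"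
  unfolding free_indep_def
proof (intro allI impI)
  fix cs :: "(('h \<Rightarrow> 'h) + ('h \<Rightarrow> 'h)) list"
  assume cs: "cs \<noteq> []" "alternating cs" "set cs \<subseteq> op_alg {id, X One} <+> op_alg {id, X Two}"
    "\<forall>c\<in>set cs. vector_state \<xi> (op_of c) = 0"
  have "\<exists>w\<in>words. type_of w = map idx_of cs \<and> op_product cs \<xi> = T w"
    using cs(2-)
  proof (induction cs)
    case Nil
    thus ?case
      using Nil_in_words by (auto simp: op_product_Nil T_Nil)
  next
    case (Cons c cs)
    have "alternating cs" and off: "starts_off (idx_of c) cs"
      using Cons.prems(1) by (auto simp: alternating_Cons)
    then obtain w where w: "w \<in> words" "type_of w = map idx_of cs" "op_product cs \<xi> = T w"
      using Cons by auto
    have hd: "w \<noteq> [] \<longrightarrow> idx_of (hd w) \<noteq> idx_of c"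
      using off w(2) by (cases w; cases cs) (auto simp: starts_off_def)
    have zero: "cinner (op_of c \<xi>) \<xi> = 0"
      using Cons.prems by (simp add: vector_state_def)
    have "\<exists>w'\<in>words. type_of w' = idx_of c # type_of w \<and> op_of c (T w) = T w'"
    proof (cases c)
      case (Inl a)
      hence "a \<in> op_alg {id, X One}"
        using Cons.prems(2) by (auto simp: id_def)
      with leg1.centered_lambda_word[OF lambda1, of a w] show ?thesis
        using Inl w(1) hd zero by (simp add: leg1.base_words_def)
    next
      case (Inr a)
      hence "a \<in> op_alg {id, X Two}"
        using Cons.prems(2) by (auto simp: id_def)
      with leg2.centered_lambda_word[OF lambda2, of a w] show ?thesis
        using Inr w(1) hd zero by (simp add: leg2.base_words_def)
    qed
    thus ?case
      by (simp add: op_product_Cons w(2,3))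
  qed
  then obtain w where w: "w \<in> words" "type_of w = map idx_of cs" "op_product cs \<xi> = T w"
    by blast
  hence "cinner (T w) (T []) = 0"
    using cs(1) by (intro T_orthogonal Nil_in_words) auto
  thus "vector_state \<xi> (op_product cs) = 0"
    by (simp add: vector_state_def w(3) T_Nil)
qed

text \<open>The model carried by the free product itself.\<close>

definition tensor_word :: "(nat + nat) list \<Rightarrow> 'h" where
  "tensor_word w = T (map (map_sum (leg1.centered_vector x1) (leg2.centered_vector x2)) w)"

lemma tensor_word_in_words:
  assumes "alternating w"
  shows "map (map_sum (leg1.centered_vector x1) (leg2.centered_vector x2)) w \<in> words"
proof -
  have "case map_sum (leg1.centered_vector x1) (leg2.centered_vector x2) u of
      Inl a \<Rightarrow> cinner a \<xi>1 = 0 | Inr b \<Rightarrow> cinner b \<xi>2 = 0" for u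
    by (cases u) (simp_all add: leg1.centered_vector_orth leg2.centered_vector_orth)
  thus ?thesis
    using assms by (auto simp: reduced_def)
qed

lemma word_model_tensor_word:
  assumes distr: "has_distr x1 \<xi>1 \<mu>" "has_distr x2 \<xi>2 \<nu>"
  shows "word_model (pair_moment \<mu> \<nu>) \<xi> tensor_word X"
proof
  let ?f = "map_sum (leg1.centered_vector x1) (leg2.centered_vector x2)"
  have mom: "cinner ((x1 ^^ k) \<xi>1) \<xi>1 = pair_moment \<mu> \<nu> One k"
    "cinner ((x2 ^^ k) \<xi>2) \<xi>2 = pair_moment \<mu> \<nu> Two k" for k
    using distr by (simp_all add: has_distr_moment)
  have cl: "bounded_clinear x1" "bounded_clinear x2"
    using selfadjoint1 selfadjoint2 by (auto simp: bounded_selfadjoint_def)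
  have base: "map ?f w \<in> (case j of One \<Rightarrow> leg1.base_words | Two \<Rightarrow> leg2.base_words)"
    if "alternating w" "starts_off j w" for w j
    using that tensor_word_in_words[OF that(1)]
    by (cases j) (auto simp: leg1.base_words_def leg2.base_words_def starts_off_def hd_map)
  show "tensor_word [] = \<xi>"
    by (simp add: tensor_word_def T_Nil)
  show "cinner (tensor_word w) \<xi> = 0" if "alternating w" "w \<noteq> []" for w
    using T_orthogonal[OF tensor_word_in_words[OF that(1)] Nil_in_words] that
    by (simp add: tensor_word_def T_Nil)
  show "X j (tensor_word w) = tensor_word (letter j 1 # w) + pair_moment \<mu> \<nu> j 1 *\<^sub>C tensor_word w"
    if "alternating w" "starts_off j w" for w j
    using base[OF that] leg1.lambda_off[OF lambda1, of "map ?f w", unfolded mom]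
      leg2.lambda_off[OF lambda2, of "map ?f w", unfolded mom]
    by (cases j) (simp_all add: tensor_word_def)
  show "X j (tensor_word (letter j k # w)) =
      (tensor_word (letter j (Suc k) # w) + pair_moment \<mu> \<nu> j (Suc k) *\<^sub>C tensor_word w)
      - pair_moment \<mu> \<nu> j k *\<^sub>C (tensor_word (letter j 1 # w) + pair_moment \<mu> \<nu> j 1 *\<^sub>C tensor_word w)"
    if "alternating w" "starts_off j w" for w j k
    using base[OF that] leg1.lambda_on[OF lambda1 cl(1), of "map ?f w" k, unfolded mom]
      leg2.lambda_on[OF lambda2 cl(2), of "map ?f w" k, unfolded mom]
    by (cases j) (simp_all add: tensor_word_def)
qed (rule norm_xi bounded_clinear_X)+

lemma branch_tensor_word:
  assumes "alternating w"
  shows "branch One (tensor_word w) =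
    (if w = [] \<or> idx_of (last w) = One then X One (tensor_word w) else 0) +
    (if w \<noteq> [] \<and> idx_of (last w) = One then X Two (tensor_word w) else 0)"
  using branch_T[OF tensor_word_in_words[OF assms], of One] by (simp add: tensor_word_def last_map)

end

lemma free_pair_if_realization:
  assumes "free_realization \<mu> \<nu> \<xi>1 \<xi>2 \<xi> T x1 x2 X"
  shows "free_pair \<xi>1 \<xi>2 \<xi> T x1 x2 X"
  by unfold_locales (use assms in \<open>auto simp: free_realization_def has_distr_def\<close>)

lemma branch_moments_eq:
  assumes R: "free_realization \<mu> \<nu> \<xi>1 \<xi>2 \<xi> T x1 x2 X"
    and R': "free_realization \<mu> \<nu> \<xi>1' \<xi>2' \<xi>' T' x1' x2' X'"
  shows "vector_state \<xi> (free_branch \<xi>1 \<xi>2 T X One ^^ n) = vector_state \<xi>' (free_branch \<xi>1' \<xi>2' T' X' One ^^ n)"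
proof -
  interpret P: free_pair \<xi>1 \<xi>2 \<xi> T x1 x2 X
    by (rule free_pair_if_realization[OF R])
  interpret P': free_pair \<xi>1' \<xi>2' \<xi>' T' x1' x2' X'
    by (rule free_pair_if_realization[OF R'])
  have M: "word_model (pair_moment \<mu> \<nu>) \<xi> P.tensor_word X"
    by (rule P.word_model_tensor_word) (use R in \<open>auto simp: free_realization_def\<close>)
  have M': "word_model (pair_moment \<mu> \<nu>) \<xi>' P'.tensor_word X'"
    by (rule P'.word_model_tensor_word) (use R' in \<open>auto simp: free_realization_def\<close>)
  define c :: "idx \<Rightarrow> (nat + nat) list \<Rightarrow> bool" where
    "c j w \<longleftrightarrow> (w = [] \<and> j = One) \<or> (w \<noteq> [] \<and> idx_of (last w) = One)" for j w
  show ?thesis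
    by (rule word_model_moments_eq[OF M M' P.bounded_clinear_branch P'.bounded_clinear_branch, where c = c])
       (auto simp: P.branch_tensor_word P'.branch_tensor_word c_def)
qed

text \<open>The branch has the same moments in all realizations on the given spaces, which makes the description of
  the s-free convolution unambiguous.\<close>

lemma has_distr_s_free_conv:
  fixes \<xi>1 :: "'a::chilbert_space" and \<xi>2 :: "'b::chilbert_space" and \<xi> :: "'h::chilbert_space"
  assumes R: "free_realization \<mu> \<nu> \<xi>1 \<xi>2 \<xi> T x1 x2 X"
  shows "has_distr (free_branch \<xi>1 \<xi>2 T X One) \<xi> (s_free_conv TYPE('a \<times> 'b \<times> 'h) \<mu> \<nu>)"
proof -
  interpret P: free_pair \<xi>1 \<xi>2 \<xi> T x1 x2 X
    by (rule free_pair_if_realization[OF R])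
  obtain \<rho> where \<rho>: "has_distr (P.branch One) \<xi> \<rho>"
    using has_distr_exists[OF P.bounded_selfadjoint_branch P.norm_xi] by blast
  have branch: "(\<lambda>h. (\<Sum>r. block \<xi>1 \<xi>2 T X One (2 * r + 1) h) + (\<Sum>r. block \<xi>1 \<xi>2 T X Two (2 * (r + 1)) h))
      = free_branch \<xi>1 \<xi>2 T X One" for \<xi>1 :: 'a and \<xi>2 :: 'b and T :: "('a + 'b) list \<Rightarrow> 'h" and X
    by (simp add: free_branch_def fun_eq_iff)
  have "s_free_conv TYPE('a \<times> 'b \<times> 'h) \<mu> \<nu> = \<rho>"
    unfolding s_free_conv_def branch
  proof (rule the_equality)
    fix \<rho>'
    assume "\<exists>(\<xi>1::'a) (\<xi>2::'b) (\<xi>::'h) T x1 x2 X. free_realization \<mu> \<nu> \<xi>1 \<xi>2 \<xi> T x1 x2 X \<and>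
        has_distr (free_branch \<xi>1 \<xi>2 T X One) \<xi> \<rho>'"
    then obtain \<xi>1' :: 'a and \<xi>2' :: 'b and \<xi>' :: 'h and T' x1' x2' X'
      where R': "free_realization \<mu> \<nu> \<xi>1' \<xi>2' \<xi>' T' x1' x2' X'"
        and \<rho>': "has_distr (free_branch \<xi>1' \<xi>2' T' X' One) \<xi>' \<rho>'"
      by blast
    show "\<rho>' = \<rho>"
      by (rule has_distr_unique[OF \<rho>' \<rho> branch_moments_eq[OF R' R]])
  qed (use R \<rho> in blast)
  thus ?thesis
    using \<rho> by simp
qed


section \<open>Interchanging the two variables\<close>

definition swap_letter :: "'b + 'a \<Rightarrow> 'a + 'b" where
  "swap_letter = case_sum Inr Inl"

lemma swap_letter_simps [simp]: "swap_letter (Inl b) = Inr b" "swap_letter (Inr a) = Inl a"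
  by (simp_all add: swap_letter_def)

lemma swap_letter_swap_letter [simp]: "swap_letter (swap_letter u) = u"
  by (cases u) auto

lemma idx_of_swap_letter [simp]: "idx_of (swap_letter u) = bar (idx_of u)"
  by (cases u) auto

lemma letter_inner_swap [simp]: "letter_inner (swap_letter u) (swap_letter v) = letter_inner u v"
  by (cases u; cases v) auto

lemma bar_eq_iff: "bar i = bar j \<longleftrightarrow> i = j"
  by (cases i; cases j) auto

lemma map_swap_reduced: "map swap_letter w \<in> reduced \<xi>1 \<xi>2 \<longleftrightarrow> w \<in> reduced \<xi>2 \<xi>1"
proof -
  have "(case swap_letter u of Inl a \<Rightarrow> cinner a \<xi>1 = 0 | Inr b \<Rightarrow> cinner b \<xi>2 = 0) \<longleftrightarrow>
      (case u of Inl b \<Rightarrow> cinner b \<xi>2 = 0 | Inr a \<Rightarrow> cinner a \<xi>1 = 0)" for u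
    by (cases u) auto
  thus ?thesis
    by (simp add: reduced_def alternating_def successively_map bar_eq_iff)
qed

lemma map_swap_image:
  "map swap_letter ` {w \<in> reduced \<xi>2 \<xi>1. P (map swap_letter w)} = {w \<in> reduced \<xi>1 \<xi>2. P w}"
proof (intro equalityI subsetI)
  fix w
  assume w: "w \<in> {w \<in> reduced \<xi>1 \<xi>2. P w}"
  have "map swap_letter (map swap_letter w) = w"
    by (simp add: comp_def)
  moreover from this have "map swap_letter w \<in> reduced \<xi>2 \<xi>1"
    using w map_swap_reduced[of "map swap_letter w" \<xi>1 \<xi>2] by simp
  ultimately show "w \<in> map swap_letter ` {w \<in> reduced \<xi>2 \<xi>1. P (map swap_letter w)}"
    using w by (intro image_eqI[of _ _ "map swap_letter w"]) auto
qed (auto simp: map_swap_reduced)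

lemma level_swap: "level \<xi>2 \<xi>1 (T \<circ> map swap_letter) j n = level \<xi>1 \<xi>2 T (bar j) n"
proof -
  have "{w \<in> reduced \<xi>2 \<xi>1. length w = n \<and> (w \<noteq> [] \<longrightarrow> idx_of (hd w) \<noteq> j)}
      = {w \<in> reduced \<xi>2 \<xi>1. length (map swap_letter w) = n \<and>
          (map swap_letter w \<noteq> [] \<longrightarrow> idx_of (hd (map swap_letter w)) \<noteq> bar j)}"
    by (auto simp: hd_map bar_eq_iff)
  thus ?thesis
    unfolding level_def image_comp[symmetric]
    using map_swap_image[of \<xi>2 \<xi>1 "\<lambda>w. length w = n \<and> (w \<noteq> [] \<longrightarrow> idx_of (hd w) \<noteq> bar j)"]
    by simp
qed

lemma block_swap: "block \<xi>2 \<xi>1 (T \<circ> map swap_letter) (X \<circ> bar) j n = block \<xi>1 \<xi>2 T X (bar j) n"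
  by (simp add: block_def level_swap)

lemma free_branch_swap:
  "free_branch \<xi>2 \<xi>1 (T \<circ> map swap_letter) (X \<circ> bar) j = free_branch \<xi>1 \<xi>2 T X (bar j)"
  by (simp add: free_branch_def block_swap fun_eq_iff)

text \<open>The free product does not distinguish its two factors, so every statement about the first branch
  yields one about the second.\<close>

lemma free_realization_swap:
  assumes R: "free_realization \<mu> \<nu> \<xi>1 \<xi>2 \<xi> T x1 x2 X"
  shows "free_realization \<nu> \<mu> \<xi>2 \<xi>1 \<xi> (T \<circ> map swap_letter) x2 x1 (X \<circ> bar)"
proof -
  have space: "free_product_space \<xi>1 \<xi>2 \<xi> T"
    and lam: "is_lambda \<xi>1 \<xi>2 T \<xi>1 Inl x1 (X One)" "is_lambda \<xi>1 \<xi>2 T \<xi>2 Inr x2 (X Two)"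
    using R by (auto simp: free_realization_def)
  have "(T \<circ> map swap_letter) ` reduced \<xi>2 \<xi>1 = T ` reduced \<xi>1 \<xi>2"
    unfolding image_comp[symmetric] using map_swap_image[of \<xi>2 \<xi>1 "\<lambda>_. True"] by simp
  moreover have "cinner (T (map swap_letter w)) (T (map swap_letter w')) =
      (if length w = length w' then \<Prod>k<length w. letter_inner (w ! k) (w' ! k) else 0)"
    if "w \<in> reduced \<xi>2 \<xi>1" "w' \<in> reduced \<xi>2 \<xi>1" for w w'
    using free_product.T_inner[OF free_product.intro[OF space], of "map swap_letter w" "map swap_letter w'"] that
    by (auto simp: map_swap_reduced)
  ultimately have "free_product_space \<xi>2 \<xi>1 \<xi> (T \<circ> map swap_letter)"
    using space by (simp add: free_product_space_def)
  moreover have "is_lambda \<xi>2 \<xi>1 (T \<circ> map swap_letter) e \<iota> a A"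
    if "is_lambda \<xi>1 \<xi>2 T e (swap_letter \<circ> \<iota>) a A"
    for e :: "'k::chilbert_space" and \<iota> a A
  proof -
    have lt: "left_tensor e \<iota> (T \<circ> map swap_letter) h w = left_tensor e (swap_letter \<circ> \<iota>) T h (map swap_letter w)" for h w
      by (simp add: left_tensor_def)
    show ?thesis
      using that unfolding is_lambda_def lt
      by (auto simp: map_swap_reduced hd_map bar_eq_iff)
  qed
  from this[of \<xi>2 Inl x2 "X Two"] this[of \<xi>1 Inr x1 "X One"] lam
  have "is_lambda \<xi>2 \<xi>1 (T \<circ> map swap_letter) \<xi>2 Inl x2 (X Two)"
    "is_lambda \<xi>2 \<xi>1 (T \<circ> map swap_letter) \<xi>1 Inr x1 (X One)"
    by (simp_all add: comp_def)
  ultimately show ?thesis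
    using R by (simp add: free_realization_def)
qed


section \<open>The decomposition of the free convolution\<close>

theorem lemma9p1:
  fixes \<mu> \<nu> :: "real measure"
    and \<xi>1 :: "'a::chilbert_space" and \<xi>2 :: "'b::chilbert_space" and \<xi> :: "'h::chilbert_space"
    and T :: "('a + 'b) list \<Rightarrow> 'h"
    and x1 :: "'a \<Rightarrow> 'a" and x2 :: "'b \<Rightarrow> 'b" and X B :: "idx \<Rightarrow> 'h \<Rightarrow> 'h"
  assumes "compact_prob \<mu>" and "compact_prob \<nu>"
    and "free_realization \<mu> \<nu> \<xi>1 \<xi>2 \<xi> T x1 x2 X"
    and "B = free_branch \<xi>1 \<xi>2 T X"
  shows "(\<forall>j h. summable (\<lambda>r. block \<xi>1 \<xi>2 T X j (2 * r + 1) h) \<and>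
                summable (\<lambda>r. block \<xi>1 \<xi>2 T X j (2 * r + 2) h)) \<and>
         (\<forall>h. X One h + X Two h = B One h + B Two h) \<and>
         boolean_indep \<xi> (B One) (B Two) \<and>
         has_distr (\<lambda>h. X One h + X Two h) \<xi> (free_conv TYPE('h) \<mu> \<nu>) \<and>
         has_distr (B One) \<xi> (s_free_conv TYPE('a \<times> 'b \<times> 'h) \<mu> \<nu>) \<and>
         has_distr (B Two) \<xi> (s_free_conv TYPE('b \<times> 'a \<times> 'h) \<nu> \<mu>) \<and>
         free_conv TYPE('h) \<mu> \<nu> =
           s_free_conv TYPE('a \<times> 'b \<times> 'h) \<mu> \<nu> \<uplus> s_free_conv TYPE('b \<times> 'a \<times> 'h) \<nu> \<mu>"
proof -
  note R = assms(3)
  interpret P: free_pair \<xi>1 \<xi>2 \<xi> T x1 x2 X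
    by (rule free_pair_if_realization[OF R])
  have B: "B = P.branch"
    by (rule assms(4))
  have distr: "has_distr (X One) \<xi> \<mu>" "has_distr (X Two) \<xi> \<nu>"
    using R P.leg1.has_distr_lambda[OF P.lambda1] P.leg2.has_distr_lambda[OF P.lambda2]
    by (auto simp: free_realization_def)
  obtain \<rho> where \<rho>: "has_distr (\<lambda>h. X One h + X Two h) \<xi> \<rho>"
    using has_distr_exists[OF bounded_selfadjoint_add[OF P.bounded_selfadjoint_X P.bounded_selfadjoint_X] P.norm_xi]
    by blast
  have free: "free_conv TYPE('h) \<mu> \<nu> = \<rho>"
    by (rule free_conv_eqI[OF P.norm_xi P.free_indep_X distr \<rho>])
  have B1: "has_distr (B One) \<xi> (s_free_conv TYPE('a \<times> 'b \<times> 'h) \<mu> \<nu>)"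
    unfolding B by (rule has_distr_s_free_conv[OF R])
  have B2: "has_distr (B Two) \<xi> (s_free_conv TYPE('b \<times> 'a \<times> 'h) \<nu> \<mu>)"
    using has_distr_s_free_conv[OF free_realization_swap[OF R]] by (simp add: B free_branch_swap)
  have sum: "(\<lambda>h. X One h + X Two h) = (\<lambda>h. B One h + B Two h)"
    by (simp add: B P.sum_eq_branches fun_eq_iff)
  have "s_free_conv TYPE('a \<times> 'b \<times> 'h) \<mu> \<nu> \<uplus> s_free_conv TYPE('b \<times> 'a \<times> 'h) \<nu> \<mu> = \<rho>"
  proof (rule boolean_conv_eqI)
    show "real_distribution \<rho>"
      using \<rho> by (simp add: has_distr_def compact_prob_def)
    show "K_transform \<rho> z = K_transform (s_free_conv TYPE('a \<times> 'b \<times> 'h) \<mu> \<nu>) z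
        + K_transform (s_free_conv TYPE('b \<times> 'a \<times> 'h) \<nu> \<mu>) z" if "Im z > 0" for z
      using P.other_branch_power[of One] P.other_branch_power[of Two] that
      by (intro K_transform_additive[OF P.norm_xi B1 B2 \<rho>[unfolded sum]]) (simp_all add: B)
  qed
  thus ?thesis
    using P.block_odd_sums P.block_even_sums P.sum_eq_branches P.boolean_indep_branches \<rho> B1 B2
    by (auto simp: free B sums_iff)
qed

end
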